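(* Let $J$ be a Jordan algebra over a field $\mathbb{F}$ of characteristic not $2$ (not assumed unital), generated as an $\mathbb{F}$-algebra by two distinct idempotents $a$ and $b$. Denote the multiplication in $J$ by $x\cdot y$ and put $\sigma:=(a-b)^2=(a-b)\cdot(a-b)$. Then: (1) $\sigma$ is in the center of $J$; (2) $J$ is spanned by $a$, $b$ and $\sigma$ as a module over $\mathbb{F}[\sigma]$; (3) if the Jordan algebra $J$ is simple, then either $J=\mathbb{F}$ or $J\cong\mathcal{H}(A,* )$, the Jordan algebra of symmetric elements $x^*=x$ of $A$, where $A$ is a simple associative $\mathbb{F}$-algebra generated by two distinct idempotents $e,f$ (so that $A$ is unital with identity $\mathbf{1}$, $\mathbb{F}[\sigma_A]$ is a field, where $\sigma_A:=(e-f)^2$, and either $A=\mathbb{F}\mathbf{1}$ or $A\cong M_2(\mathbb{F}[\sigma_A])$), and $*$ is the involution on $A$ given by $$(\alpha_1\sigma_A+\alpha_2 e+\alpha_3 f+\alpha_4(ef))^*=\alpha_1\sigma_A+\alpha_2 e+\alpha_3 f+\alpha_4(fe)\qquad(\alpha_1,\dots,\alpha_4\in\mathbb{F}[\sigma_A]).$$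
   Context: For an algebra $B$ over $\mathbb{F}$, let $B^{(1)}:=B$ if $B$ is unital, and otherwise $B^{(1)}:=\mathbb{F}\oplus B$ with multiplication $(\alpha,x)(\beta,y)=(\alpha\beta,\alpha y+\beta x+xy)$, with $B$ identified with $\{(0,x)\mid x\in B\}$; $\mathbf{1}$ is the identity of $B^{(1)}$. For $x\in B$ (with $B$ power associative), $\mathbb{F}[x]\subseteq B^{(1)}$ is the set of polynomials in $x$ with coefficients in $\mathbb{F}$, where $x^0=\mathbf{1}$. For a (not necessarily associative) algebra $B$ with commutator $[x,y]=xy-yx$ and associator $[x,y,z]=(xy)z-x(yz)$, the nucleus is $\{x\in B\mid [x,B,B]=[B,x,B]=[B,B,x]=0\}$ and the center of $B$ is the set of elements $c$ of the nucleus with $[c,B]=0$. An algebra is simple if its multiplication is not identically zero and its only proper ideal is $\{0\}$. For an associative algebra $A$, $A^+$ denotes the Jordan algebra on the same module with product $x\cdot y=\tfrac12(xy+yx)$. An involution on an associative algebra is an anti-automorphism $*$ with $x^{**}=x$; given an involution $*$ on $A$, $\mathcal{H}(A,* )=\{x\in A\mid x^*=x\}$, regarded as a subalgebra of $A^+$. A simple associative algebra generated by two distinct idempotents $e,f$ is spanned by $\sigma_A,e,f,ef$ over $\mathbb{F}[\sigma_A]$. "$J=\mathbb{F}$" means that $J$ is the one-dimensional algebra $\mathbb{F}\mathbf{1}$. *)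

theory Defs
  imports "HOL-Algebra.Algebra"
begin

text \<open>
  A not necessarily associative, not necessarily unital algebra over a field is carried by the
  record type of \<^locale>\<open>module\<close>. Its field \<open>one\<close> is meaningless unless it is explicitly required
  to be an identity.
\<close>

locale na_algebra = K?: field F + module F B for F (structure) and B (structure) +
  assumes mult_closed: "\<lbrakk>x \<in> carrier B; y \<in> carrier B\<rbrakk> \<Longrightarrow> x \<otimes>\<^bsub>B\<^esub> y \<in> carrier B"
    and mult_l_distr: "\<lbrakk>x \<in> carrier B; y \<in> carrier B; z \<in> carrier B\<rbrakk>
      \<Longrightarrow> (x \<oplus>\<^bsub>B\<^esub> y) \<otimes>\<^bsub>B\<^esub> z = x \<otimes>\<^bsub>B\<^esub> z \<oplus>\<^bsub>B\<^esub> y \<otimes>\<^bsub>B\<^esub> z"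
    and mult_r_distr: "\<lbrakk>x \<in> carrier B; y \<in> carrier B; z \<in> carrier B\<rbrakk>
      \<Longrightarrow> z \<otimes>\<^bsub>B\<^esub> (x \<oplus>\<^bsub>B\<^esub> y) = z \<otimes>\<^bsub>B\<^esub> x \<oplus>\<^bsub>B\<^esub> z \<otimes>\<^bsub>B\<^esub> y"
    and mult_l_smult: "\<lbrakk>\<alpha> \<in> carrier F; x \<in> carrier B; y \<in> carrier B\<rbrakk>
      \<Longrightarrow> (\<alpha> \<odot>\<^bsub>B\<^esub> x) \<otimes>\<^bsub>B\<^esub> y = \<alpha> \<odot>\<^bsub>B\<^esub> (x \<otimes>\<^bsub>B\<^esub> y)"
    and mult_r_smult: "\<lbrakk>\<alpha> \<in> carrier F; x \<in> carrier B; y \<in> carrier B\<rbrakk>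
      \<Longrightarrow> x \<otimes>\<^bsub>B\<^esub> (\<alpha> \<odot>\<^bsub>B\<^esub> y) = \<alpha> \<odot>\<^bsub>B\<^esub> (x \<otimes>\<^bsub>B\<^esub> y)"

locale assoc_algebra = na_algebra +
  assumes mult_assoc: "\<lbrakk>x \<in> carrier B; y \<in> carrier B; z \<in> carrier B\<rbrakk>
      \<Longrightarrow> (x \<otimes>\<^bsub>B\<^esub> y) \<otimes>\<^bsub>B\<^esub> z = x \<otimes>\<^bsub>B\<^esub> (y \<otimes>\<^bsub>B\<^esub> z)"

locale jordan_algebra = na_algebra +
  assumes mult_comm: "\<lbrakk>x \<in> carrier B; y \<in> carrier B\<rbrakk> \<Longrightarrow> x \<otimes>\<^bsub>B\<^esub> y = y \<otimes>\<^bsub>B\<^esub> x"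
    and jordan_identity: "\<lbrakk>x \<in> carrier B; y \<in> carrier B\<rbrakk>
      \<Longrightarrow> ((x \<otimes>\<^bsub>B\<^esub> x) \<otimes>\<^bsub>B\<^esub> y) \<otimes>\<^bsub>B\<^esub> x = (x \<otimes>\<^bsub>B\<^esub> x) \<otimes>\<^bsub>B\<^esub> (y \<otimes>\<^bsub>B\<^esub> x)"

definition na_subalgebra :: "('f, 'm) ring_scheme \<Rightarrow> ('f, 'b, 'n) module_scheme \<Rightarrow> 'b set \<Rightarrow> bool" where
  "na_subalgebra F B S \<longleftrightarrow> submodule S F B \<and> (\<forall>x\<in>S. \<forall>y\<in>S. x \<otimes>\<^bsub>B\<^esub> y \<in> S)"

definition generated_subalgebra ::
    "('f, 'm) ring_scheme \<Rightarrow> ('f, 'b, 'n) module_scheme \<Rightarrow> 'b set \<Rightarrow> 'b set" where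
  "generated_subalgebra F B G = \<Inter>{S. na_subalgebra F B S \<and> G \<subseteq> S}"

definition generated_by_idempotents ::
    "('f, 'm) ring_scheme \<Rightarrow> ('f, 'b, 'n) module_scheme \<Rightarrow> 'b \<Rightarrow> 'b \<Rightarrow> bool" where
  "generated_by_idempotents F B e f \<longleftrightarrow>
     e \<in> carrier B \<and> f \<in> carrier B \<and> e \<noteq> f \<and> e \<otimes>\<^bsub>B\<^esub> e = e \<and> f \<otimes>\<^bsub>B\<^esub> f = f \<and>
     generated_subalgebra F B {e, f} = carrier B"

definition algebra_ideal :: "('f, 'm) ring_scheme \<Rightarrow> ('f, 'b, 'n) module_scheme \<Rightarrow> 'b set \<Rightarrow> bool" where
  "algebra_ideal F B I \<longleftrightarrow> submodule I F B \<and>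
     (\<forall>x\<in>carrier B. \<forall>y\<in>I. x \<otimes>\<^bsub>B\<^esub> y \<in> I \<and> y \<otimes>\<^bsub>B\<^esub> x \<in> I)"

definition simple_algebra :: "('f, 'm) ring_scheme \<Rightarrow> ('f, 'b, 'n) module_scheme \<Rightarrow> bool" where
  "simple_algebra F B \<longleftrightarrow>
     (\<exists>x\<in>carrier B. \<exists>y\<in>carrier B. x \<otimes>\<^bsub>B\<^esub> y \<noteq> \<zero>\<^bsub>B\<^esub>) \<and>
     (\<forall>I. algebra_ideal F B I \<and> I \<noteq> carrier B \<longrightarrow> I = {\<zero>\<^bsub>B\<^esub>})"

definition commutator :: "('f, 'b, 'n) module_scheme \<Rightarrow> 'b \<Rightarrow> 'b \<Rightarrow> 'b" where
  "commutator B x y = x \<otimes>\<^bsub>B\<^esub> y \<ominus>\<^bsub>B\<^esub> y \<otimes>\<^bsub>B\<^esub> x"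

definition associator :: "('f, 'b, 'n) module_scheme \<Rightarrow> 'b \<Rightarrow> 'b \<Rightarrow> 'b \<Rightarrow> 'b" where
  "associator B x y z = (x \<otimes>\<^bsub>B\<^esub> y) \<otimes>\<^bsub>B\<^esub> z \<ominus>\<^bsub>B\<^esub> x \<otimes>\<^bsub>B\<^esub> (y \<otimes>\<^bsub>B\<^esub> z)"

definition nucleus :: "('f, 'b, 'n) module_scheme \<Rightarrow> 'b set" where
  "nucleus B = {x \<in> carrier B. \<forall>y\<in>carrier B. \<forall>z\<in>carrier B.
     associator B x y z = \<zero>\<^bsub>B\<^esub> \<and> associator B y x z = \<zero>\<^bsub>B\<^esub> \<and> associator B y z x = \<zero>\<^bsub>B\<^esub>}"

definition center :: "('f, 'b, 'n) module_scheme \<Rightarrow> 'b set" where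
  "center B = {c \<in> nucleus B. \<forall>x\<in>carrier B. commutator B c x = \<zero>\<^bsub>B\<^esub>}"

definition is_identity :: "('f, 'b, 'n) module_scheme \<Rightarrow> 'b \<Rightarrow> bool" where
  "is_identity B u \<longleftrightarrow> u \<in> carrier B \<and> (\<forall>x\<in>carrier B. u \<otimes>\<^bsub>B\<^esub> x = x \<and> x \<otimes>\<^bsub>B\<^esub> u = x)"

definition is_scalar_algebra :: "('f, 'm) ring_scheme \<Rightarrow> ('f, 'b, 'n) module_scheme \<Rightarrow> bool" where
  "is_scalar_algebra F B \<longleftrightarrow>
     (\<exists>u. is_identity B u \<and> u \<noteq> \<zero>\<^bsub>B\<^esub> \<and> carrier B = {\<alpha> \<odot>\<^bsub>B\<^esub> u | \<alpha>. \<alpha> \<in> carrier F})"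

text \<open>
  The algebra $B^{(1)}$. To have one type in both cases, a unital $B$ is represented by its copy
  $\{0\} \times B$, so that \<open>hull_emb\<close> is always the identification of $B$ with a subset of
  $B^{(1)}$, and it is onto when $B$ is unital.
\<close>

definition unital_hull ::
    "('f, 'm) ring_scheme \<Rightarrow> ('f, 'b, 'n) module_scheme \<Rightarrow> ('f, 'f \<times> 'b) module" where
  "unital_hull F B =
     \<lparr>carrier = (if \<exists>u. is_identity B u then {\<zero>\<^bsub>F\<^esub>} else carrier F) \<times> carrier B,
      monoid.mult = (\<lambda>(\<alpha>, x) (\<beta>, y).
        (\<alpha> \<otimes>\<^bsub>F\<^esub> \<beta>, (\<alpha> \<odot>\<^bsub>B\<^esub> y \<oplus>\<^bsub>B\<^esub> \<beta> \<odot>\<^bsub>B\<^esub> x) \<oplus>\<^bsub>B\<^esub> x \<otimes>\<^bsub>B\<^esub> y)),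
      monoid.one = (if \<exists>u. is_identity B u then (\<zero>\<^bsub>F\<^esub>, THE u. is_identity B u) else (\<one>\<^bsub>F\<^esub>, \<zero>\<^bsub>B\<^esub>)),
      ring.zero = (\<zero>\<^bsub>F\<^esub>, \<zero>\<^bsub>B\<^esub>),
      ring.add = (\<lambda>(\<alpha>, x) (\<beta>, y). (\<alpha> \<oplus>\<^bsub>F\<^esub> \<beta>, x \<oplus>\<^bsub>B\<^esub> y)),
      module.smult = (\<lambda>\<gamma> (\<alpha>, x). (\<gamma> \<otimes>\<^bsub>F\<^esub> \<alpha>, \<gamma> \<odot>\<^bsub>B\<^esub> x))\<rparr>"

definition hull_emb :: "('f, 'm) ring_scheme \<Rightarrow> 'b \<Rightarrow> 'f \<times> 'b" where
  "hull_emb F x = (\<zero>\<^bsub>F\<^esub>, x)"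

text \<open>
  $\mathbb{F}[x]$ as a substructure of $B$. It is to be used only when \<open>\<one>\<^bsub>B\<^esub>\<close> is the identity of
  $B$ (since $x^0 = \<one>$), in particular when $B$ is a \<^const>\<open>unital_hull\<close>.
\<close>

definition polys ::
    "('f, 'm) ring_scheme \<Rightarrow> ('f, 'b, 'n) module_scheme \<Rightarrow> 'b \<Rightarrow> ('f, 'b, 'n) module_scheme" where
  "polys F B x = B\<lparr>carrier :=
     {(\<Oplus>\<^bsub>B\<^esub>i\<in>{..n}. c i \<odot>\<^bsub>B\<^esub> (x [^]\<^bsub>B\<^esub> i)) | (n::nat) c. \<forall>i\<le>n. c i \<in> carrier F}\<rparr>"

text \<open>
  The copy of $B$ in $B^{(1)}$ with $B^{(1)}$ acting by multiplication; for central $x \in B$ this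
  is $B$ as a module over $\mathbb{F}[x]$.
\<close>

definition hull_action_module ::
    "('f, 'm) ring_scheme \<Rightarrow> ('f, 'b, 'n) module_scheme \<Rightarrow> ('f \<times> 'b, 'f \<times> 'b) module" where
  "hull_action_module F B =
     \<lparr>carrier = hull_emb F ` carrier B, monoid.mult = monoid.mult (unital_hull F B), monoid.one = monoid.one (unital_hull F B),
      ring.zero = ring.zero (unital_hull F B), ring.add = ring.add (unital_hull F B), module.smult = monoid.mult (unital_hull F B)\<rparr>"

definition spanned_by3 :: "('r, 'm) ring_scheme \<Rightarrow> ('r, 'b, 'n) module_scheme \<Rightarrow> 'b \<Rightarrow> 'b \<Rightarrow> 'b \<Rightarrow> bool" where
  "spanned_by3 R M x y z \<longleftrightarrow> module R M \<and> x \<in> carrier M \<and> y \<in> carrier M \<and> z \<in> carrier M \<and>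
     carrier M = {p \<odot>\<^bsub>M\<^esub> x \<oplus>\<^bsub>M\<^esub> q \<odot>\<^bsub>M\<^esub> y \<oplus>\<^bsub>M\<^esub> r \<odot>\<^bsub>M\<^esub> z | p q r.
       p \<in> carrier R \<and> q \<in> carrier R \<and> r \<in> carrier R}"

definition algebra_iso ::
    "('f, 'm) ring_scheme \<Rightarrow> ('f, 'b, 'n) module_scheme \<Rightarrow> ('f, 'c, 'k) module_scheme \<Rightarrow> bool" where
  "algebra_iso F B C \<longleftrightarrow> (\<exists>h. bij_betw h (carrier B) (carrier C) \<and>
     (\<forall>x\<in>carrier B. \<forall>y\<in>carrier B. h (x \<oplus>\<^bsub>B\<^esub> y) = h x \<oplus>\<^bsub>C\<^esub> h y) \<and>
     (\<forall>\<alpha>\<in>carrier F. \<forall>x\<in>carrier B. h (\<alpha> \<odot>\<^bsub>B\<^esub> x) = \<alpha> \<odot>\<^bsub>C\<^esub> h x) \<and>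
     (\<forall>x\<in>carrier B. \<forall>y\<in>carrier B. h (x \<otimes>\<^bsub>B\<^esub> y) = h x \<otimes>\<^bsub>C\<^esub> h y))"

definition involution ::
    "('f, 'm) ring_scheme \<Rightarrow> ('f, 'b, 'n) module_scheme \<Rightarrow> ('b \<Rightarrow> 'b) \<Rightarrow> bool" where
  "involution F A star \<longleftrightarrow> bij_betw star (carrier A) (carrier A) \<and>
     (\<forall>x\<in>carrier A. \<forall>y\<in>carrier A. star (x \<oplus>\<^bsub>A\<^esub> y) = star x \<oplus>\<^bsub>A\<^esub> star y) \<and>
     (\<forall>\<alpha>\<in>carrier F. \<forall>x\<in>carrier A. star (\<alpha> \<odot>\<^bsub>A\<^esub> x) = \<alpha> \<odot>\<^bsub>A\<^esub> star x) \<and>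
     (\<forall>x\<in>carrier A. \<forall>y\<in>carrier A. star (x \<otimes>\<^bsub>A\<^esub> y) = star y \<otimes>\<^bsub>A\<^esub> star x) \<and>
     (\<forall>x\<in>carrier A. star (star x) = x)"

definition plus_algebra ::
    "('f, 'm) ring_scheme \<Rightarrow> ('f, 'b, 'n) module_scheme \<Rightarrow> ('f, 'b, 'n) module_scheme" where
  "plus_algebra F A = A\<lparr>monoid.mult := (\<lambda>x y.
     inv\<^bsub>F\<^esub> (\<one>\<^bsub>F\<^esub> \<oplus>\<^bsub>F\<^esub> \<one>\<^bsub>F\<^esub>) \<odot>\<^bsub>A\<^esub> (x \<otimes>\<^bsub>A\<^esub> y \<oplus>\<^bsub>A\<^esub> y \<otimes>\<^bsub>A\<^esub> x))\<rparr>"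

definition sym_algebra ::
    "('f, 'm) ring_scheme \<Rightarrow> ('f, 'b, 'n) module_scheme \<Rightarrow> ('b \<Rightarrow> 'b) \<Rightarrow> ('f, 'b, 'n) module_scheme" where
  "sym_algebra F A star = (plus_algebra F A)\<lparr>carrier := {x \<in> carrier A. star x = x}\<rparr>"

text \<open>
  $M_2(K)$ as an algebra over the scalars of $K$; \<open>((p, q), (r, s))\<close> lists the rows of a matrix.
  Any existential quantifier over algebras ranges over algebras carried by one HOL type; the type of
  2 by 2 arrays over the carrier type of $J$ has room for the matrix algebras that are needed.
\<close>

definition mat2_algebra ::
    "('f, 'b, 'n) module_scheme \<Rightarrow> ('f, ('b \<times> 'b) \<times> ('b \<times> 'b)) module" where
  "mat2_algebra K =
     \<lparr>carrier = (carrier K \<times> carrier K) \<times> (carrier K \<times> carrier K),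
      monoid.mult = (\<lambda>((p, q), (r, s)) ((p', q'), (r', s')).
        ((p \<otimes>\<^bsub>K\<^esub> p' \<oplus>\<^bsub>K\<^esub> q \<otimes>\<^bsub>K\<^esub> r', p \<otimes>\<^bsub>K\<^esub> q' \<oplus>\<^bsub>K\<^esub> q \<otimes>\<^bsub>K\<^esub> s'),
         (r \<otimes>\<^bsub>K\<^esub> p' \<oplus>\<^bsub>K\<^esub> s \<otimes>\<^bsub>K\<^esub> r', r \<otimes>\<^bsub>K\<^esub> q' \<oplus>\<^bsub>K\<^esub> s \<otimes>\<^bsub>K\<^esub> s'))),
      monoid.one = ((\<one>\<^bsub>K\<^esub>, \<zero>\<^bsub>K\<^esub>), (\<zero>\<^bsub>K\<^esub>, \<one>\<^bsub>K\<^esub>)),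
      ring.zero = ((\<zero>\<^bsub>K\<^esub>, \<zero>\<^bsub>K\<^esub>), (\<zero>\<^bsub>K\<^esub>, \<zero>\<^bsub>K\<^esub>)),
      ring.add = (\<lambda>((p, q), (r, s)) ((p', q'), (r', s')).
        ((p \<oplus>\<^bsub>K\<^esub> p', q \<oplus>\<^bsub>K\<^esub> q'), (r \<oplus>\<^bsub>K\<^esub> r', s \<oplus>\<^bsub>K\<^esub> s'))),
      module.smult = (\<lambda>\<alpha> ((p, q), (r, s)).
        ((\<alpha> \<odot>\<^bsub>K\<^esub> p, \<alpha> \<odot>\<^bsub>K\<^esub> q), (\<alpha> \<odot>\<^bsub>K\<^esub> r, \<alpha> \<odot>\<^bsub>K\<^esub> s)))\<rparr>"

end

theory Submission
  imports Defs
begin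

text \<open>
  Write \<open>L x\<close> for multiplication by \<open>x\<close>. Linearizing the Jordan identity shows that \<open>L a\<close> commutes with
  \<open>L z\<close> whenever \<open>z\<close> lies in the Peirce spaces 0 and 1 of the idempotent \<open>a\<close>, and \<open>\<sigma>\<close> is a sum of two such
  elements; by symmetry \<open>L \<sigma>\<close> commutes with \<open>L a\<close> and \<open>L b\<close>, hence also with \<open>L (a b)\<close>, as
  \<open>2 a b = a + b - \<sigma>\<close>. The linearized identity expresses \<open>L ((x y) z)\<close> through \<open>L\<close> of shorter products, so
  \<open>L \<sigma>\<close> commutes with \<open>L t\<close> for all \<open>t\<close> in the span of the \<open>\<sigma>\<close>-multiples of \<open>a\<close>, \<open>b\<close>, \<open>\<sigma>\<close>. This span is then
  closed under multiplication, so it is everything and \<open>\<sigma>\<close> is central.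

  If \<open>J\<close> is simple, then multiplication by a central element is zero or onto. It is onto for \<open>\<sigma>\<close>, which gives
  an identity \<open>1\<close>, and the Peirce 1-space of \<open>a\<close> being \<open>F[\<sigma>] a\<close> forces \<open>C = F[\<sigma>] 1\<close> to be a field. With \<open>h\<close> the
  Peirce 1/2-component of \<open>b\<close> one gets \<open>b = (1 - \<sigma>) a + h + \<sigma> (1 - a)\<close> and \<open>h\<^sup>2 = \<mu> = \<sigma> (1 - \<sigma>)\<close>, and
  simplicity makes \<open>a\<close>, \<open>h\<close>, \<open>1 - a\<close> a basis of \<open>J\<close> over \<open>C\<close> and \<open>\<mu>\<close> nonzero. Sending this basis to the
  matrices with rows \<open>(1, 0), (0, 0)\<close>; \<open>(0, 1), (\<mu>, 0)\<close>; \<open>(0, 0), (0, 1)\<close> identifies \<open>J\<close> with the symmetric elements of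
  the \<open>2 \<times> 2\<close> matrices over \<open>C\<close>.
\<close>

section \<open>Centers and polynomial subalgebras\<close>

text \<open>The elements that commute with \<sigma> as multiplications are not visibly closed under
  products, and the formula for a triple product presupposes all pairwise products; hence the
  induction over the span carries \<open>x\<close> and \<open>\<sigma> x\<close> together. With
  \<open>a\<close> sent to a diagonal matrix unit, the ordinary transpose would require a square
  root of \<mu> in \<open>C\<close>. A weighted adjoint avoids the root, fixes the images of
  \<open>a\<close> and \<open>b\<close>, and therefore exchanges \<open>e f\<close> and
  \<open>f e\<close>. Two reductions precede the coordinates: a zero idempotent gives
  \<open>J = F\<close> at once, and the identity found is written into the record, so that
  F[\<sigma>] can be formed inside \<open>J\<close> and not only in its hull.\<close>

context na_algebra
begin

abbreviation badd (infixl "\<boxplus>" 65) where "x \<boxplus> y \<equiv> x \<oplus>\<^bsub>B\<^esub> y"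
abbreviation bsub (infixl "\<boxminus>" 65) where "x \<boxminus> y \<equiv> x \<ominus>\<^bsub>B\<^esub> y"
abbreviation bmul (infixl "\<bullet>" 70) where "x \<bullet> y \<equiv> x \<otimes>\<^bsub>B\<^esub> y"
abbreviation bneg ("\<boxminus> _" [81] 80) where "\<boxminus> x \<equiv> \<ominus>\<^bsub>B\<^esub> x"
abbreviation bzero ("\<^bold>0") where "\<^bold>0 \<equiv> \<zero>\<^bsub>B\<^esub>"

lemma zero_mult [simp]: "x \<in> carrier B \<Longrightarrow> \<^bold>0 \<bullet> x = \<^bold>0"
  using mult_l_distr[of "\<^bold>0" "\<^bold>0" x] mult_closed[of "\<^bold>0" x]
  by (metis M.l_zero M.zero_closed M.add.r_cancel_one')

lemma mult_zero [simp]: "x \<in> carrier B \<Longrightarrow> x \<bullet> \<^bold>0 = \<^bold>0"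
  using mult_r_distr[of "\<^bold>0" "\<^bold>0" x] mult_closed[of x "\<^bold>0"]
  by (metis M.l_zero M.zero_closed M.add.r_cancel_one')

lemma mult_l_minus:
  assumes "x \<in> carrier B" "y \<in> carrier B"
  shows "(\<boxminus> x) \<bullet> y = \<boxminus> (x \<bullet> y)"
  using mult_l_distr[of "\<boxminus> x" x y] assms mult_closed[of "\<boxminus> x" y] mult_closed[of x y]
  by (simp add: M.l_neg M.minus_equality)

lemma mult_r_minus:
  assumes "x \<in> carrier B" "y \<in> carrier B"
  shows "y \<bullet> (\<boxminus> x) = \<boxminus> (y \<bullet> x)"
  using mult_r_distr[of "\<boxminus> x" x y] assms mult_closed[of y "\<boxminus> x"] mult_closed[of y x]
  by (simp add: M.l_neg M.minus_equality)

text \<open>Teaches \<open>algebra\<close> a product that is bilinear but neither associative nor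
  commutative: sums and scalars are moved out, and nested products keep their bracketing. The Jordan
  setting later adds \<open>mult_comm\<close>.\<close>

lemmas na_simprules [algebra add: na_algebra "ring.zero B" "ring.add B" "a_inv B" "a_minus B" "monoid.mult B" "module.smult B"] =
  M.a_closed M.zero_closed M.a_inv_closed mult_closed M.minus_closed smult_closed
  M.a_assoc M.l_zero M.r_zero M.l_neg M.r_neg M.a_comm M.a_lcomm M.minus_eq M.r_neg1 M.r_neg2
  M.minus_add M.minus_minus mult_l_distr mult_r_distr mult_l_minus mult_r_minus zero_mult mult_zero
  smult_r_distr smult_r_minus smult_r_null mult_l_smult mult_r_smult

lemma minus_eq_zero_iff:
  assumes "x \<in> carrier B" "y \<in> carrier B"
  shows "x \<boxminus> y = \<^bold>0 \<longleftrightarrow> x = y"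
proof
  assume "x \<boxminus> y = \<^bold>0"
  moreover have "x = (x \<boxminus> y) \<boxplus> y"
    using assms by algebra
  ultimately show "x = y"
    using assms by simp
qed (use assms in \<open>simp add: M.minus_eq M.r_neg\<close>)

lemma center_iff:
  "c \<in> center B \<longleftrightarrow> c \<in> carrier B \<and> (\<forall>x\<in>carrier B. c \<bullet> x = x \<bullet> c) \<and>
     (\<forall>x\<in>carrier B. \<forall>y\<in>carrier B. (c \<bullet> x) \<bullet> y = c \<bullet> (x \<bullet> y) \<and> (x \<bullet> c) \<bullet> y = x \<bullet> (c \<bullet> y) \<and>
        (x \<bullet> y) \<bullet> c = x \<bullet> (y \<bullet> c))"
proof -
  have "commutator B c x = \<^bold>0 \<longleftrightarrow> c \<bullet> x = x \<bullet> c" if "c \<in> carrier B" "x \<in> carrier B" for x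
    using that by (simp add: commutator_def minus_eq_zero_iff mult_closed)
  moreover have "associator B x y z = \<^bold>0 \<longleftrightarrow> (x \<bullet> y) \<bullet> z = x \<bullet> (y \<bullet> z)"
    if "x \<in> carrier B" "y \<in> carrier B" "z \<in> carrier B" for x y z
    using that by (simp add: associator_def minus_eq_zero_iff mult_closed)
  ultimately show ?thesis
    unfolding center_def nucleus_def by blast
qed

lemma center_closed: "c \<in> center B \<Longrightarrow> c \<in> carrier B"
  unfolding center_iff by blast

lemma center_commute:
  assumes "c \<in> center B" "x \<in> carrier B"
  shows "x \<bullet> c = c \<bullet> x"
  using assms unfolding center_iff by metis

lemma center_assoc:
  "\<lbrakk>c \<in> center B; x \<in> carrier B; y \<in> carrier B\<rbrakk> \<Longrightarrow> (c \<bullet> x) \<bullet> y = c \<bullet> (x \<bullet> y)"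
  unfolding center_iff by blast

lemma center_lcomm:
  assumes "c \<in> center B" "x \<in> carrier B" "y \<in> carrier B"
  shows "x \<bullet> (c \<bullet> y) = c \<bullet> (x \<bullet> y)"
proof -
  have "x \<bullet> (c \<bullet> y) = (x \<bullet> c) \<bullet> y"
    using assms unfolding center_iff by metis
  also have "\<dots> = (c \<bullet> x) \<bullet> y"
    using assms by (simp only: center_commute)
  finally show ?thesis
    using assms by (simp only: center_assoc)
qed

text \<open>Once \<open>c\<close> commutes with everything, the two missing associator conditions
  follow: \<open>(x c) y = (c x) y = c (x y) = x (c y)\<close> and
  \<open>(x y) c = c (x y) = x (c y) = x (y c)\<close>.\<close>

lemma centerI:
  assumes "c \<in> carrier B" "\<And>x. x \<in> carrier B \<Longrightarrow> x \<bullet> c = c \<bullet> x"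
    "\<And>x y. \<lbrakk>x \<in> carrier B; y \<in> carrier B\<rbrakk> \<Longrightarrow> (c \<bullet> x) \<bullet> y = c \<bullet> (x \<bullet> y)"
    "\<And>x y. \<lbrakk>x \<in> carrier B; y \<in> carrier B\<rbrakk> \<Longrightarrow> x \<bullet> (c \<bullet> y) = c \<bullet> (x \<bullet> y)"
  shows "c \<in> center B"
  unfolding center_iff by (simp add: assms mult_closed)

lemma center_add:
  assumes "c \<in> center B" "d \<in> center B"
  shows "c \<boxplus> d \<in> center B"
  by (rule centerI)
    (simp_all add: center_closed[OF assms(1)] center_closed[OF assms(2)] mult_closed mult_l_distr mult_r_distr
      center_commute[OF assms(1)] center_commute[OF assms(2)] center_assoc[OF assms(1)]
      center_assoc[OF assms(2)] center_lcomm[OF assms(1)] center_lcomm[OF assms(2)])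

lemma center_smult:
  assumes "\<alpha> \<in> carrier F" "c \<in> center B"
  shows "\<alpha> \<odot>\<^bsub>B\<^esub> c \<in> center B"
  by (rule centerI)
    (simp_all add: assms(1) center_closed[OF assms(2)] mult_closed mult_l_smult mult_r_smult
      center_commute[OF assms(2)] center_assoc[OF assms(2)] center_lcomm[OF assms(2)])

lemma center_mult:
  assumes c: "c \<in> center B" and d: "d \<in> center B"
  shows "c \<bullet> d \<in> center B"
proof (rule centerI)
  note cl = center_closed[OF c] center_closed[OF d] mult_closed
  show "c \<bullet> d \<in> carrier B"
    by (simp add: cl)
  show "x \<bullet> (c \<bullet> d) = c \<bullet> d \<bullet> x" if "x \<in> carrier B" for x
    using center_lcomm[OF c that, of d] center_commute[OF d that] center_assoc[OF c _ that, of d] by (simp add: cl)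
  show "c \<bullet> d \<bullet> x \<bullet> y = c \<bullet> d \<bullet> (x \<bullet> y)" if "x \<in> carrier B" "y \<in> carrier B" for x y
    using center_assoc[OF c _ that(2), of "d \<bullet> x"] center_assoc[OF c _ that(1), of d]
      center_assoc[OF c, of d "x \<bullet> y"] center_assoc[OF d that] that by (simp add: cl)
  show "x \<bullet> (c \<bullet> d \<bullet> y) = c \<bullet> d \<bullet> (x \<bullet> y)" if "x \<in> carrier B" "y \<in> carrier B" for x y
    using center_lcomm[OF c that(1), of "d \<bullet> y"] center_assoc[OF c _ that(2), of d] center_lcomm[OF d that]
      center_assoc[OF c, of d "x \<bullet> y"] that by (simp add: cl)
qed

lemma center_identity: "is_identity B u \<Longrightarrow> u \<in> center B"
  by (rule centerI) (auto simp: is_identity_def mult_closed)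

section \<open>Polynomials in one element of a unital algebra\<close>

context
  fixes x
  assumes one: "is_identity B \<one>\<^bsub>B\<^esub>" and x: "x \<in> carrier B"
begin

lemma nat_pow_closed: "x [^]\<^bsub>B\<^esub> (i::nat) \<in> carrier B"
proof (induction i)
  case 0
  with one show ?case by (simp add: is_identity_def nat_pow_def)
next
  case (Suc i)
  with x show ?case by (simp add: nat_pow_def mult_closed)
qed

lemma polys_sum_closed:
  assumes "\<forall>i\<le>n. c i \<in> carrier F"
  shows "(\<Oplus>\<^bsub>B\<^esub>i\<in>{..n}. c i \<odot>\<^bsub>B\<^esub> (x [^]\<^bsub>B\<^esub> (i::nat))) \<in> carrier B"
  using assms by (intro M.finsum_closed) (auto simp: nat_pow_closed)

lemma polys_sum_Suc:
  assumes "\<forall>i\<le>Suc n. c i \<in> carrier F"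
  shows "(\<Oplus>\<^bsub>B\<^esub>i\<in>{..Suc n}. c i \<odot>\<^bsub>B\<^esub> (x [^]\<^bsub>B\<^esub> (i::nat))) =
    (\<Oplus>\<^bsub>B\<^esub>i\<in>{..n}. c i \<odot>\<^bsub>B\<^esub> (x [^]\<^bsub>B\<^esub> i)) \<boxplus> c (Suc n) \<odot>\<^bsub>B\<^esub> (x [^]\<^bsub>B\<^esub> n \<bullet> x)"
  using assms
  by (subst M.finsum_Suc)
    (auto simp: nat_pow_closed nat_pow_def[of B x "Suc n"] mult_closed x nat_pow_def[of B x n, symmetric]
      intro!: M.a_comm M.finsum_closed)

lemma polys_sum_0:
  assumes "c 0 \<in> carrier F"
  shows "(\<Oplus>\<^bsub>B\<^esub>i\<in>{..0}. c i \<odot>\<^bsub>B\<^esub> (x [^]\<^bsub>B\<^esub> (i::nat))) = c 0 \<odot>\<^bsub>B\<^esub> \<one>\<^bsub>B\<^esub>"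
  using assms one by (simp add: is_identity_def nat_pow_def)

text \<open>Replaces explicit sums by closure rules. Right multiplication by \<open>x\<close>
  matches the recursion of \<open>[^]\<close>, so nothing about the bracketing of powers has to be
  known.\<close>

lemma polys_induct [consumes 1, case_names one add smult mult]:
  assumes p: "p \<in> carrier (polys F B x)"
    and Q_one: "Q \<one>\<^bsub>B\<^esub>"
    and Q_add: "\<And>p q. \<lbrakk>p \<in> carrier B; q \<in> carrier B; Q p; Q q\<rbrakk> \<Longrightarrow> Q (p \<boxplus> q)"
    and Q_smult: "\<And>\<alpha> p. \<lbrakk>\<alpha> \<in> carrier F; p \<in> carrier B; Q p\<rbrakk> \<Longrightarrow> Q (\<alpha> \<odot>\<^bsub>B\<^esub> p)"
    and Q_mult: "\<And>p. \<lbrakk>p \<in> carrier B; Q p\<rbrakk> \<Longrightarrow> Q (p \<bullet> x)"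
  shows "Q p"
proof -
  have pow: "Q (x [^]\<^bsub>B\<^esub> (i::nat))" for i
    using Q_one Q_mult nat_pow_closed by (induction i) (simp_all add: nat_pow_def)
  have "Q (\<Oplus>\<^bsub>B\<^esub>i\<in>{..n}. c i \<odot>\<^bsub>B\<^esub> (x [^]\<^bsub>B\<^esub> i))" if "\<forall>i\<le>n. c i \<in> carrier F" for c and n :: nat
    using that
  proof (induction n)
    case 0
    then show ?case
      using Q_smult[OF _ _ Q_one] one by (simp only: polys_sum_0) (simp add: is_identity_def)
  next
    case (Suc n)
    then have "Q (c (Suc n) \<odot>\<^bsub>B\<^esub> (x [^]\<^bsub>B\<^esub> n \<bullet> x))"
      by (intro Q_smult Q_mult pow mult_closed nat_pow_closed x) auto
    with Suc show ?case
      by (subst polys_sum_Suc) (auto intro!: Q_add polys_sum_closed mult_closed nat_pow_closed x)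
  qed
  with p show ?thesis
    by (auto simp: polys_def)
qed

lemma polys_closed: "p \<in> carrier (polys F B x) \<Longrightarrow> p \<in> carrier B"
  by (induction rule: polys_induct) (use one in \<open>auto simp: is_identity_def mult_closed x\<close>)

lemma polysI:
  assumes "\<forall>i\<le>n. c i \<in> carrier F"
  shows "(\<Oplus>\<^bsub>B\<^esub>i\<in>{..n}. c i \<odot>\<^bsub>B\<^esub> (x [^]\<^bsub>B\<^esub> (i::nat))) \<in> carrier (polys F B x)"
  using assms by (auto simp: polys_def)

text \<open>Padding with zero coefficients brings two polynomials of different degree to a common
  length, after which \<open>polys_add\<close> can add coefficientwise.\<close>

lemma polys_extend:
  assumes "\<forall>i\<le>n. c i \<in> carrier F" and "n \<le> m"
  shows "(\<Oplus>\<^bsub>B\<^esub>i\<in>{..m}. (if i \<le> n then c i else \<zero>\<^bsub>F\<^esub>) \<odot>\<^bsub>B\<^esub> (x [^]\<^bsub>B\<^esub> (i::nat))) =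
    (\<Oplus>\<^bsub>B\<^esub>i\<in>{..n}. c i \<odot>\<^bsub>B\<^esub> (x [^]\<^bsub>B\<^esub> i))"
  using assms(2)
proof (induction m rule: dec_induct)
  case base
  show ?case
    using assms(1) by (intro M.finsum_cong') (auto simp: nat_pow_closed)
next
  case (step m)
  have "\<forall>i\<le>Suc m. (if i \<le> n then c i else \<zero>\<^bsub>F\<^esub>) \<in> carrier F"
    using assms(1) by auto
  then show ?case
    using step assms(1) by (subst polys_sum_Suc) (auto simp: polys_sum_closed mult_closed nat_pow_closed x)
qed

lemma polys_add:
  assumes "p \<in> carrier (polys F B x)" "q \<in> carrier (polys F B x)"
  shows "p \<boxplus> q \<in> carrier (polys F B x)"
proof -
  obtain n c m d where
    p: "p = (\<Oplus>\<^bsub>B\<^esub>i\<in>{..n}. c i \<odot>\<^bsub>B\<^esub> (x [^]\<^bsub>B\<^esub> (i::nat)))" and c: "\<forall>i\<le>n. c i \<in> carrier F" and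
    q: "q = (\<Oplus>\<^bsub>B\<^esub>i\<in>{..m}. d i \<odot>\<^bsub>B\<^esub> (x [^]\<^bsub>B\<^esub> (i::nat)))" and d: "\<forall>i\<le>m. d i \<in> carrier F"
    using assms by (auto simp: polys_def)
  define N where "N = max n m"
  define c' d' where "c' i = (if i \<le> n then c i else \<zero>\<^bsub>F\<^esub>)" and "d' i = (if i \<le> m then d i else \<zero>\<^bsub>F\<^esub>)" for i
  have cd: "c' i \<in> carrier F" "d' i \<in> carrier F" for i
    using c d by (auto simp: c'_def d'_def)
  have "p = (\<Oplus>\<^bsub>B\<^esub>i\<in>{..N}. c' i \<odot>\<^bsub>B\<^esub> (x [^]\<^bsub>B\<^esub> i))"
    unfolding p c'_def by (rule polys_extend[symmetric]) (use c in \<open>auto simp: N_def\<close>)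
  moreover have "q = (\<Oplus>\<^bsub>B\<^esub>i\<in>{..N}. d' i \<odot>\<^bsub>B\<^esub> (x [^]\<^bsub>B\<^esub> i))"
    unfolding q d'_def by (rule polys_extend[symmetric]) (use d in \<open>auto simp: N_def\<close>)
  ultimately have "p \<boxplus> q = (\<Oplus>\<^bsub>B\<^esub>i\<in>{..N}. c' i \<odot>\<^bsub>B\<^esub> (x [^]\<^bsub>B\<^esub> i) \<boxplus> d' i \<odot>\<^bsub>B\<^esub> (x [^]\<^bsub>B\<^esub> i))"
    using cd by (simp add: M.finsum_addf nat_pow_closed)
  also have "\<dots> = (\<Oplus>\<^bsub>B\<^esub>i\<in>{..N}. (c' i \<oplus>\<^bsub>F\<^esub> d' i) \<odot>\<^bsub>B\<^esub> (x [^]\<^bsub>B\<^esub> i))"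
    using cd by (intro M.finsum_cong') (auto simp: smult_l_distr nat_pow_closed)
  finally show ?thesis
    using cd by (simp add: polysI)
qed

lemma polys_monomial:
  assumes "\<alpha> \<in> carrier F"
  shows "\<alpha> \<odot>\<^bsub>B\<^esub> (x [^]\<^bsub>B\<^esub> (n::nat)) \<in> carrier (polys F B x)"
proof (cases n)
  case 0
  with polysI[of 0 "\<lambda>_. \<alpha>"] assms polys_sum_0[of "\<lambda>_. \<alpha>"] show ?thesis
    by (simp add: nat_pow_def)
next
  case (Suc m)
  have "(\<Oplus>\<^bsub>B\<^esub>i\<in>{..m}. (if i = Suc m then \<alpha> else \<zero>\<^bsub>F\<^esub>) \<odot>\<^bsub>B\<^esub> (x [^]\<^bsub>B\<^esub> i)) = \<^bold>0"
    by (rule M.add.finprod_one_eqI) (auto simp: nat_pow_closed)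
  then have "(\<Oplus>\<^bsub>B\<^esub>i\<in>{..Suc m}. (if i = Suc m then \<alpha> else \<zero>\<^bsub>F\<^esub>) \<odot>\<^bsub>B\<^esub> (x [^]\<^bsub>B\<^esub> i)) = \<alpha> \<odot>\<^bsub>B\<^esub> (x [^]\<^bsub>B\<^esub> Suc m)"
    using assms by (subst polys_sum_Suc) (auto simp: mult_closed nat_pow_closed x nat_pow_def[of B x "Suc m"] nat_pow_def[of B x m, symmetric])
  with polysI[of "Suc m" "\<lambda>i. if i = Suc m then \<alpha> else \<zero>\<^bsub>F\<^esub>"] assms Suc show ?thesis
    by auto
qed

lemma polys_one: "\<one>\<^bsub>B\<^esub> \<in> carrier (polys F B x)"
  using polys_monomial[of "\<one>\<^bsub>F\<^esub>" 0] one by (simp add: nat_pow_def is_identity_def)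

lemma polys_smult:
  assumes "\<alpha> \<in> carrier F" "p \<in> carrier (polys F B x)"
  shows "\<alpha> \<odot>\<^bsub>B\<^esub> p \<in> carrier (polys F B x)"
proof -
  obtain n c where p: "p = (\<Oplus>\<^bsub>B\<^esub>i\<in>{..n}. c i \<odot>\<^bsub>B\<^esub> (x [^]\<^bsub>B\<^esub> (i::nat)))" and c: "\<forall>i\<le>n. c i \<in> carrier F"
    using assms(2) by (auto simp: polys_def)
  have "\<alpha> \<odot>\<^bsub>B\<^esub> p = (\<Oplus>\<^bsub>B\<^esub>i\<in>{..n}. \<alpha> \<odot>\<^bsub>B\<^esub> (c i \<odot>\<^bsub>B\<^esub> (x [^]\<^bsub>B\<^esub> i)))"
    unfolding p using c assms(1) by (intro finsum_smult_ldistr) (auto simp: nat_pow_closed)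
  also have "\<dots> = (\<Oplus>\<^bsub>B\<^esub>i\<in>{..n}. (\<alpha> \<otimes>\<^bsub>F\<^esub> c i) \<odot>\<^bsub>B\<^esub> (x [^]\<^bsub>B\<^esub> i))"
    using c assms(1) by (intro M.finsum_cong') (auto simp: smult_assoc1 nat_pow_closed)
  finally show ?thesis
    using c assms(1) by (simp add: polysI)
qed

lemma polys_mult_generator:
  assumes "p \<in> carrier (polys F B x)"
  shows "p \<bullet> x \<in> carrier (polys F B x)"
proof -
  have "(\<Oplus>\<^bsub>B\<^esub>i\<in>{..n}. c i \<odot>\<^bsub>B\<^esub> (x [^]\<^bsub>B\<^esub> i)) \<bullet> x \<in> carrier (polys F B x)"
    if "\<forall>i\<le>n. c i \<in> carrier F" for c and n :: nat
    using that
  proof (induction n)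
    case 0
    then have "(c 0 \<odot>\<^bsub>B\<^esub> \<one>\<^bsub>B\<^esub>) \<bullet> x = c 0 \<odot>\<^bsub>B\<^esub> (x [^]\<^bsub>B\<^esub> Suc 0)"
      using one x by (simp add: is_identity_def mult_l_smult nat_pow_def)
    with 0 show ?case
      by (simp only: polys_sum_0 polys_monomial)
  next
    case (Suc n)
    then have "(c (Suc n) \<odot>\<^bsub>B\<^esub> (x [^]\<^bsub>B\<^esub> n \<bullet> x)) \<bullet> x = c (Suc n) \<odot>\<^bsub>B\<^esub> (x [^]\<^bsub>B\<^esub> Suc (Suc n))"
      using x nat_pow_closed[of n] by (simp add: mult_l_smult mult_closed nat_pow_def)
    moreover have "c (Suc n) \<odot>\<^bsub>B\<^esub> (x [^]\<^bsub>B\<^esub> Suc (Suc n)) \<in> carrier (polys F B x)"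
      using Suc.prems by (intro polys_monomial) simp
    ultimately show ?case
      using Suc by (subst polys_sum_Suc)
        (auto simp: mult_l_distr polys_sum_closed mult_closed nat_pow_closed x intro!: polys_add)
  qed
  with assms show ?thesis
    by (auto simp: polys_def)
qed

lemma polys_generator: "x \<in> carrier (polys F B x)"
  using polys_mult_generator[OF polys_one] one x by (simp add: is_identity_def)

lemma polys_zero: "\<^bold>0 \<in> carrier (polys F B x)"
  using polys_smult[OF K.zero_closed polys_one] one by (simp add: is_identity_def)

lemma polys_neg:
  assumes "p \<in> carrier (polys F B x)" shows "\<boxminus> p \<in> carrier (polys F B x)"
  using polys_smult[of "\<ominus>\<^bsub>F\<^esub> \<one>\<^bsub>F\<^esub>" p] polys_closed[OF assms] assms by (simp add: smult_l_minus)

lemma polys_center: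
  assumes "x \<in> center B"
  shows "carrier (polys F B x) \<subseteq> center B"
proof
  fix p
  assume "p \<in> carrier (polys F B x)"
  then show "p \<in> center B"
    by (induction rule: polys_induct)
      (use assms one in \<open>auto intro: center_add center_smult center_mult center_identity\<close>)
qed

text \<open>Without associativity a product of polynomials need not be a polynomial. Centrality of
  \<open>x\<close> gives \<open>p (r x) = (p r) x\<close>, which reduces the claim to
  \<open>polys_mult_generator\<close>.\<close>

lemma polys_mult:
  assumes c: "x \<in> center B" and p: "p \<in> carrier (polys F B x)" and q: "q \<in> carrier (polys F B x)"
  shows "p \<bullet> q \<in> carrier (polys F B x)"
  using q
proof (induction rule: polys_induct)
  case one
  have "p \<bullet> \<one>\<^bsub>B\<^esub> = p"
    using polys_closed[OF p] \<open>is_identity B \<one>\<^bsub>B\<^esub>\<close> by (simp add: is_identity_def)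
  with p show ?case
    by simp
next
  case (add r s)
  then show ?case
    using polys_closed[OF p] by (simp add: mult_r_distr polys_add)
next
  case (smult \<alpha> r)
  then show ?case
    using polys_closed[OF p] by (simp add: mult_r_smult polys_smult)
next
  case (mult r)
  then have "p \<bullet> (r \<bullet> x) = (p \<bullet> r) \<bullet> x"
    using c polys_closed[OF p] unfolding center_iff by metis
  with mult show ?case
    using polys_mult_generator by simp
qed

lemma polys_simps [simp]:
  "ring.zero (polys F B x) = \<^bold>0" "ring.add (polys F B x) = ring.add B"
  "monoid.one (polys F B x) = \<one>\<^bsub>B\<^esub>" "monoid.mult (polys F B x) = monoid.mult B"
  "module.smult (polys F B x) = module.smult B"
  by (simp_all add: polys_def)

lemma polys_cring:
  assumes c: "x \<in> center B"
  shows "cring (polys F B x)"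
proof (rule cringI)
  note cl = polys_closed
  show "abelian_group (polys F B x)"
  proof (rule abelian_groupI)
    fix p assume p: "p \<in> carrier (polys F B x)"
    show "\<exists>q\<in>carrier (polys F B x). q \<oplus>\<^bsub>polys F B x\<^esub> p = \<zero>\<^bsub>polys F B x\<^esub>"
      using polys_neg[OF p] cl[OF p] by (intro bexI[of _ "\<boxminus> p"]) (simp_all add: M.l_neg)
  qed (auto simp: polys_add polys_zero cl M.a_assoc intro: M.a_comm)
  show "comm_monoid (polys F B x)"
  proof (rule comm_monoidI)
    fix p q r assume "p \<in> carrier (polys F B x)" "q \<in> carrier (polys F B x)" "r \<in> carrier (polys F B x)"
    then show "p \<otimes>\<^bsub>polys F B x\<^esub> q \<otimes>\<^bsub>polys F B x\<^esub> r = p \<otimes>\<^bsub>polys F B x\<^esub> (q \<otimes>\<^bsub>polys F B x\<^esub> r)"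
      using polys_center[OF c] cl by (auto intro!: center_assoc)
  next
    fix p q assume "p \<in> carrier (polys F B x)" "q \<in> carrier (polys F B x)"
    then show "p \<otimes>\<^bsub>polys F B x\<^esub> q = q \<otimes>\<^bsub>polys F B x\<^esub> p"
      using polys_center[OF c] cl by (auto intro!: center_commute)
  qed (use polys_mult[OF c] polys_one cl one in \<open>auto simp: is_identity_def\<close>)
  show "(p \<oplus>\<^bsub>polys F B x\<^esub> q) \<otimes>\<^bsub>polys F B x\<^esub> r = p \<otimes>\<^bsub>polys F B x\<^esub> r \<oplus>\<^bsub>polys F B x\<^esub> q \<otimes>\<^bsub>polys F B x\<^esub> r"
    if "p \<in> carrier (polys F B x)" "q \<in> carrier (polys F B x)" "r \<in> carrier (polys F B x)" for p q r
    using that cl by (simp add: mult_l_distr)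
qed

end

end

lemmas (in jordan_algebra) [algebra add: na_algebra "ring.zero B" "ring.add B" "a_inv B" "a_minus B" "monoid.mult B" "module.smult B"] =
  mult_comm

section \<open>Centrality of the squared difference\<close>

context na_algebra
begin

lemma minus_eq_minus_iff:
  assumes "x \<in> carrier B" "y \<in> carrier B" "z \<in> carrier B" "w \<in> carrier B"
  shows "x \<boxminus> y = z \<boxminus> w \<longleftrightarrow> x \<boxplus> w = z \<boxplus> y"
proof -
  have "x \<boxminus> y = z \<boxminus> w \<longleftrightarrow> (x \<boxminus> y) \<boxplus> (y \<boxplus> w) = (z \<boxminus> w) \<boxplus> (y \<boxplus> w)"
    using assms by simp
  also have "(x \<boxminus> y) \<boxplus> (y \<boxplus> w) = x \<boxplus> w"
    using assms by (simp add: M.minus_eq M.a_assoc M.r_neg1)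
  also have "(z \<boxminus> w) \<boxplus> (y \<boxplus> w) = z \<boxplus> y"
    using assms M.a_comm[of y w] by (simp add: M.minus_eq M.a_assoc M.r_neg1)
  finally show ?thesis .
qed

end

section \<open>Linearization of the Jordan identity and Peirce spaces\<close>

context jordan_algebra
begin

lemma eq_of_double_eq:
  assumes "\<one>\<^bsub>F\<^esub> \<oplus>\<^bsub>F\<^esub> \<one>\<^bsub>F\<^esub> \<noteq> \<zero>\<^bsub>F\<^esub>" and "x \<in> carrier B" "y \<in> carrier B" and "x \<boxplus> x = y \<boxplus> y"
  shows "x = y"
proof -
  let ?t = "\<one>\<^bsub>F\<^esub> \<oplus>\<^bsub>F\<^esub> \<one>\<^bsub>F\<^esub>"
  have t: "?t \<in> Units F"
    using assms(1) by (simp add: K.field_Units)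
  have "z = inv\<^bsub>F\<^esub> ?t \<odot>\<^bsub>B\<^esub> (z \<boxplus> z)" if z: "z \<in> carrier B" for z
  proof -
    have "inv\<^bsub>F\<^esub> ?t \<odot>\<^bsub>B\<^esub> (z \<boxplus> z) = inv\<^bsub>F\<^esub> ?t \<odot>\<^bsub>B\<^esub> (?t \<odot>\<^bsub>B\<^esub> z)"
      using z by (simp add: smult_l_distr)
    also have "\<dots> = z"
      using z t by (simp add: smult_assoc1[symmetric] K.Units_l_inv)
    finally show ?thesis ..
  qed
  from this[of x] this[of y] assms show ?thesis by simp
qed

text \<open>Full linearization of the cubic map \<open>u \<mapsto> T u u u\<close>; the symmetry in
  the first two arguments merges six terms into three. Only signs and division by 2 are used, so the
  argument covers characteristic 3.\<close>

lemma polarization: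
  assumes two: "\<one>\<^bsub>F\<^esub> \<oplus>\<^bsub>F\<^esub> \<one>\<^bsub>F\<^esub> \<noteq> \<zero>\<^bsub>F\<^esub>"
    and cl: "\<And>u v w. \<lbrakk>u \<in> carrier B; v \<in> carrier B; w \<in> carrier B\<rbrakk> \<Longrightarrow> T u v w \<in> carrier B"
    and add1: "\<And>u u' v w. \<lbrakk>u \<in> carrier B; u' \<in> carrier B; v \<in> carrier B; w \<in> carrier B\<rbrakk> \<Longrightarrow>
      T (u \<boxplus> u') v w = T u v w \<boxplus> T u' v w"
    and add3: "\<And>u v w w'. \<lbrakk>u \<in> carrier B; v \<in> carrier B; w \<in> carrier B; w' \<in> carrier B\<rbrakk> \<Longrightarrow>
      T u v (w \<boxplus> w') = T u v w \<boxplus> T u v w'"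
    and sym: "\<And>u v w. \<lbrakk>u \<in> carrier B; v \<in> carrier B; w \<in> carrier B\<rbrakk> \<Longrightarrow> T u v w = T v u w"
    and diag: "\<And>u. u \<in> carrier B \<Longrightarrow> T u u u = \<^bold>0"
    and x: "x \<in> carrier B" and z: "z \<in> carrier B" and w: "w \<in> carrier B"
  shows "T x z w \<boxplus> T z w x \<boxplus> T w x z = \<^bold>0"
proof -
  have add2: "T u (v \<boxplus> v') w = T u v w \<boxplus> T u v' w"
    if "u \<in> carrier B" "v \<in> carrier B" "v' \<in> carrier B" "w \<in> carrier B" for u v v' w
    using that by (simp add: sym[of u] add1)
  have neg_of_add: "g (\<boxminus> v) = \<boxminus> (g v)"
    if g: "\<And>u v. \<lbrakk>u \<in> carrier B; v \<in> carrier B\<rbrakk> \<Longrightarrow> g (u \<boxplus> v) = g u \<boxplus> g v"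
      "\<And>v. v \<in> carrier B \<Longrightarrow> g v \<in> carrier B" and v: "v \<in> carrier B" for g v
  proof -
    have "g \<^bold>0 \<boxplus> g \<^bold>0 = g \<^bold>0"
      using g(1)[of "\<^bold>0" "\<^bold>0"] by simp
    then have "g \<^bold>0 = \<^bold>0"
      using g(2)[of "\<^bold>0"] by simp
    then have "g (\<boxminus> v) \<boxplus> g v = \<^bold>0"
      using g(1)[of "\<boxminus> v" v] v by (simp add: M.l_neg)
    then show ?thesis
      using g(2) v by (simp add: M.minus_equality)
  qed
  note neg = neg_of_add[of "\<lambda>u. T u _ _"] neg_of_add[of "\<lambda>u. T _ u _"] neg_of_add[of "\<lambda>u. T _ _ u"]
  \<comment> \<open>\<open>A v\<close> collects the terms of
    \<open>T (u + v) (u + v) (u + v)\<close> that are linear in \<open>v\<close>, and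
    \<open>C v\<close> the quadratic ones. Replacing \<open>v\<close> by its negative changes the
    sign of \<open>A v\<close> only, so the equation \<open>A v + C v = 0\<close> splits.\<close>
  have odd: "T u v u \<boxplus> T u v u \<boxplus> T u u v = \<^bold>0" if u: "u \<in> carrier B" and v: "v \<in> carrier B" for u v
  proof -
    define A where "A v = T u v u \<boxplus> T u v u \<boxplus> T u u v" for v
    define C where "C v = T v v u \<boxplus> T u v v \<boxplus> T u v v" for v
    have AC: "A v \<in> carrier B" "C v \<in> carrier B" if "v \<in> carrier B" for v
      using that u by (simp_all add: A_def C_def cl)
    have sum: "A v \<boxplus> C v = \<^bold>0" if v: "v \<in> carrier B" for v
    proof -
      have "T (u \<boxplus> v) (u \<boxplus> v) (u \<boxplus> v) = T u u u \<boxplus> T v v v \<boxplus> (A v \<boxplus> C v)"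
        using u v by (simp add: A_def C_def cl add1 add2 add3 sym[of v u] M.a_ac)
      with u v AC[OF v] show ?thesis
        by (simp add: diag)
    qed
    have "A (\<boxminus> v) = \<boxminus> A v" "C (\<boxminus> v) = C v"
      using u v by (simp_all add: A_def C_def cl neg add1 add2 add3 M.minus_add M.a_ac)
    with sum[of v] sum[of "\<boxminus> v"] v AC[of v] have "A v \<boxplus> C v = \<boxminus> A v \<boxplus> C v"
      by simp
    then have "A v = \<boxminus> A v"
      using AC[OF v] by simp
    then have "A v \<boxplus> A v = \<^bold>0 \<boxplus> \<^bold>0"
      using AC[OF v] by (metis M.r_neg M.l_zero M.zero_closed)
    then show ?thesis
      using eq_of_double_eq[OF two, of "A v" "\<^bold>0"] AC[OF v] by (simp add: A_def)
  qed
  \<comment> \<open>Substituting \<open>x + w\<close> for the repeated argument of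
    \<open>odd\<close> produces each term of the wanted sum twice, next to instances of
    \<open>odd\<close> for \<open>x\<close> and for \<open>w\<close>.\<close>
  define D where "D = T x z w \<boxplus> T z w x \<boxplus> T w x z"
  have "(T x z x \<boxplus> T x z x \<boxplus> T x x z) \<boxplus> (T w z w \<boxplus> T w z w \<boxplus> T w w z) \<boxplus> (D \<boxplus> D) =
    T (x \<boxplus> w) z (x \<boxplus> w) \<boxplus> T (x \<boxplus> w) z (x \<boxplus> w) \<boxplus> T (x \<boxplus> w) (x \<boxplus> w) z"
    using x z w by (simp add: D_def cl add1 add2 add3 sym[of z w x] sym[of w x z] M.a_ac)
  then have "D \<boxplus> D = \<^bold>0 \<boxplus> \<^bold>0"
    using x z w odd by (simp add: D_def cl)
  then show ?thesis
    using eq_of_double_eq[OF two, of D "\<^bold>0"] x z w by (simp add: D_def cl)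
qed

text \<open>For fixed \<open>y\<close>, the associator \<open>T\<close> is symmetric in
  \<open>u\<close> and \<open>v\<close> by commutativity and vanishes on the diagonal by the Jordan
  identity, so it can be polarized.\<close>

lemma jordan_linearized:
  assumes two: "\<one>\<^bsub>F\<^esub> \<oplus>\<^bsub>F\<^esub> \<one>\<^bsub>F\<^esub> \<noteq> \<zero>\<^bsub>F\<^esub>"
    and x: "x \<in> carrier B" and y: "y \<in> carrier B" and z: "z \<in> carrier B" and w: "w \<in> carrier B"
  shows "((x \<bullet> z) \<bullet> y) \<bullet> w \<boxplus> ((z \<bullet> w) \<bullet> y) \<bullet> x \<boxplus> ((w \<bullet> x) \<bullet> y) \<bullet> z =
    (x \<bullet> z) \<bullet> (y \<bullet> w) \<boxplus> (z \<bullet> w) \<bullet> (y \<bullet> x) \<boxplus> (w \<bullet> x) \<bullet> (y \<bullet> z)"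
proof -
  define T where "T u v t = ((u \<bullet> v) \<bullet> y) \<bullet> t \<boxminus> (u \<bullet> v) \<bullet> (y \<bullet> t)" for u v t
  have "T x z w \<boxplus> T z w x \<boxplus> T w x z = \<^bold>0"
  proof (rule polarization[OF two, where T = T])
    fix u
    assume "u \<in> carrier B"
    then show "T u u u = \<^bold>0"
      using y jordan_identity[of u y] by (simp add: T_def minus_eq_zero_iff mult_closed)
  qed (use x y z w in \<open>simp_all add: T_def mult_closed mult_l_distr mult_r_distr M.minus_eq M.minus_add M.a_ac mult_comm\<close>)
  moreover have "(p \<boxminus> p') \<boxplus> (q \<boxminus> q') \<boxplus> (r \<boxminus> r') = (p \<boxplus> q \<boxplus> r) \<boxminus> (p' \<boxplus> q' \<boxplus> r')"
    if "p \<in> carrier B" "q \<in> carrier B" "r \<in> carrier B" "p' \<in> carrier B" "q' \<in> carrier B" "r' \<in> carrier B"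
    for p q r p' q' r'
    using that by (simp add: M.minus_eq M.minus_add M.a_ac)
  ultimately show ?thesis
    using x y z w by (simp add: T_def mult_closed minus_eq_zero_iff)
qed

text \<open>With \<open>L\<close> for multiplication by \<open>e\<close> this is
  \<open>2 L^3 - 3 L^2 + L = 0\<close>, whose roots 0, 1/2, 1 are the Peirce eigenvalues. It is the
  linearized identity with \<open>e\<close> in three of the four places.\<close>

lemma idempotent_peirce:
  assumes two: "\<one>\<^bsub>F\<^esub> \<oplus>\<^bsub>F\<^esub> \<one>\<^bsub>F\<^esub> \<noteq> \<zero>\<^bsub>F\<^esub>"
    and e: "e \<in> carrier B" "e \<bullet> e = e" and y: "y \<in> carrier B"
  shows "e \<bullet> (e \<bullet> (e \<bullet> y)) \<boxplus> e \<bullet> (e \<bullet> (e \<bullet> y)) \<boxplus> e \<bullet> y = e \<bullet> (e \<bullet> y) \<boxplus> e \<bullet> (e \<bullet> y) \<boxplus> e \<bullet> (e \<bullet> y)"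
proof -
  have "y \<bullet> e = e \<bullet> y" "(e \<bullet> y) \<bullet> e = e \<bullet> (e \<bullet> y)" "(e \<bullet> (e \<bullet> y)) \<bullet> e = e \<bullet> (e \<bullet> (e \<bullet> y))"
    using e y by (simp_all add: mult_comm mult_closed)
  with jordan_linearized[OF two y e(1) e(1) e(1)] e y show ?thesis
    by (simp add: mult_closed M.a_ac)
qed

text \<open>The linearized identity at \<open>e, y, z, e\<close> becomes
  \<open>2 e (z y) + z (e y) = 2 z (e y) + e (z y)\<close>, because \<open>e z = z\<close>.
  Subtracting \<open>e (z y) + z (e y)\<close> leaves the claim.\<close>

lemma idempotent_commutes_with_peirce_1:
  assumes two: "\<one>\<^bsub>F\<^esub> \<oplus>\<^bsub>F\<^esub> \<one>\<^bsub>F\<^esub> \<noteq> \<zero>\<^bsub>F\<^esub>"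
    and e: "e \<in> carrier B" "e \<bullet> e = e" and z: "z \<in> carrier B" "e \<bullet> z = z" and y: "y \<in> carrier B"
  shows "e \<bullet> (z \<bullet> y) = z \<bullet> (e \<bullet> y)"
proof -
  have "z \<bullet> e = z" "y \<bullet> e = e \<bullet> y" "y \<bullet> z = z \<bullet> y" "(z \<bullet> y) \<bullet> e = e \<bullet> (z \<bullet> y)" "(e \<bullet> y) \<bullet> z = z \<bullet> (e \<bullet> y)"
    using e z y by (simp_all add: mult_comm mult_closed)
  with jordan_linearized[OF two e(1) y z(1) e(1)] e z y
  have "e \<bullet> (z \<bullet> y) \<boxplus> (e \<bullet> (z \<bullet> y) \<boxplus> z \<bullet> (e \<bullet> y)) = z \<bullet> (e \<bullet> y) \<boxplus> (e \<bullet> (z \<bullet> y) \<boxplus> z \<bullet> (e \<bullet> y))"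
    by (simp add: mult_closed M.a_ac)
  then show ?thesis
    using e z y by (simp add: mult_closed)
qed

text \<open>In the same instance of the linearized identity, \<open>e z = 0\<close> kills the first
  two terms on either side.\<close>

lemma idempotent_commutes_with_peirce_0:
  assumes two: "\<one>\<^bsub>F\<^esub> \<oplus>\<^bsub>F\<^esub> \<one>\<^bsub>F\<^esub> \<noteq> \<zero>\<^bsub>F\<^esub>"
    and e: "e \<in> carrier B" "e \<bullet> e = e" and z: "z \<in> carrier B" "e \<bullet> z = \<^bold>0" and y: "y \<in> carrier B"
  shows "e \<bullet> (z \<bullet> y) = z \<bullet> (e \<bullet> y)"
proof -
  have "z \<bullet> e = \<^bold>0" "y \<bullet> e = e \<bullet> y" "y \<bullet> z = z \<bullet> y" "(z \<bullet> y) \<bullet> e = e \<bullet> (z \<bullet> y)" "(e \<bullet> y) \<bullet> z = z \<bullet> (e \<bullet> y)"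
    using e z y mult_comm[OF z(1) e(1)] by (simp_all add: mult_comm mult_closed)
  with jordan_linearized[OF two e(1) y z(1) e(1)] e z y show ?thesis
    by (simp add: mult_closed)
qed

text \<open>The hypothesis on \<open>s\<close> means that its Peirce 1/2-component vanishes:
  \<open>e s\<close> lies in the 1-space and \<open>s - e s\<close> in the 0-space, so the two
  preceding lemmas add up.\<close>

lemma idempotent_commutes:
  assumes two: "\<one>\<^bsub>F\<^esub> \<oplus>\<^bsub>F\<^esub> \<one>\<^bsub>F\<^esub> \<noteq> \<zero>\<^bsub>F\<^esub>"
    and e: "e \<in> carrier B" "e \<bullet> e = e" and s: "s \<in> carrier B" "e \<bullet> (e \<bullet> s) = e \<bullet> s" and y: "y \<in> carrier B"
  shows "s \<bullet> (e \<bullet> y) = e \<bullet> (s \<bullet> y)"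
proof -
  let ?p = "e \<bullet> s" and ?q = "s \<boxminus> e \<bullet> s"
  have p: "?p \<in> carrier B" "e \<bullet> ?p = ?p" and q: "?q \<in> carrier B" "e \<bullet> ?q = \<^bold>0"
    using e s by (auto simp: mult_closed M.minus_eq mult_r_distr mult_r_minus M.r_neg)
  have "s \<bullet> (e \<bullet> y) = ?p \<bullet> (e \<bullet> y) \<boxplus> ?q \<bullet> (e \<bullet> y)"
    using e(1) s(1) y by algebra
  also have "\<dots> = e \<bullet> (?p \<bullet> y) \<boxplus> e \<bullet> (?q \<bullet> y)"
    using idempotent_commutes_with_peirce_1[OF two e p y] idempotent_commutes_with_peirce_0[OF two e q y]
    by simp
  also have "\<dots> = e \<bullet> (s \<bullet> y)"
    using e(1) s(1) y by algebra
  finally show ?thesis .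
qed

lemma idempotent_difference_square:
  assumes "e \<in> carrier B" "e \<bullet> e = e" "f \<in> carrier B" "f \<bullet> f = f"
  shows "(e \<boxminus> f) \<bullet> (e \<boxminus> f) = e \<boxplus> f \<boxminus> (e \<bullet> f \<boxplus> e \<bullet> f)"
  using assms by algebra

text \<open>Supplies the hypothesis of \<open>idempotent_commutes\<close> for
  \<open>s = (e - f)^2\<close>. Since \<open>e s = e + e f - 2 e (e f)\<close>, the equation is
  \<open>idempotent_peirce\<close> applied to \<open>f\<close>.\<close>

lemma idempotent_mult_difference_square:
  assumes two: "\<one>\<^bsub>F\<^esub> \<oplus>\<^bsub>F\<^esub> \<one>\<^bsub>F\<^esub> \<noteq> \<zero>\<^bsub>F\<^esub>"
    and e: "e \<in> carrier B" "e \<bullet> e = e" and f: "f \<in> carrier B" "f \<bullet> f = f"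
  shows "e \<bullet> (e \<bullet> ((e \<boxminus> f) \<bullet> (e \<boxminus> f))) = e \<bullet> ((e \<boxminus> f) \<bullet> (e \<boxminus> f))"
proof -
  let ?n = "e \<bullet> f"
  have n: "?n \<in> carrier B"
    using e f by (simp add: mult_closed)
  have "e \<bullet> (e \<boxplus> f \<boxminus> (?n \<boxplus> ?n)) = e \<boxplus> (?n \<boxminus> (e \<bullet> ?n \<boxplus> e \<bullet> ?n))"
    using e f(1) n by (simp add: mult_r_distr mult_r_minus mult_closed M.minus_eq M.minus_add M.a_assoc)
  moreover from this
  have "e \<bullet> (e \<bullet> (e \<boxplus> f \<boxminus> (?n \<boxplus> ?n))) = e \<boxplus> (e \<bullet> ?n \<boxminus> (e \<bullet> (e \<bullet> ?n) \<boxplus> e \<bullet> (e \<bullet> ?n)))"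
    using e f(1) n by (simp add: mult_r_distr mult_r_minus mult_closed M.minus_eq M.minus_add M.a_assoc)
  moreover have "e \<bullet> ?n \<boxminus> (e \<bullet> (e \<bullet> ?n) \<boxplus> e \<bullet> (e \<bullet> ?n)) = ?n \<boxminus> (e \<bullet> ?n \<boxplus> e \<bullet> ?n)"
    using idempotent_peirce[OF two e f(1)] e n by (subst minus_eq_minus_iff) (simp_all add: mult_closed M.a_ac)
  ultimately show ?thesis
    using e f by (simp add: idempotent_difference_square)
qed

text \<open>Solving the linearized identity at \<open>y, v, z, w\<close> for
  \<open>((z w) v) y\<close> gives \<open>L ((z w) v) = L (v w) L z + L (z w) L v + L (z v) L w - L
  w L v L z - L z L v L w\<close>. Every factor on the right commutes with
  \<open>L s\<close>.\<close>

lemma commuting_triple: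
  assumes two: "\<one>\<^bsub>F\<^esub> \<oplus>\<^bsub>F\<^esub> \<one>\<^bsub>F\<^esub> \<noteq> \<zero>\<^bsub>F\<^esub>"
    and s: "s \<in> carrier B" and cl: "z \<in> carrier B" "w \<in> carrier B" "v \<in> carrier B"
    and comm: "\<And>t y. \<lbrakk>t \<in> {z, w, v, z \<bullet> w, w \<bullet> v, z \<bullet> v}; y \<in> carrier B\<rbrakk> \<Longrightarrow> s \<bullet> (t \<bullet> y) = t \<bullet> (s \<bullet> y)"
    and x: "x \<in> carrier B"
  shows "s \<bullet> (((z \<bullet> w) \<bullet> v) \<bullet> x) = ((z \<bullet> w) \<bullet> v) \<bullet> (s \<bullet> x)"
proof -
  have rep: "((z \<bullet> w) \<bullet> v) \<bullet> y =
      ((v \<bullet> w) \<bullet> (z \<bullet> y) \<boxplus> (z \<bullet> w) \<bullet> (v \<bullet> y) \<boxplus> (z \<bullet> v) \<bullet> (w \<bullet> y)) \<boxminus> (w \<bullet> (v \<bullet> (z \<bullet> y)) \<boxplus> z \<bullet> (v \<bullet> (w \<bullet> y)))"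
    (is "?l y = ?r y") if y: "y \<in> carrier B" for y
  proof -
    have "(((y \<bullet> z) \<bullet> v) \<bullet> w) \<boxplus> ?l y \<boxplus> ((w \<bullet> y) \<bullet> v) \<bullet> z =
        (y \<bullet> z) \<bullet> (v \<bullet> w) \<boxplus> (z \<bullet> w) \<bullet> (v \<bullet> y) \<boxplus> (w \<bullet> y) \<bullet> (v \<bullet> z)"
      by (rule jordan_linearized[OF two y cl(3,1,2)])
    moreover have "((y \<bullet> z) \<bullet> v) \<bullet> w = w \<bullet> (v \<bullet> (z \<bullet> y))" "((w \<bullet> y) \<bullet> v) \<bullet> z = z \<bullet> (v \<bullet> (w \<bullet> y))"
      "(y \<bullet> z) \<bullet> (v \<bullet> w) = (v \<bullet> w) \<bullet> (z \<bullet> y)" "(w \<bullet> y) \<bullet> (v \<bullet> z) = (z \<bullet> v) \<bullet> (w \<bullet> y)"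
      using cl y by (simp_all add: mult_closed mult_comm)
    moreover have move: "p = q \<boxminus> (r \<boxplus> t)" if "r \<boxplus> p \<boxplus> t = q" "p \<in> carrier B" "r \<in> carrier B" "t \<in> carrier B" for p q r t
    proof -
      have "q = p \<boxplus> (r \<boxplus> t)"
        using that by (simp add: M.a_ac)
      with that(2-4) show ?thesis
        by (simp add: M.minus_eq M.a_assoc[of p "r \<boxplus> t"] M.r_neg)
    qed
    ultimately show ?thesis
      using cl y by (intro move) (simp_all add: mult_closed)
  qed
  have "s \<bullet> (w \<bullet> (v \<bullet> (z \<bullet> x))) = w \<bullet> (v \<bullet> (z \<bullet> (s \<bullet> x)))" "s \<bullet> (z \<bullet> (v \<bullet> (w \<bullet> x))) = z \<bullet> (v \<bullet> (w \<bullet> (s \<bullet> x)))"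
    using cl s x by (simp_all add: comm mult_closed)
  moreover have "s \<bullet> ((v \<bullet> w) \<bullet> (z \<bullet> x)) = (v \<bullet> w) \<bullet> (z \<bullet> (s \<bullet> x))"
    "s \<bullet> ((z \<bullet> w) \<bullet> (v \<bullet> x)) = (z \<bullet> w) \<bullet> (v \<bullet> (s \<bullet> x))" "s \<bullet> ((z \<bullet> v) \<bullet> (w \<bullet> x)) = (z \<bullet> v) \<bullet> (w \<bullet> (s \<bullet> x))"
    using cl s x by (simp_all add: comm mult_closed mult_comm[of v w])
  ultimately show ?thesis
    unfolding rep[OF x] rep[OF mult_closed[OF s x]] using cl s x
    by (simp add: M.minus_eq mult_r_distr mult_r_minus mult_closed)
qed

end

section \<open>Multiplications that commute with multiplication by \<sigma>\<close>

locale jordan_two_idempotents = jordan_algebra F B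
  for F (structure) and B (structure) +
  fixes a b \<sigma>
  assumes two: "\<one>\<^bsub>F\<^esub> \<oplus>\<^bsub>F\<^esub> \<one>\<^bsub>F\<^esub> \<noteq> \<zero>\<^bsub>F\<^esub>"
    and generated: "generated_by_idempotents F B a b"
    and sigma_def: "\<sigma> = (a \<boxminus> b) \<bullet> (a \<boxminus> b)"
begin

lemma ab [simp]: "a \<in> carrier B" "b \<in> carrier B" "a \<bullet> a = a" "b \<bullet> b = b" "a \<noteq> b"
  using generated by (auto simp: generated_by_idempotents_def)

lemma sigma_closed [simp]: "\<sigma> \<in> carrier B"
  by (simp add: sigma_def mult_closed)

lemma ab_closed [simp]: "a \<bullet> b \<in> carrier B"
  by (simp add: mult_closed)

lemma sigma_eq: "\<sigma> = a \<boxplus> b \<boxminus> (a \<bullet> b \<boxplus> a \<bullet> b)"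
  unfolding sigma_def by (rule idempotent_difference_square) simp_all

lemma sigma_eq': "\<sigma> = (b \<boxminus> a) \<bullet> (b \<boxminus> a)"
proof -
  have "(a \<boxminus> b) \<bullet> (a \<boxminus> b) = (b \<boxminus> a) \<bullet> (b \<boxminus> a)"
    using ab(1,2) by algebra
  then show ?thesis by (simp add: sigma_def)
qed

text \<open>Visibly a subspace, but not visibly closed under products; this is why
  \<open>commutant_sigma_triple\<close> carries side conditions on pairwise products.\<close>

definition "commutant_sigma = {z \<in> carrier B. \<forall>y\<in>carrier B. \<sigma> \<bullet> (z \<bullet> y) = z \<bullet> (\<sigma> \<bullet> y)}"

lemma commutant_sigmaD: "\<lbrakk>z \<in> commutant_sigma; y \<in> carrier B\<rbrakk> \<Longrightarrow> \<sigma> \<bullet> (z \<bullet> y) = z \<bullet> (\<sigma> \<bullet> y)"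
  unfolding commutant_sigma_def by blast

lemma commutant_sigmaI:
  "\<lbrakk>z \<in> carrier B; \<And>y. y \<in> carrier B \<Longrightarrow> \<sigma> \<bullet> (z \<bullet> y) = z \<bullet> (\<sigma> \<bullet> y)\<rbrakk> \<Longrightarrow> z \<in> commutant_sigma"
  unfolding commutant_sigma_def by blast

lemma commutant_sigma_closed: "z \<in> commutant_sigma \<Longrightarrow> z \<in> carrier B"
  by (simp add: commutant_sigma_def)

lemma commutant_sigma_a: "a \<in> commutant_sigma"
  using idempotent_commutes[OF two ab(1,3) sigma_closed] idempotent_mult_difference_square[OF two ab(1,3,2,4)]
  by (simp add: commutant_sigma_def sigma_def[symmetric])

lemma commutant_sigma_b: "b \<in> commutant_sigma"
  using idempotent_commutes[OF two ab(2,4) sigma_closed] idempotent_mult_difference_square[OF two ab(2,4,1,3)]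
  by (simp add: commutant_sigma_def sigma_eq'[symmetric])

lemma commutant_sigma_sigma: "\<sigma> \<in> commutant_sigma"
  by (simp add: commutant_sigma_def)

lemma commutant_sigma_add: "\<lbrakk>z \<in> commutant_sigma; w \<in> commutant_sigma\<rbrakk> \<Longrightarrow> z \<boxplus> w \<in> commutant_sigma"
  by (rule commutant_sigmaI)
    (simp_all add: commutant_sigmaD commutant_sigma_closed mult_l_distr mult_r_distr mult_closed)

lemma commutant_sigma_smult: "\<lbrakk>\<alpha> \<in> carrier F; z \<in> commutant_sigma\<rbrakk> \<Longrightarrow> \<alpha> \<odot>\<^bsub>B\<^esub> z \<in> commutant_sigma"
  by (rule commutant_sigmaI)
    (simp_all add: commutant_sigmaD commutant_sigma_closed mult_l_smult mult_r_smult mult_closed)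

lemma commutant_sigma_neg: "z \<in> commutant_sigma \<Longrightarrow> \<boxminus> z \<in> commutant_sigma"
  by (rule commutant_sigmaI)
    (simp_all add: commutant_sigmaD commutant_sigma_closed mult_l_minus mult_r_minus mult_closed)

text \<open>Since \<open>2 a b = a + b - \<sigma>\<close> lies in the subspace, so does
  \<open>a b\<close>, as 2 can be cancelled.\<close>

lemma commutant_sigma_ab: "a \<bullet> b \<in> commutant_sigma"
proof -
  have "\<sigma> \<bullet> ((a \<bullet> b) \<bullet> y) = (a \<bullet> b) \<bullet> (\<sigma> \<bullet> y)" if y: "y \<in> carrier B" for y
  proof (rule eq_of_double_eq[OF two])
    have eq: "a \<bullet> b \<boxplus> a \<bullet> b = a \<boxplus> b \<boxplus> \<boxminus> \<sigma>"
      unfolding sigma_eq using ab(1,2) by algebra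
    have mem: "a \<boxplus> b \<boxplus> \<boxminus> \<sigma> \<in> commutant_sigma"
      by (intro commutant_sigma_add commutant_sigma_a commutant_sigma_b commutant_sigma_neg commutant_sigma_sigma)
    have "\<sigma> \<bullet> ((a \<bullet> b) \<bullet> y) \<boxplus> \<sigma> \<bullet> ((a \<bullet> b) \<bullet> y) = \<sigma> \<bullet> ((a \<bullet> b \<boxplus> a \<bullet> b) \<bullet> y)"
      using y by (simp add: mult_l_distr mult_r_distr mult_closed)
    also have "\<dots> = (a \<bullet> b \<boxplus> a \<bullet> b) \<bullet> (\<sigma> \<bullet> y)"
      unfolding eq by (rule commutant_sigmaD[OF mem y])
    finally show "\<sigma> \<bullet> ((a \<bullet> b) \<bullet> y) \<boxplus> \<sigma> \<bullet> ((a \<bullet> b) \<bullet> y) = (a \<bullet> b) \<bullet> (\<sigma> \<bullet> y) \<boxplus> (a \<bullet> b) \<bullet> (\<sigma> \<bullet> y)"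
      using y by (simp add: mult_l_distr mult_closed)
  qed (use y in \<open>simp_all add: mult_closed\<close>)
  then show ?thesis by (simp add: commutant_sigma_def)
qed

lemma commutant_sigma_triple:
  assumes "z \<in> commutant_sigma" "w \<in> commutant_sigma" "v \<in> commutant_sigma"
    "z \<bullet> w \<in> commutant_sigma" "w \<bullet> v \<in> commutant_sigma" "z \<bullet> v \<in> commutant_sigma"
  shows "(z \<bullet> w) \<bullet> v \<in> commutant_sigma"
proof -
  have "\<sigma> \<bullet> (((z \<bullet> w) \<bullet> v) \<bullet> x) = ((z \<bullet> w) \<bullet> v) \<bullet> (\<sigma> \<bullet> x)" if "x \<in> carrier B" for x
    by (rule commuting_triple[OF two sigma_closed _ _ _ _ that])
      (use assms in \<open>auto simp: commutant_sigma_closed intro: commutant_sigmaD\<close>)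
  then show ?thesis
    using assms by (simp add: commutant_sigma_def mult_closed)
qed

text \<open>Here \<open>\<sigma> e = e + e f - 2 (e f) e\<close>, and the only new product
  \<open>(e f) e\<close> is a triple whose pairwise products \<open>e f\<close>, \<open>f e\<close>,
  \<open>e e\<close> are known. The form with \<open>e\<close> and \<open>f\<close> serves
  \<open>a\<close> and \<open>b\<close> alike.\<close>

lemma commutant_sigma_sigma_idempotent:
  assumes e: "e \<in> commutant_sigma" "e \<bullet> e = e" and f: "f \<in> commutant_sigma"
    and ef: "e \<bullet> f \<in> commutant_sigma" and s: "\<sigma> = e \<boxplus> f \<boxminus> (e \<bullet> f \<boxplus> e \<bullet> f)"
  shows "\<sigma> \<bullet> e \<in> commutant_sigma"
proof -
  note cl = commutant_sigma_closed[OF e(1)] commutant_sigma_closed[OF f]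
  have fe: "f \<bullet> e \<in> commutant_sigma"
    using ef cl by (simp add: mult_comm)
  have efe: "(e \<bullet> f) \<bullet> e \<in> commutant_sigma"
    by (rule commutant_sigma_triple) (simp_all add: e f ef fe)
  have "\<sigma> \<bullet> e = e \<boxplus> e \<bullet> f \<boxplus> \<boxminus> ((e \<bullet> f) \<bullet> e \<boxplus> (e \<bullet> f) \<bullet> e)"
    unfolding s using cl e(2) by algebra
  moreover have "\<dots> \<in> commutant_sigma"
    by (intro commutant_sigma_add commutant_sigma_neg e(1) ef efe)
  ultimately show ?thesis by simp
qed

lemma commutant_sigma_sigma_a: "\<sigma> \<bullet> a \<in> commutant_sigma"
  by (rule commutant_sigma_sigma_idempotent[OF commutant_sigma_a _ commutant_sigma_b commutant_sigma_ab sigma_eq])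
    simp

lemma commutant_sigma_sigma_b: "\<sigma> \<bullet> b \<in> commutant_sigma"
proof (rule commutant_sigma_sigma_idempotent[OF commutant_sigma_b _ commutant_sigma_a])
  show "\<sigma> = b \<boxplus> a \<boxminus> (b \<bullet> a \<boxplus> b \<bullet> a)"
    unfolding sigma_eq by (simp add: mult_comm M.a_comm)
  show "b \<bullet> a \<in> commutant_sigma"
    using commutant_sigma_ab by (simp add: mult_comm)
qed simp

text \<open>This is the Jordan identity for \<sigma> itself, up to commutativity.\<close>

lemma commutant_sigma_sigma_sigma: "\<sigma> \<bullet> \<sigma> \<in> commutant_sigma"
proof -
  have "\<sigma> \<bullet> ((\<sigma> \<bullet> \<sigma>) \<bullet> y) = (\<sigma> \<bullet> \<sigma>) \<bullet> (\<sigma> \<bullet> y)" if "y \<in> carrier B" for y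
    using jordan_identity[OF sigma_closed that] that by (simp add: mult_closed mult_comm)
  then show ?thesis by (simp add: commutant_sigma_def mult_closed)
qed

text \<open>The module over F[\<sigma>] spanned by \<open>a\<close>, \<open>b\<close> and \<sigma>,
  given by closure rules because the constant polynomial 1 may live outside the algebra. Once the
  set is known to be everything, its rules become the induction principle
  \<open>sigma_span_induct\<close>.\<close>

inductive_set sigma_span where
  a: "a \<in> sigma_span"
| b: "b \<in> sigma_span"
| sigma: "\<sigma> \<in> sigma_span"
| add: "\<lbrakk>x \<in> sigma_span; y \<in> sigma_span\<rbrakk> \<Longrightarrow> x \<boxplus> y \<in> sigma_span"
| smult: "\<lbrakk>\<alpha> \<in> carrier F; x \<in> sigma_span\<rbrakk> \<Longrightarrow> \<alpha> \<odot>\<^bsub>B\<^esub> x \<in> sigma_span"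
| mult: "x \<in> sigma_span \<Longrightarrow> \<sigma> \<bullet> x \<in> sigma_span"

lemma sigma_span_closed: "x \<in> sigma_span \<Longrightarrow> x \<in> carrier B"
  by (induction rule: sigma_span.induct) (simp_all add: mult_closed)

text \<open>The second conjunct strengthens the induction: in the step to \<open>\<sigma> x\<close>,
  the triple \<open>(\<sigma> x) \<sigma>\<close> is controlled by the pairwise products
  \<open>\<sigma> x\<close>, \<open>x \<sigma>\<close> and \<open>\<sigma> \<sigma>\<close>.\<close>

lemma sigma_span_commutant:
  "x \<in> sigma_span \<Longrightarrow> x \<in> commutant_sigma \<and> \<sigma> \<bullet> x \<in> commutant_sigma"
proof (induction rule: sigma_span.induct)
  case (add x y)
  then show ?case
    by (simp add: commutant_sigma_add mult_r_distr commutant_sigma_closed)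
next
  case (smult \<alpha> x)
  then show ?case
    by (simp add: commutant_sigma_smult mult_r_smult commutant_sigma_closed)
next
  case (mult x)
  have "(\<sigma> \<bullet> x) \<bullet> \<sigma> \<in> commutant_sigma"
    using mult.IH mult_comm[of x \<sigma>]
    by (intro commutant_sigma_triple) (simp_all add: commutant_sigma_sigma commutant_sigma_sigma_sigma commutant_sigma_closed)
  with mult.IH show ?case
    by (simp add: mult_comm[of "\<sigma> \<bullet> x" \<sigma>] commutant_sigma_closed)
qed (simp_all add: commutant_sigma_a commutant_sigma_b commutant_sigma_sigma commutant_sigma_sigma_a
  commutant_sigma_sigma_b commutant_sigma_sigma_sigma)

lemma sigma_lcomm: "\<lbrakk>x \<in> sigma_span; y \<in> carrier B\<rbrakk> \<Longrightarrow> x \<bullet> (\<sigma> \<bullet> y) = \<sigma> \<bullet> (x \<bullet> y)"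
  using sigma_span_commutant commutant_sigmaD by simp

text \<open>Because \<open>x (\<sigma> y) = \<sigma> (x y)\<close>, closure under multiplication by
  \<open>x\<close> has to be checked on the three generators only.\<close>

lemma sigma_span_mult_right:
  assumes "x \<in> sigma_span" "x \<bullet> a \<in> sigma_span" "x \<bullet> b \<in> sigma_span" "x \<bullet> \<sigma> \<in> sigma_span" "y \<in> sigma_span"
  shows "x \<bullet> y \<in> sigma_span"
  using assms(5)
proof (induction rule: sigma_span.induct)
  case (add y z)
  then show ?case
    using assms(1) by (simp add: mult_r_distr sigma_span_closed sigma_span.add)
next
  case (smult \<alpha> y)
  then show ?case
    using assms(1) by (simp add: mult_r_smult sigma_span_closed sigma_span.smult)
next
  case (mult y)
  then show ?case
    using assms(1) by (simp add: sigma_lcomm sigma_span_closed sigma_span.mult)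
qed (use assms in auto)

lemma sigma_span_neg: "x \<in> sigma_span \<Longrightarrow> \<boxminus> x \<in> sigma_span"
  using sigma_span.smult[of "\<ominus>\<^bsub>F\<^esub> \<one>\<^bsub>F\<^esub>" x] sigma_span_closed[of x] by (simp add: smult_l_minus)

lemma sigma_span_ab: "a \<bullet> b \<in> sigma_span"
proof -
  let ?t = "\<one>\<^bsub>F\<^esub> \<oplus>\<^bsub>F\<^esub> \<one>\<^bsub>F\<^esub>"
  have t: "?t \<in> Units F"
    using two by (simp add: K.field_Units)
  have "a \<boxplus> b \<boxplus> \<boxminus> \<sigma> \<in> sigma_span"
    by (intro sigma_span.intros sigma_span_neg)
  moreover have "a \<boxplus> b \<boxplus> \<boxminus> \<sigma> = a \<bullet> b \<boxplus> a \<bullet> b"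
    unfolding sigma_eq using ab(1,2) by algebra
  moreover have "\<dots> = ?t \<odot>\<^bsub>B\<^esub> (a \<bullet> b)"
    by (simp add: smult_l_distr)
  ultimately have "?t \<odot>\<^bsub>B\<^esub> (a \<bullet> b) \<in> sigma_span"
    by simp
  then have "inv\<^bsub>F\<^esub> ?t \<odot>\<^bsub>B\<^esub> (?t \<odot>\<^bsub>B\<^esub> (a \<bullet> b)) \<in> sigma_span"
    by (rule sigma_span.smult[OF K.Units_inv_closed[OF t]])
  moreover have "inv\<^bsub>F\<^esub> ?t \<odot>\<^bsub>B\<^esub> (?t \<odot>\<^bsub>B\<^esub> (a \<bullet> b)) = a \<bullet> b"
    using t by (simp add: smult_assoc1[symmetric] K.Units_l_inv)
  ultimately show ?thesis
    by simp
qed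

text \<open>The reduction to generators is applied twice: with \<open>a\<close> or \<open>b\<close>
  as the left factor and then, after commuting, with an arbitrary left factor.\<close>

lemma sigma_span_mult:
  assumes x: "x \<in> sigma_span" and y: "y \<in> sigma_span"
  shows "x \<bullet> y \<in> sigma_span"
proof -
  have s: "x \<bullet> \<sigma> \<in> sigma_span" if "x \<in> sigma_span" for x
    using sigma_span.mult[OF that] mult_comm[of \<sigma> x] sigma_span_closed[OF that] by simp
  have ba: "b \<bullet> a \<in> sigma_span"
    using sigma_span_ab by (simp add: mult_comm)
  have a: "x \<bullet> a \<in> sigma_span" if "x \<in> sigma_span" for x
    using sigma_span_mult_right[OF sigma_span.a _ sigma_span_ab s[OF sigma_span.a] that] that
    by (simp add: sigma_span.a mult_comm[of x a] sigma_span_closed)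
  have b: "x \<bullet> b \<in> sigma_span" if "x \<in> sigma_span" for x
    using sigma_span_mult_right[OF sigma_span.b ba _ s[OF sigma_span.b] that] that
    by (simp add: sigma_span.b mult_comm[of x b] sigma_span_closed)
  show ?thesis
    by (rule sigma_span_mult_right) (use x y a b s in auto)
qed

lemma sigma_span_eq: "sigma_span = carrier B"
proof
  show "sigma_span \<subseteq> carrier B"
    using sigma_span_closed by blast
  have "submodule sigma_span F B"
  proof (rule submoduleI)
    show "\<^bold>0 \<in> sigma_span"
      using sigma_span.smult[OF K.zero_closed sigma_span.a] by simp
  qed (auto intro: sigma_span_closed sigma_span.intros sigma_span_neg)
  then have "na_subalgebra F B sigma_span \<and> {a, b} \<subseteq> sigma_span"
    by (auto simp: na_subalgebra_def intro: sigma_span_mult sigma_span.a sigma_span.b)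
  then have "generated_subalgebra F B {a, b} \<subseteq> sigma_span"
    unfolding generated_subalgebra_def by blast
  then show "carrier B \<subseteq> sigma_span"
    using generated by (simp add: generated_by_idempotents_def)
qed

text \<open>As the span is everything, multiplication by \<sigma> commutes with all multiplications;
  in a commutative algebra this makes every associator containing \<sigma> vanish.\<close>

lemma sigma_center: "\<sigma> \<in> center B"
proof (rule centerI)
  show lc: "x \<bullet> (\<sigma> \<bullet> y) = \<sigma> \<bullet> (x \<bullet> y)" if "x \<in> carrier B" "y \<in> carrier B" for x y
    using that sigma_lcomm by (simp add: sigma_span_eq)
  show "\<sigma> \<bullet> x \<bullet> y = \<sigma> \<bullet> (x \<bullet> y)" if "x \<in> carrier B" "y \<in> carrier B" for x y
    using lc[OF that(2,1)] that by (simp add: mult_comm mult_closed)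
qed (simp_all add: mult_comm)

lemmas sigma_span_induct [consumes 1, case_names a b sigma add smult mult] =
  sigma_span.induct[unfolded sigma_span_eq]

end

section \<open>The unital hull\<close>

context na_algebra
begin

lemma smult_lcomm:
  "\<lbrakk>\<alpha> \<in> carrier F; \<beta> \<in> carrier F; x \<in> carrier B\<rbrakk> \<Longrightarrow> \<alpha> \<odot>\<^bsub>B\<^esub> (\<beta> \<odot>\<^bsub>B\<^esub> x) = \<beta> \<odot>\<^bsub>B\<^esub> (\<alpha> \<odot>\<^bsub>B\<^esub> x)"
  by (simp add: smult_assoc1[symmetric] K.m_comm)

text \<open>The first components that occur in the hull. In either case they form an ideal of
  \<open>F\<close>, which lets the algebra laws of the hull be computed uniformly; the case
  distinction matters again in \<open>hull_identity\<close>.\<close>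

definition hull_scalars where
  "hull_scalars = (if \<exists>u. is_identity B u then {\<zero>\<^bsub>F\<^esub>} else carrier F)"

lemma hull_scalars_cases:
  obtains "hull_scalars = {\<zero>\<^bsub>F\<^esub>}" | "hull_scalars = carrier F"
  by (cases "\<exists>u. is_identity B u") (simp_all add: hull_scalars_def)

lemma hull_scalars_closed [simp]: "\<alpha> \<in> hull_scalars \<Longrightarrow> \<alpha> \<in> carrier F"
  by (cases rule: hull_scalars_cases) simp_all

lemma hull_scalars_zero [simp]: "\<zero>\<^bsub>F\<^esub> \<in> hull_scalars"
  by (cases rule: hull_scalars_cases) simp_all

lemma hull_scalars_add [simp]: "\<lbrakk>\<alpha> \<in> hull_scalars; \<beta> \<in> hull_scalars\<rbrakk> \<Longrightarrow> \<alpha> \<oplus>\<^bsub>F\<^esub> \<beta> \<in> hull_scalars"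
  by (cases rule: hull_scalars_cases) simp_all

lemma hull_scalars_neg [simp]: "\<alpha> \<in> hull_scalars \<Longrightarrow> \<ominus>\<^bsub>F\<^esub> \<alpha> \<in> hull_scalars"
  by (cases rule: hull_scalars_cases) simp_all

lemma hull_scalars_mult [simp]: "\<lbrakk>\<gamma> \<in> carrier F; \<alpha> \<in> hull_scalars\<rbrakk> \<Longrightarrow> \<gamma> \<otimes>\<^bsub>F\<^esub> \<alpha> \<in> hull_scalars"
  by (cases rule: hull_scalars_cases) simp_all

abbreviation "Bu \<equiv> unital_hull F B"

lemma hull_simps:
  "carrier Bu = hull_scalars \<times> carrier B"
  "(\<alpha>, x) \<otimes>\<^bsub>Bu\<^esub> (\<beta>, y) = (\<alpha> \<otimes>\<^bsub>F\<^esub> \<beta>, (\<alpha> \<odot>\<^bsub>B\<^esub> y \<boxplus> \<beta> \<odot>\<^bsub>B\<^esub> x) \<boxplus> x \<bullet> y)"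
  "\<zero>\<^bsub>Bu\<^esub> = (\<zero>\<^bsub>F\<^esub>, \<^bold>0)"
  "(\<alpha>, x) \<oplus>\<^bsub>Bu\<^esub> (\<beta>, y) = (\<alpha> \<oplus>\<^bsub>F\<^esub> \<beta>, x \<boxplus> y)"
  "\<gamma> \<odot>\<^bsub>Bu\<^esub> (\<alpha>, x) = (\<gamma> \<otimes>\<^bsub>F\<^esub> \<alpha>, \<gamma> \<odot>\<^bsub>B\<^esub> x)"
  by (simp_all add: unital_hull_def hull_scalars_def)

lemma hull_abelian_group: "abelian_group Bu"
proof (rule abelian_groupI)
  fix p
  assume "p \<in> carrier Bu"
  then show "\<exists>q\<in>carrier Bu. q \<oplus>\<^bsub>Bu\<^esub> p = \<zero>\<^bsub>Bu\<^esub>"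
    by (intro bexI[of _ "(\<ominus>\<^bsub>F\<^esub> fst p, \<boxminus> (snd p))"]) (auto simp: hull_simps K.l_neg M.l_neg)
qed (auto simp: hull_simps M.a_ac K.a_ac)

lemma hull_module: "module F Bu"
proof (rule moduleI[OF K.is_cring hull_abelian_group])
  fix p
  assume "p \<in> carrier Bu"
  then obtain \<gamma> x where p: "p = (\<gamma>, x)" and cl: "\<gamma> \<in> hull_scalars" "x \<in> carrier B"
    by (auto simp: hull_simps)
  show "\<one>\<^bsub>F\<^esub> \<odot>\<^bsub>Bu\<^esub> p = p"
    unfolding p using cl by (simp add: hull_simps)
  fix \<alpha>
  assume \<alpha>: "\<alpha> \<in> carrier F"
  show "\<alpha> \<odot>\<^bsub>Bu\<^esub> p \<in> carrier Bu"
    unfolding p using \<alpha> cl by (simp add: hull_simps)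
  show "(\<alpha> \<oplus>\<^bsub>F\<^esub> \<beta>) \<odot>\<^bsub>Bu\<^esub> p = \<alpha> \<odot>\<^bsub>Bu\<^esub> p \<oplus>\<^bsub>Bu\<^esub> \<beta> \<odot>\<^bsub>Bu\<^esub> p" if "\<beta> \<in> carrier F" for \<beta>
    unfolding p using \<alpha> cl that by (simp add: hull_simps smult_l_distr K.l_distr)
  show "(\<alpha> \<otimes>\<^bsub>F\<^esub> \<beta>) \<odot>\<^bsub>Bu\<^esub> p = \<alpha> \<odot>\<^bsub>Bu\<^esub> (\<beta> \<odot>\<^bsub>Bu\<^esub> p)" if "\<beta> \<in> carrier F" for \<beta>
    unfolding p using \<alpha> cl that by (simp add: hull_simps smult_assoc1 K.m_assoc)
  show "\<alpha> \<odot>\<^bsub>Bu\<^esub> (p \<oplus>\<^bsub>Bu\<^esub> q) = \<alpha> \<odot>\<^bsub>Bu\<^esub> p \<oplus>\<^bsub>Bu\<^esub> \<alpha> \<odot>\<^bsub>Bu\<^esub> q" if "q \<in> carrier Bu" for q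
    unfolding p using \<alpha> cl that by (cases q) (simp add: hull_simps smult_r_distr K.r_distr)
qed

lemma hull_na_algebra: "na_algebra F Bu"
proof (intro na_algebra.intro na_algebra_axioms.intro K.field_axioms hull_module)
  fix p q
  assume "p \<in> carrier Bu" "q \<in> carrier Bu"
  then obtain \<alpha> x \<beta> y where pq: "p = (\<alpha>, x)" "q = (\<beta>, y)"
    and cl: "\<alpha> \<in> hull_scalars" "x \<in> carrier B" "\<beta> \<in> hull_scalars" "y \<in> carrier B"
    by (auto simp: hull_simps)
  show "p \<otimes>\<^bsub>Bu\<^esub> q \<in> carrier Bu"
    unfolding pq using cl by (simp add: hull_simps mult_closed)
  show "(\<gamma> \<odot>\<^bsub>Bu\<^esub> p) \<otimes>\<^bsub>Bu\<^esub> q = \<gamma> \<odot>\<^bsub>Bu\<^esub> (p \<otimes>\<^bsub>Bu\<^esub> q)" if "\<gamma> \<in> carrier F" for \<gamma>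
    unfolding pq using cl that smult_lcomm[of \<gamma> \<beta> x]
    by (simp add: hull_simps mult_closed K.m_assoc smult_assoc1 smult_r_distr mult_l_smult)
  show "p \<otimes>\<^bsub>Bu\<^esub> (\<gamma> \<odot>\<^bsub>Bu\<^esub> q) = \<gamma> \<odot>\<^bsub>Bu\<^esub> (p \<otimes>\<^bsub>Bu\<^esub> q)" if "\<gamma> \<in> carrier F" for \<gamma>
    unfolding pq using cl that smult_lcomm[of \<gamma> \<alpha> y]
    by (simp add: hull_simps mult_closed K.m_lcomm smult_assoc1 smult_r_distr mult_r_smult)
  fix r
  assume "r \<in> carrier Bu"
  then obtain \<gamma> z where r: "r = (\<gamma>, z)" and cl': "\<gamma> \<in> hull_scalars" "z \<in> carrier B"
    by (auto simp: hull_simps)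
  show "(p \<oplus>\<^bsub>Bu\<^esub> q) \<otimes>\<^bsub>Bu\<^esub> r = p \<otimes>\<^bsub>Bu\<^esub> r \<oplus>\<^bsub>Bu\<^esub> q \<otimes>\<^bsub>Bu\<^esub> r"
    unfolding pq r using cl cl'
    by (simp add: hull_simps mult_closed K.l_distr smult_l_distr smult_r_distr mult_l_distr M.a_ac)
  show "r \<otimes>\<^bsub>Bu\<^esub> (p \<oplus>\<^bsub>Bu\<^esub> q) = r \<otimes>\<^bsub>Bu\<^esub> p \<oplus>\<^bsub>Bu\<^esub> r \<otimes>\<^bsub>Bu\<^esub> q"
    unfolding pq r using cl cl'
    by (simp add: hull_simps mult_closed K.r_distr smult_l_distr smult_r_distr mult_r_distr M.a_ac)
qed

lemma identity_unique: "\<lbrakk>is_identity B u; is_identity B v\<rbrakk> \<Longrightarrow> u = v"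
  unfolding is_identity_def by metis

lemma hull_identity: "is_identity Bu \<one>\<^bsub>Bu\<^esub>"
proof (cases "\<exists>u. is_identity B u")
  case True
  then obtain u where u: "is_identity B u" by blast
  then have "(THE u. is_identity B u) = u"
    using identity_unique by blast
  then have "\<one>\<^bsub>Bu\<^esub> = (\<zero>\<^bsub>F\<^esub>, u)"
    using True by (simp add: unital_hull_def)
  moreover have "hull_scalars = {\<zero>\<^bsub>F\<^esub>}"
    using True by (simp add: hull_scalars_def)
  ultimately show ?thesis
    using u by (auto simp: hull_simps is_identity_def)
next
  case False
  then have "\<one>\<^bsub>Bu\<^esub> = (\<one>\<^bsub>F\<^esub>, \<^bold>0)" "hull_scalars = carrier F"
    by (simp_all add: unital_hull_def hull_scalars_def)
  then show ?thesis
    by (auto simp: hull_simps is_identity_def)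
qed

lemma hull_center:
  assumes c: "c \<in> center B"
  shows "hull_emb F c \<in> center Bu"
proof -
  note cl [simp] = center_closed[OF c] and comm = center_commute[OF c]
    and assoc = center_assoc[OF c] and lcomm = center_lcomm[OF c]
  interpret H: na_algebra F Bu
    by (rule hull_na_algebra)
  show ?thesis
  proof (rule H.centerI)
    show "hull_emb F c \<in> carrier Bu"
      by (simp add: hull_simps hull_emb_def)
    fix p
    assume p: "p \<in> carrier Bu"
    then show "p \<otimes>\<^bsub>Bu\<^esub> hull_emb F c = hull_emb F c \<otimes>\<^bsub>Bu\<^esub> p"
      by (auto simp: hull_simps hull_emb_def comm mult_closed M.a_ac)
    fix q
    assume q: "q \<in> carrier Bu"
    from p q show "(hull_emb F c \<otimes>\<^bsub>Bu\<^esub> p) \<otimes>\<^bsub>Bu\<^esub> q = hull_emb F c \<otimes>\<^bsub>Bu\<^esub> (p \<otimes>\<^bsub>Bu\<^esub> q)"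
      by (auto simp: hull_simps hull_emb_def assoc mult_closed M.a_ac smult_r_distr mult_l_distr mult_r_distr mult_l_smult
        mult_r_smult smult_assoc1 smult_lcomm)
    from p q show "p \<otimes>\<^bsub>Bu\<^esub> (hull_emb F c \<otimes>\<^bsub>Bu\<^esub> q) = hull_emb F c \<otimes>\<^bsub>Bu\<^esub> (p \<otimes>\<^bsub>Bu\<^esub> q)"
      by (auto simp: hull_simps hull_emb_def comm lcomm mult_closed M.a_ac smult_r_distr mult_l_distr mult_r_distr mult_l_smult
        mult_r_smult smult_assoc1 smult_lcomm)
  qed
qed

lemma hull_action_simps:
  "carrier (hull_action_module F B) = hull_emb F ` carrier B"
  "ring.zero (hull_action_module F B) = ring.zero Bu"
  "ring.add (hull_action_module F B) = ring.add Bu"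
  "module.smult (hull_action_module F B) = monoid.mult Bu"
  by (simp_all add: hull_action_module_def)

lemma hull_emb_simps:
  "(\<alpha>, x) \<otimes>\<^bsub>Bu\<^esub> hull_emb F y = (\<alpha> \<otimes>\<^bsub>F\<^esub> \<zero>\<^bsub>F\<^esub>, (\<alpha> \<odot>\<^bsub>B\<^esub> y \<boxplus> \<zero>\<^bsub>F\<^esub> \<odot>\<^bsub>B\<^esub> x) \<boxplus> x \<bullet> y)"
  "hull_emb F x \<oplus>\<^bsub>Bu\<^esub> hull_emb F y = (\<zero>\<^bsub>F\<^esub> \<oplus>\<^bsub>F\<^esub> \<zero>\<^bsub>F\<^esub>, x \<boxplus> y)"
  by (simp_all add: hull_simps hull_emb_def)

lemma hull_mult_emb:
  assumes "p \<in> carrier Bu" "y \<in> carrier B"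
  shows "p \<otimes>\<^bsub>Bu\<^esub> hull_emb F y = hull_emb F (fst p \<odot>\<^bsub>B\<^esub> y \<boxplus> snd p \<bullet> y)"
  using assms by (auto simp: hull_simps mult_closed hull_emb_def)

text \<open>The law \<open>(p q) x = p (q x)\<close> is the one that a nonassociative hull does not
  supply; it holds because polynomials in a central element are central.\<close>

lemma hull_action_is_module:
  assumes c: "c \<in> center B"
  shows "module (polys F Bu (hull_emb F c)) (hull_action_module F B)"
proof -
  interpret H: na_algebra F Bu
    by (rule hull_na_algebra)
  note cc = hull_center[OF c]
  note H_id = hull_identity
  let ?c = "hull_emb F c"
  have c_closed: "?c \<in> carrier Bu"
    using H.center_closed[OF cc] .
  note P_closed = H.polys_closed[OF H_id c_closed]
  note P_simps = H.polys_simps[OF H_id c_closed]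
  have emb_closed: "hull_emb F x \<in> carrier Bu" if "x \<in> carrier B" for x
    using that by (simp add: hull_simps hull_emb_def)
  show ?thesis
  proof (rule moduleI)
    show "cring (polys F Bu ?c)"
      by (rule H.polys_cring[OF H_id c_closed cc])
    show "abelian_group (hull_action_module F B)"
    proof (rule abelian_groupI)
      fix x
      assume "x \<in> carrier (hull_action_module F B)"
      then obtain y where "y \<in> carrier B" "x = hull_emb F y"
        by (auto simp: hull_action_simps)
      then show "\<exists>z\<in>carrier (hull_action_module F B). z \<oplus>\<^bsub>hull_action_module F B\<^esub> x = \<zero>\<^bsub>hull_action_module F B\<^esub>"
        by (intro bexI[of _ "hull_emb F (\<boxminus> y)"]) (simp_all add: hull_action_simps hull_emb_simps hull_simps M.l_neg)
    qed (auto simp: hull_action_simps hull_simps hull_emb_def M.a_ac)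
  next
    fix p x
    assume "p \<in> carrier (polys F Bu ?c)" "x \<in> carrier (hull_action_module F B)"
    then show "p \<odot>\<^bsub>hull_action_module F B\<^esub> x \<in> carrier (hull_action_module F B)"
      using P_closed[of p]
      by (auto simp: hull_action_simps hull_mult_emb hull_simps mult_closed mem_Times_iff)
  next
    fix p q x
    assume p: "p \<in> carrier (polys F Bu ?c)" and q: "q \<in> carrier (polys F Bu ?c)"
      and x: "x \<in> carrier (hull_action_module F B)"
    have x': "x \<in> carrier Bu"
      using x emb_closed by (auto simp: hull_action_simps)
    show "(p \<oplus>\<^bsub>polys F Bu ?c\<^esub> q) \<odot>\<^bsub>hull_action_module F B\<^esub> x =
        p \<odot>\<^bsub>hull_action_module F B\<^esub> x \<oplus>\<^bsub>hull_action_module F B\<^esub> q \<odot>\<^bsub>hull_action_module F B\<^esub> x"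
      using H.mult_l_distr[OF P_closed[OF p] P_closed[OF q] x'] by (simp add: hull_action_simps P_simps)
    show "(p \<otimes>\<^bsub>polys F Bu ?c\<^esub> q) \<odot>\<^bsub>hull_action_module F B\<^esub> x =
        p \<odot>\<^bsub>hull_action_module F B\<^esub> (q \<odot>\<^bsub>hull_action_module F B\<^esub> x)"
      using H.center_assoc[OF subsetD[OF H.polys_center[OF H_id c_closed cc] p] P_closed[OF q] x']
      by (simp add: hull_action_simps P_simps)
  next
    fix p x y
    assume p: "p \<in> carrier (polys F Bu ?c)" and xy: "x \<in> carrier (hull_action_module F B)" "y \<in> carrier (hull_action_module F B)"
    have xy': "x \<in> carrier Bu" "y \<in> carrier Bu"
      using xy emb_closed by (auto simp: hull_action_simps)
    show "p \<odot>\<^bsub>hull_action_module F B\<^esub> (x \<oplus>\<^bsub>hull_action_module F B\<^esub> y) =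
        p \<odot>\<^bsub>hull_action_module F B\<^esub> x \<oplus>\<^bsub>hull_action_module F B\<^esub> p \<odot>\<^bsub>hull_action_module F B\<^esub> y"
      using H.mult_r_distr[OF xy' P_closed[OF p]] by (simp add: hull_action_simps)
  next
    fix x
    assume "x \<in> carrier (hull_action_module F B)"
    then have "x \<in> carrier Bu"
      using emb_closed by (auto simp: hull_action_simps)
    then show "\<one>\<^bsub>polys F Bu ?c\<^esub> \<odot>\<^bsub>hull_action_module F B\<^esub> x = x"
      using H_id by (simp add: is_identity_def hull_action_simps P_simps)
  qed
qed

text \<open>The premise \<open>span\<close> is an induction principle for \<open>B\<close>, applied
  to the set of elements whose copy in the hull is a combination with coefficients in F[c]. These
  coefficients include the identity of the hull, so the generators themselves are
  combinations.\<close>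

lemma hull_spanned_by3:
  assumes c: "c \<in> center B" and ab: "a \<in> carrier B" "b \<in> carrier B"
    and span: "\<And>Q. \<lbrakk>a \<in> Q; b \<in> Q; c \<in> Q; \<And>x y. \<lbrakk>x \<in> Q; y \<in> Q\<rbrakk> \<Longrightarrow> x \<boxplus> y \<in> Q;
      \<And>\<alpha> x. \<lbrakk>\<alpha> \<in> carrier F; x \<in> Q\<rbrakk> \<Longrightarrow> \<alpha> \<odot>\<^bsub>B\<^esub> x \<in> Q; \<And>x. x \<in> Q \<Longrightarrow> c \<bullet> x \<in> Q\<rbrakk> \<Longrightarrow> carrier B \<subseteq> Q"
  shows "spanned_by3 (polys F Bu (hull_emb F c)) (hull_action_module F B)
    (hull_emb F a) (hull_emb F b) (hull_emb F c)"
proof -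
  interpret H: na_algebra F Bu
    by (rule hull_na_algebra)
  let ?s = "hull_emb F c"
  define P where "P = carrier (polys F Bu ?s)"
  note cc = hull_center[OF c]
  note c_closed = H.center_closed[OF cc]
  note H_id = hull_identity
  have P_sub: "P \<subseteq> carrier Bu"
    unfolding P_def by (rule subsetI) (rule H.polys_closed[OF H_id c_closed])
  have emb_closed: "hull_emb F x \<in> carrier Bu" if "x \<in> carrier B" for x
    using that by (simp add: hull_simps hull_emb_def)
  have P_zero: "\<zero>\<^bsub>Bu\<^esub> \<in> P" and P_one: "\<one>\<^bsub>Bu\<^esub> \<in> P"
    and P_add: "\<And>p q. \<lbrakk>p \<in> P; q \<in> P\<rbrakk> \<Longrightarrow> p \<oplus>\<^bsub>Bu\<^esub> q \<in> P"
    and P_smult: "\<And>\<alpha> p. \<lbrakk>\<alpha> \<in> carrier F; p \<in> P\<rbrakk> \<Longrightarrow> \<alpha> \<odot>\<^bsub>Bu\<^esub> p \<in> P"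
    and P_mult: "\<And>p. p \<in> P \<Longrightarrow> p \<otimes>\<^bsub>Bu\<^esub> ?s \<in> P"
    unfolding P_def
        apply (rule H.polys_zero[OF H_id c_closed])
       apply (rule H.polys_one[OF H_id c_closed])
      apply (erule (1) H.polys_add[OF H_id c_closed])
     apply (erule (1) H.polys_smult[OF H_id c_closed])
    apply (erule H.polys_mult_generator[OF H_id c_closed])
    done
  define comb where "comb p q r = p \<otimes>\<^bsub>Bu\<^esub> hull_emb F a \<oplus>\<^bsub>Bu\<^esub> q \<otimes>\<^bsub>Bu\<^esub> hull_emb F b \<oplus>\<^bsub>Bu\<^esub> r \<otimes>\<^bsub>Bu\<^esub> ?s"
    for p q r
  let ?C = "{comb p q r | p q r. p \<in> P \<and> q \<in> P \<and> r \<in> P}"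
  have emb_ops: "hull_emb F (x \<boxplus> y) = hull_emb F x \<oplus>\<^bsub>Bu\<^esub> hull_emb F y"
    "hull_emb F (\<alpha> \<odot>\<^bsub>B\<^esub> x) = \<alpha> \<odot>\<^bsub>Bu\<^esub> hull_emb F x"
    "hull_emb F (x \<bullet> y) = hull_emb F x \<otimes>\<^bsub>Bu\<^esub> hull_emb F y"
    if "\<alpha> \<in> carrier F" "x \<in> carrier B" "y \<in> carrier B" for \<alpha> x y
    using that by (simp_all add: hull_simps hull_emb_def mult_closed)
  note cl = emb_closed[OF ab(1)] emb_closed[OF ab(2)] c_closed
  have comb_add: "comb p q r \<oplus>\<^bsub>Bu\<^esub> comb p' q' r' = comb (p \<oplus>\<^bsub>Bu\<^esub> p') (q \<oplus>\<^bsub>Bu\<^esub> q') (r \<oplus>\<^bsub>Bu\<^esub> r')"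
    if "p \<in> P" "q \<in> P" "r \<in> P" "p' \<in> P" "q' \<in> P" "r' \<in> P" for p q r p' q' r'
    using that P_sub cl unfolding comb_def
    by (simp add: subsetD H.mult_l_distr H.mult_closed H.M.a_ac)
  have comb_smult: "\<alpha> \<odot>\<^bsub>Bu\<^esub> comb p q r = comb (\<alpha> \<odot>\<^bsub>Bu\<^esub> p) (\<alpha> \<odot>\<^bsub>Bu\<^esub> q) (\<alpha> \<odot>\<^bsub>Bu\<^esub> r)"
    if "\<alpha> \<in> carrier F" "p \<in> P" "q \<in> P" "r \<in> P" for \<alpha> p q r
    using that P_sub cl unfolding comb_def
    by (simp add: subsetD H.mult_l_smult H.smult_r_distr H.mult_closed)
  have comb_mult: "?s \<otimes>\<^bsub>Bu\<^esub> comb p q r = comb (p \<otimes>\<^bsub>Bu\<^esub> ?s) (q \<otimes>\<^bsub>Bu\<^esub> ?s) (r \<otimes>\<^bsub>Bu\<^esub> ?s)"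
    if "p \<in> P" "q \<in> P" "r \<in> P" for p q r
    using that P_sub cl unfolding comb_def
    by (simp add: subsetD H.center_commute[OF cc] H.center_assoc[OF cc] H.mult_r_distr H.mult_closed
     )
  define Q where "Q = {x \<in> carrier B. \<exists>p q r. hull_emb F x = comb p q r \<and> p \<in> P \<and> q \<in> P \<and> r \<in> P}"
  have QI: "x \<in> Q" if "x \<in> carrier B" "hull_emb F x = comb p q r" "p \<in> P" "q \<in> P" "r \<in> P" for x p q r
    using that unfolding Q_def by blast
  have QE: "\<exists>p q r. hull_emb F x = comb p q r \<and> p \<in> P \<and> q \<in> P \<and> r \<in> P" "x \<in> carrier B" if "x \<in> Q" for x
    using that unfolding Q_def by blast+
  have "carrier B \<subseteq> Q"
  proof (rule span)
    have "hull_emb F a = comb \<one>\<^bsub>Bu\<^esub> \<zero>\<^bsub>Bu\<^esub> \<zero>\<^bsub>Bu\<^esub>"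
      using H_id cl unfolding comb_def is_identity_def by simp
    then show "a \<in> Q"
      by (rule QI[OF ab(1)]) (rule P_one P_zero)+
    have "hull_emb F b = comb \<zero>\<^bsub>Bu\<^esub> \<one>\<^bsub>Bu\<^esub> \<zero>\<^bsub>Bu\<^esub>"
      using H_id cl unfolding comb_def is_identity_def by simp
    then show "b \<in> Q"
      by (rule QI[OF ab(2)]) (rule P_one P_zero)+
    have "?s = comb \<zero>\<^bsub>Bu\<^esub> \<zero>\<^bsub>Bu\<^esub> \<one>\<^bsub>Bu\<^esub>"
      using H_id cl unfolding comb_def is_identity_def by simp
    then show "c \<in> Q"
      by (rule QI[OF center_closed[OF c]]) (rule P_one P_zero)+
  next
    fix x y
    assume Q: "x \<in> Q" "y \<in> Q"
    obtain p q r where x: "hull_emb F x = comb p q r" and pqr: "p \<in> P" "q \<in> P" "r \<in> P"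
      using QE(1)[OF Q(1)] by blast
    obtain p' q' r' where y: "hull_emb F y = comb p' q' r'" and pqr': "p' \<in> P" "q' \<in> P" "r' \<in> P"
      using QE(1)[OF Q(2)] by blast
    have "hull_emb F (x \<boxplus> y) = comb (p \<oplus>\<^bsub>Bu\<^esub> p') (q \<oplus>\<^bsub>Bu\<^esub> q') (r \<oplus>\<^bsub>Bu\<^esub> r')"
      using QE(2)[OF Q(1)] QE(2)[OF Q(2)]
      by (simp only: emb_ops(1)[OF K.zero_closed] x y comb_add[OF pqr pqr'])
    then show "x \<boxplus> y \<in> Q"
      by (rule QI[rotated]) (use pqr pqr' Q in \<open>auto intro: P_add M.a_closed QE(2)\<close>)
  next
    fix \<alpha> x
    assume \<alpha>: "\<alpha> \<in> carrier F" and Q: "x \<in> Q"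
    obtain p q r where x: "hull_emb F x = comb p q r" and pqr: "p \<in> P" "q \<in> P" "r \<in> P"
      using QE(1)[OF Q] by blast
    have "hull_emb F (\<alpha> \<odot>\<^bsub>B\<^esub> x) = comb (\<alpha> \<odot>\<^bsub>Bu\<^esub> p) (\<alpha> \<odot>\<^bsub>Bu\<^esub> q) (\<alpha> \<odot>\<^bsub>Bu\<^esub> r)"
      using emb_ops(2)[OF \<alpha> QE(2)[OF Q] QE(2)[OF Q]] by (simp only: x comb_smult[OF \<alpha> pqr])
    then show "\<alpha> \<odot>\<^bsub>B\<^esub> x \<in> Q"
      by (rule QI[rotated]) (use \<alpha> pqr Q in \<open>auto intro: P_smult smult_closed QE(2)\<close>)
  next
    fix x
    assume Q: "x \<in> Q"
    obtain p q r where x: "hull_emb F x = comb p q r" and pqr: "p \<in> P" "q \<in> P" "r \<in> P"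
      using QE(1)[OF Q] by blast
    have "hull_emb F (c \<bullet> x) = comb (p \<otimes>\<^bsub>Bu\<^esub> ?s) (q \<otimes>\<^bsub>Bu\<^esub> ?s) (r \<otimes>\<^bsub>Bu\<^esub> ?s)"
      using emb_ops(3)[OF K.zero_closed center_closed[OF c] QE(2)[OF Q]] by (simp only: x comb_mult[OF pqr])
    then show "c \<bullet> x \<in> Q"
      by (rule QI[rotated]) (use pqr Q in \<open>auto intro: P_mult mult_closed center_closed[OF c] QE(2)\<close>)
  qed
  then have mem: "hull_emb F x \<in> ?C" if "x \<in> carrier B" for x
    using QE(1)[of x] that by blast
  interpret A: module "polys F Bu ?s" "hull_action_module F B"
    by (rule hull_action_is_module[OF c])
  have "comb p q r \<in> carrier (hull_action_module F B)" if "p \<in> P" "q \<in> P" "r \<in> P" for p q r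
  proof -
    have "hull_emb F a \<in> carrier (hull_action_module F B)" "hull_emb F b \<in> carrier (hull_action_module F B)"
      "?s \<in> carrier (hull_action_module F B)"
      using ab center_closed[OF c] by (simp_all add: hull_action_simps)
    from A.M.a_closed[OF A.M.a_closed[OF A.smult_closed[OF _ this(1)] A.smult_closed[OF _ this(2)]]
        A.smult_closed[OF _ this(3)], of p q r] that
    show ?thesis
      unfolding comb_def P_def by (simp only: hull_action_simps(3,4))
  qed
  then have "carrier (hull_action_module F B) = ?C"
    using mem by (auto simp: hull_action_simps)
  then show ?thesis
    unfolding spanned_by3_def hull_action_simps(3,4) comb_def P_def
    using A.module_axioms ab center_closed[OF c] by (auto simp: hull_action_simps(1))
qed

end

context jordan_two_idempotents
begin

lemma spanned_by_a_b_sigma: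
  "spanned_by3 (polys F Bu (hull_emb F \<sigma>)) (hull_action_module F B)
     (hull_emb F a) (hull_emb F b) (hull_emb F \<sigma>)"
proof (rule hull_spanned_by3[OF sigma_center ab(1,2)])
  show "carrier B \<subseteq> Q" if "a \<in> Q" "b \<in> Q" "\<sigma> \<in> Q" "\<And>x y. \<lbrakk>x \<in> Q; y \<in> Q\<rbrakk> \<Longrightarrow> x \<boxplus> y \<in> Q"
    "\<And>\<alpha> x. \<lbrakk>\<alpha> \<in> carrier F; x \<in> Q\<rbrakk> \<Longrightarrow> \<alpha> \<odot>\<^bsub>B\<^esub> x \<in> Q" "\<And>x. x \<in> Q \<Longrightarrow> \<sigma> \<bullet> x \<in> Q" for Q
  proof
    fix x
    assume "x \<in> carrier B"
    then show "x \<in> Q"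
    proof (induction rule: sigma_span_induct)
      case (add x y)
      from add.IH show ?case by (rule that(4))
    next
      case (smult \<alpha> x)
      with that(5) show ?case by blast
    next
      case (mult x)
      from mult.IH show ?case by (rule that(6))
    qed (rule that)+
  qed
qed

end

section \<open>Ideals of simple algebras\<close>

context na_algebra
begin

lemma minus_zero [simp]: "\<boxminus> \<^bold>0 = \<^bold>0"
  by (rule M.minus_equality) simp_all

lemma central_multiples_ideal:
  assumes c: "c \<in> center B"
  shows "algebra_ideal F B ((\<bullet>) c ` carrier B)"
  unfolding algebra_ideal_def
proof (intro conjI ballI)
  note cl = center_closed[OF c]
  show "submodule ((\<bullet>) c ` carrier B) F B"
  proof (rule submoduleI)
    show "\<^bold>0 \<in> (\<bullet>) c ` carrier B"
      by (rule image_eqI[of _ _ "\<^bold>0"]) (simp_all add: cl)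
    fix x
    assume "x \<in> (\<bullet>) c ` carrier B"
    then obtain x' where x: "x = c \<bullet> x'" "x' \<in> carrier B"
      by (rule imageE)
    show "\<boxminus> x \<in> (\<bullet>) c ` carrier B"
      by (rule image_eqI[of _ _ "\<boxminus> x'"]) (simp_all add: x cl mult_r_minus)
    show "\<alpha> \<odot>\<^bsub>B\<^esub> x \<in> (\<bullet>) c ` carrier B" if "\<alpha> \<in> carrier F" for \<alpha>
      by (rule image_eqI[of _ _ "\<alpha> \<odot>\<^bsub>B\<^esub> x'"]) (simp_all add: that x cl mult_r_smult)
    fix y
    assume "y \<in> (\<bullet>) c ` carrier B"
    then obtain y' where y: "y = c \<bullet> y'" "y' \<in> carrier B"
      by (rule imageE)
    show "x \<boxplus> y \<in> (\<bullet>) c ` carrier B"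
      by (rule image_eqI[of _ _ "x' \<boxplus> y'"]) (simp_all add: x y cl mult_r_distr)
  qed (use cl in \<open>auto simp: mult_closed\<close>)
  fix x y
  assume x: "x \<in> carrier B" and "y \<in> (\<bullet>) c ` carrier B"
  then obtain z where z: "z \<in> carrier B" "y = c \<bullet> z"
    by blast
  show "x \<bullet> y \<in> (\<bullet>) c ` carrier B"
    by (rule image_eqI[of _ _ "x \<bullet> z"]) (simp_all add: z x mult_closed center_lcomm[OF c])
  show "y \<bullet> x \<in> (\<bullet>) c ` carrier B"
    by (rule image_eqI[of _ _ "z \<bullet> x"]) (simp_all add: z x mult_closed center_assoc[OF c])
qed

lemma simple_idealD:
  assumes "simple_algebra F B" "algebra_ideal F B I" "x \<in> I" "x \<noteq> \<^bold>0"
  shows "I = carrier B"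
  using assms unfolding simple_algebra_def by blast

lemma simple_nonzero_product:
  assumes "simple_algebra F B"
  obtains x y where "x \<in> carrier B" "y \<in> carrier B" "x \<bullet> y \<noteq> \<^bold>0"
  using assms unfolding simple_algebra_def by blast

text \<open>The multiples of a central element form an ideal, which is everything as soon as one
  multiple is nonzero.\<close>

lemma simple_central_surj:
  assumes "simple_algebra F B" "c \<in> center B" "x \<in> carrier B" "c \<bullet> x \<noteq> \<^bold>0" "y \<in> carrier B"
  obtains z where "z \<in> carrier B" "y = c \<bullet> z"
proof -
  have "(\<bullet>) c ` carrier B = carrier B"
    by (rule simple_idealD[OF assms(1) central_multiples_ideal[OF assms(2)], of "c \<bullet> x"]) (use assms in blast)+
  with assms(5) that show ?thesis
    by blast
qed

text \<open>Serves to exclude one-dimensional ideals, with \<open>d\<close> equal to \<sigma> and to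
  \<open>a - b\<close> in \<open>sigma_not_annihilating\<close>.\<close>

lemma scalar_multiples_ideal:
  assumes d: "d \<in> carrier B"
    and l: "\<And>x. x \<in> carrier B \<Longrightarrow> \<exists>\<alpha>\<in>carrier F. x \<bullet> d = \<alpha> \<odot>\<^bsub>B\<^esub> d"
    and r: "\<And>x. x \<in> carrier B \<Longrightarrow> \<exists>\<alpha>\<in>carrier F. d \<bullet> x = \<alpha> \<odot>\<^bsub>B\<^esub> d"
  shows "algebra_ideal F B ((\<lambda>\<alpha>. \<alpha> \<odot>\<^bsub>B\<^esub> d) ` carrier F)"
  unfolding algebra_ideal_def
proof (intro conjI ballI)
  show "submodule ((\<lambda>\<alpha>. \<alpha> \<odot>\<^bsub>B\<^esub> d) ` carrier F) F B"
  proof (rule submoduleI)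
    show "\<^bold>0 \<in> (\<lambda>\<alpha>. \<alpha> \<odot>\<^bsub>B\<^esub> d) ` carrier F"
      by (rule image_eqI[of _ _ "\<zero>\<^bsub>F\<^esub>"]) (simp_all add: d)
    fix x
    assume "x \<in> (\<lambda>\<alpha>. \<alpha> \<odot>\<^bsub>B\<^esub> d) ` carrier F"
    then obtain \<alpha> where x: "x = \<alpha> \<odot>\<^bsub>B\<^esub> d" "\<alpha> \<in> carrier F"
      by (rule imageE)
    show "\<boxminus> x \<in> (\<lambda>\<alpha>. \<alpha> \<odot>\<^bsub>B\<^esub> d) ` carrier F"
      by (rule image_eqI[of _ _ "\<ominus>\<^bsub>F\<^esub> \<alpha>"]) (simp_all add: x d smult_l_minus)
    show "\<gamma> \<odot>\<^bsub>B\<^esub> x \<in> (\<lambda>\<alpha>. \<alpha> \<odot>\<^bsub>B\<^esub> d) ` carrier F" if "\<gamma> \<in> carrier F" for \<gamma>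
      by (rule image_eqI[of _ _ "\<gamma> \<otimes>\<^bsub>F\<^esub> \<alpha>"]) (simp_all add: that x d smult_assoc1)
    fix y
    assume "y \<in> (\<lambda>\<alpha>. \<alpha> \<odot>\<^bsub>B\<^esub> d) ` carrier F"
    then obtain \<beta> where y: "y = \<beta> \<odot>\<^bsub>B\<^esub> d" "\<beta> \<in> carrier F"
      by (rule imageE)
    show "x \<boxplus> y \<in> (\<lambda>\<alpha>. \<alpha> \<odot>\<^bsub>B\<^esub> d) ` carrier F"
      by (rule image_eqI[of _ _ "\<alpha> \<oplus>\<^bsub>F\<^esub> \<beta>"]) (simp_all add: x y d smult_l_distr)
  qed (use d in auto)
  fix x y
  assume x: "x \<in> carrier B" and "y \<in> (\<lambda>\<alpha>. \<alpha> \<odot>\<^bsub>B\<^esub> d) ` carrier F"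
  then obtain \<alpha> where y: "y = \<alpha> \<odot>\<^bsub>B\<^esub> d" "\<alpha> \<in> carrier F"
    by blast
  obtain \<beta> \<gamma> where \<beta>\<gamma>: "\<beta> \<in> carrier F" "x \<bullet> d = \<beta> \<odot>\<^bsub>B\<^esub> d" "\<gamma> \<in> carrier F" "d \<bullet> x = \<gamma> \<odot>\<^bsub>B\<^esub> d"
    using l[OF x] r[OF x] by blast
  show "x \<bullet> y \<in> (\<lambda>\<alpha>. \<alpha> \<odot>\<^bsub>B\<^esub> d) ` carrier F"
    by (rule image_eqI[of _ _ "\<alpha> \<otimes>\<^bsub>F\<^esub> \<beta>"]) (simp_all add: y x d \<beta>\<gamma> mult_r_smult smult_assoc1)
  show "y \<bullet> x \<in> (\<lambda>\<alpha>. \<alpha> \<odot>\<^bsub>B\<^esub> d) ` carrier F"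
    by (rule image_eqI[of _ _ "\<alpha> \<otimes>\<^bsub>F\<^esub> \<gamma>"]) (simp_all add: y x d \<beta>\<gamma> mult_l_smult smult_assoc1)
qed

lemma scalar_algebraI:
  assumes e: "e \<in> carrier B" "e \<bullet> e = e" "e \<noteq> \<^bold>0" and span: "carrier B \<subseteq> (\<lambda>\<alpha>. \<alpha> \<odot>\<^bsub>B\<^esub> e) ` carrier F"
  shows "is_scalar_algebra F B"
proof -
  have "e \<bullet> (\<alpha> \<odot>\<^bsub>B\<^esub> e) = \<alpha> \<odot>\<^bsub>B\<^esub> e" "(\<alpha> \<odot>\<^bsub>B\<^esub> e) \<bullet> e = \<alpha> \<odot>\<^bsub>B\<^esub> e" if "\<alpha> \<in> carrier F" for \<alpha>
    using that e by (simp_all add: mult_r_smult mult_l_smult)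
  with span e have "is_identity B e"
    unfolding is_identity_def by blast
  moreover have "carrier B = {\<alpha> \<odot>\<^bsub>B\<^esub> e | \<alpha>. \<alpha> \<in> carrier F}"
    using span e(1) by auto
  ultimately show ?thesis
    unfolding is_scalar_algebra_def using e(3) by blast
qed

end

section \<open>From simplicity to an identity element\<close>

context jordan_two_idempotents
begin

abbreviation half where "half \<equiv> inv\<^bsub>F\<^esub> (\<one>\<^bsub>F\<^esub> \<oplus>\<^bsub>F\<^esub> \<one>\<^bsub>F\<^esub>)"

lemma half_closed [simp]: "half \<in> carrier F"
  using two by (intro K.Units_inv_closed) (simp add: K.field_Units)

lemma half_double:
  assumes "x \<in> carrier B"
  shows "half \<odot>\<^bsub>B\<^esub> (x \<boxplus> x) = x"
proof -
  let ?t = "\<one>\<^bsub>F\<^esub> \<oplus>\<^bsub>F\<^esub> \<one>\<^bsub>F\<^esub>"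
  have t: "?t \<in> Units F"
    using two by (simp add: K.field_Units)
  have "half \<odot>\<^bsub>B\<^esub> (x \<boxplus> x) = half \<odot>\<^bsub>B\<^esub> (?t \<odot>\<^bsub>B\<^esub> x)"
    using assms by (simp add: smult_l_distr)
  also have "\<dots> = (half \<otimes>\<^bsub>F\<^esub> ?t) \<odot>\<^bsub>B\<^esub> x"
    using assms by (intro smult_assoc1[symmetric]) simp_all
  also have "\<dots> = x"
    using assms t by (simp add: K.Units_l_inv del: K.r_distr)
  finally show ?thesis .
qed

text \<open>With the other idempotent equal to 0, \<sigma> is \<open>e\<close> itself, so the
  closure rules of the span never leave the line through \<open>e\<close>. The set equation
  \<open>f\<close> covers both orders of the two idempotents.\<close>

lemma scalar_if_other_idempotent_zero:
  assumes e: "e \<in> {a, b}" "e \<noteq> \<^bold>0" and f: "{a, b} = {e, \<^bold>0}"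
  shows "is_scalar_algebra F B"
proof (rule scalar_algebraI)
  have ee: "e \<in> carrier B" "e \<bullet> e = e"
    using e(1) by auto
  then show "e \<in> carrier B" "e \<bullet> e = e" "e \<noteq> \<^bold>0"
    using e(2) by auto
  have "(e \<boxminus> \<^bold>0) \<bullet> (e \<boxminus> \<^bold>0) = e" "(\<^bold>0 \<boxminus> e) \<bullet> (\<^bold>0 \<boxminus> e) = e"
    using ee by (simp_all add: M.minus_eq mult_l_minus mult_r_minus)
  then have s: "\<sigma> = e"
    using f ab(5) sigma_def by (auto simp: doubleton_eq_iff)
  have e_mem: "e \<in> (\<lambda>\<alpha>. \<alpha> \<odot>\<^bsub>B\<^esub> e) ` carrier F"
    by (rule image_eqI[of _ _ "\<one>\<^bsub>F\<^esub>"]) (simp_all add: ee)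
  have z_mem: "\<^bold>0 \<in> (\<lambda>\<alpha>. \<alpha> \<odot>\<^bsub>B\<^esub> e) ` carrier F"
    by (rule image_eqI[of _ _ "\<zero>\<^bsub>F\<^esub>"]) (simp_all add: ee)
  show "carrier B \<subseteq> (\<lambda>\<alpha>. \<alpha> \<odot>\<^bsub>B\<^esub> e) ` carrier F"
  proof
    fix x
    assume "x \<in> carrier B"
    then show "x \<in> (\<lambda>\<alpha>. \<alpha> \<odot>\<^bsub>B\<^esub> e) ` carrier F"
    proof (induction rule: sigma_span_induct)
      case (add x y)
      then obtain \<alpha> \<beta> where "x = \<alpha> \<odot>\<^bsub>B\<^esub> e" "\<alpha> \<in> carrier F" "y = \<beta> \<odot>\<^bsub>B\<^esub> e" "\<beta> \<in> carrier F"
        by blast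
      then show ?case
        by (intro image_eqI[of _ _ "\<alpha> \<oplus>\<^bsub>F\<^esub> \<beta>"]) (simp_all add: ee smult_l_distr)
    next
      case (smult \<gamma> x)
      then obtain \<alpha> where "x = \<alpha> \<odot>\<^bsub>B\<^esub> e" "\<alpha> \<in> carrier F"
        by blast
      then show ?case
        using smult.hyps(1) by (intro image_eqI[of _ _ "\<gamma> \<otimes>\<^bsub>F\<^esub> \<alpha>"]) (simp_all add: ee smult_assoc1)
    next
      case (mult x)
      then show ?case
        using ee by (auto simp: s mult_r_smult)
    next
      case sigma
      show ?case
        unfolding s using e_mem .
    next
      case a
      have "a = e \<or> a = \<^bold>0" using f by auto
      then show ?case
        using e_mem z_mem by metis
    next
      case b
      have "b = e \<or> b = \<^bold>0" using f by auto
      then show ?case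
        using e_mem z_mem by metis
    qed
  qed
qed

lemma scalar_if_zero_idempotent:
  assumes "a = \<^bold>0 \<or> b = \<^bold>0"
  shows "is_scalar_algebra F B"
  using assms
proof
  assume "a = \<^bold>0"
  with ab(5) show ?thesis
    by (intro scalar_if_other_idempotent_zero[of b]) auto
next
  assume "b = \<^bold>0"
  with ab(5) show ?thesis
    by (intro scalar_if_other_idempotent_zero[of a]) auto
qed

lemma no_zero_product_span:
  assumes "simple_algebra F B" and d: "d \<in> carrier B" "d \<bullet> d = \<^bold>0"
  shows "carrier B \<noteq> (\<lambda>\<alpha>. \<alpha> \<odot>\<^bsub>B\<^esub> d) ` carrier F"
proof
  assume *: "carrier B = (\<lambda>\<alpha>. \<alpha> \<odot>\<^bsub>B\<^esub> d) ` carrier F"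
  obtain x y where xy: "x \<in> carrier B" "y \<in> carrier B" and "x \<bullet> y \<noteq> \<^bold>0"
    using simple_nonzero_product[OF assms(1)] .
  moreover obtain \<alpha> \<beta> where "x = \<alpha> \<odot>\<^bsub>B\<^esub> d" "\<alpha> \<in> carrier F" "y = \<beta> \<odot>\<^bsub>B\<^esub> d" "\<beta> \<in> carrier F"
    using xy * by blast
  then have "x \<bullet> y = \<^bold>0"
    using d by (simp add: mult_l_smult mult_r_smult)
  ultimately show False by blast
qed

text \<open>If \<sigma> annihilated everything, the line through \<sigma> would be an ideal with
  zero product, which forces \<sigma> = 0; then the same holds of the line through
  \<open>a - b\<close>, which is nonzero.\<close>

lemma sigma_not_annihilating:
  assumes simple: "simple_algebra F B"
  obtains x where "x \<in> carrier B" "\<sigma> \<bullet> x \<noteq> \<^bold>0"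
proof (rule ccontr)
  assume "\<not> thesis"
  with that have z: "\<sigma> \<bullet> x = \<^bold>0" if "x \<in> carrier B" for x
    using that by blast
  have "algebra_ideal F B ((\<lambda>\<alpha>. \<alpha> \<odot>\<^bsub>B\<^esub> \<sigma>) ` carrier F)"
  proof (rule scalar_multiples_ideal[OF sigma_closed])
    fix x
    assume "x \<in> carrier B"
    then show "\<exists>\<alpha>\<in>carrier F. x \<bullet> \<sigma> = \<alpha> \<odot>\<^bsub>B\<^esub> \<sigma>" "\<exists>\<alpha>\<in>carrier F. \<sigma> \<bullet> x = \<alpha> \<odot>\<^bsub>B\<^esub> \<sigma>"
      using z[of x] by (auto simp: mult_comm[of x \<sigma>] intro!: bexI[of _ "\<zero>\<^bsub>F\<^esub>"])
  qed
  moreover have "\<sigma> \<in> (\<lambda>\<alpha>. \<alpha> \<odot>\<^bsub>B\<^esub> \<sigma>) ` carrier F"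
    by (rule image_eqI[of _ _ "\<one>\<^bsub>F\<^esub>"]) simp_all
  ultimately have s0: "\<sigma> = \<^bold>0"
    using simple_idealD[OF simple] no_zero_product_span[OF simple sigma_closed z[OF sigma_closed]] by blast
  \<comment> \<open>From \<sigma> = 0 follow \<open>d d = 0\<close> and
    \<open>2 a b = a + b\<close>, hence \<open>a d = b d = d / 2\<close>, so the line through
    \<open>d\<close> absorbs products.\<close>
  let ?d = "a \<boxminus> b"
  have d: "?d \<in> carrier B" "?d \<bullet> ?d = \<^bold>0" "?d \<noteq> \<^bold>0"
    using s0 ab unfolding sigma_def[symmetric] by (simp_all add: minus_eq_zero_iff)
  have n: "a \<bullet> b \<boxplus> a \<bullet> b = a \<boxplus> b"
    using s0 unfolding sigma_eq by (simp add: minus_eq_zero_iff)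
  have "a \<bullet> ?d \<boxplus> a \<bullet> ?d = (a \<boxplus> a) \<boxminus> (a \<bullet> b \<boxplus> a \<bullet> b)" "b \<bullet> ?d \<boxplus> b \<bullet> ?d = (a \<bullet> b \<boxplus> a \<bullet> b) \<boxminus> (b \<boxplus> b)"
    using ab(1-4) by algebra+
  then have "a \<bullet> ?d \<boxplus> a \<bullet> ?d = ?d" "b \<bullet> ?d \<boxplus> b \<bullet> ?d = ?d"
    unfolding n using ab(1,2) by (algebra+)
  then have ad: "a \<bullet> ?d = half \<odot>\<^bsub>B\<^esub> ?d" "b \<bullet> ?d = half \<odot>\<^bsub>B\<^esub> ?d"
    using half_double[of "a \<bullet> ?d"] half_double[of "b \<bullet> ?d"] d(1) by (simp_all add: mult_closed)
  have z': "\<exists>\<alpha>\<in>carrier F. \<^bold>0 = \<alpha> \<odot>\<^bsub>B\<^esub> ?d"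
    by (rule bexI[of _ "\<zero>\<^bsub>F\<^esub>"]) (simp_all add: d)
  have l: "\<exists>\<alpha>\<in>carrier F. x \<bullet> ?d = \<alpha> \<odot>\<^bsub>B\<^esub> ?d" if "x \<in> carrier B" for x
    using that
  proof (induction rule: sigma_span_induct)
    case (add x y)
    then show ?case
      using mult_l_distr[OF add.hyps d(1)] smult_l_distr[OF _ _ d(1)] by (metis K.a_closed)
  next
    case (smult \<alpha> x)
    then show ?case
      using mult_l_smult[OF smult.hyps d(1)] smult_assoc1[OF smult.hyps(1) _ d(1)] by (metis K.m_closed)
  next
    case (mult x)
    then show ?case
      using z' d(1) by (simp add: s0)
  next
    case sigma
    then show ?case
      using z' d(1) by (simp add: s0)
  qed (use ad half_closed in blast)+
  moreover have "\<exists>\<alpha>\<in>carrier F. ?d \<bullet> x = \<alpha> \<odot>\<^bsub>B\<^esub> ?d" if "x \<in> carrier B" for x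
    using l[OF that] mult_comm[OF d(1) that] by simp
  ultimately have "algebra_ideal F B ((\<lambda>\<alpha>. \<alpha> \<odot>\<^bsub>B\<^esub> ?d) ` carrier F)"
    by (intro scalar_multiples_ideal[OF d(1)])
  moreover have "?d \<in> (\<lambda>\<alpha>. \<alpha> \<odot>\<^bsub>B\<^esub> ?d) ` carrier F"
    by (rule image_eqI[of _ _ "\<one>\<^bsub>F\<^esub>"]) (simp_all add: d)
  ultimately show False
    using simple_idealD[OF simple _ _ d(3)] no_zero_product_span[OF simple d(1,2)] by blast
qed

text \<open>Multiplication by \<sigma> is onto, so \<sigma> = \<open>\<sigma> u\<close> for some
  \<open>u\<close>. Any \<open>y\<close> is of the form \<open>\<sigma> z\<close>, and
  \<open>u (\<sigma> z) = (\<sigma> u) z = \<sigma> z\<close>.\<close>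

lemma simple_unital:
  assumes simple: "simple_algebra F B"
  obtains u where "is_identity B u"
proof -
  obtain x where x: "x \<in> carrier B" "\<sigma> \<bullet> x \<noteq> \<^bold>0"
    using sigma_not_annihilating[OF simple] .
  note surj = simple_central_surj[OF simple sigma_center x]
  obtain u where u: "u \<in> carrier B" "\<sigma> = \<sigma> \<bullet> u"
    using surj[OF sigma_closed] .
  have "u \<bullet> y = y" if y: "y \<in> carrier B" for y
  proof -
    obtain z where z: "z \<in> carrier B" "y = \<sigma> \<bullet> z"
      using surj[OF y] .
    have "u \<bullet> y = (\<sigma> \<bullet> u) \<bullet> z"
      using z u(1) by (simp add: center_lcomm[OF sigma_center] center_assoc[OF sigma_center])
    with u z show ?thesis by simp
  qed
  then have "is_identity B u"
    using u(1) mult_comm unfolding is_identity_def by metis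
  then show ?thesis ..
qed

end

section \<open>Coordinates of a simple Jordan algebra generated by two idempotents\<close>

text \<open>Here the record field \<open>one\<close> is the identity, so that F[\<sigma>] can be
  formed in the algebra itself instead of its hull.\<close>

locale jordan_simple_unital = jordan_two_idempotents F B a b \<sigma>
  for F (structure) and B (structure) and a b \<sigma> +
  assumes simple: "simple_algebra F B" and unit: "is_identity B \<one>\<^bsub>B\<^esub>"
    and a_nonzero: "a \<noteq> \<^bold>0" and b_nonzero: "b \<noteq> \<^bold>0"
begin

abbreviation one_B ("\<^bold>1") where "\<^bold>1 \<equiv> \<one>\<^bsub>B\<^esub>"

lemma one_simps [simp]:
  "\<^bold>1 \<in> carrier B" "x \<in> carrier B \<Longrightarrow> \<^bold>1 \<bullet> x = x" "x \<in> carrier B \<Longrightarrow> x \<bullet> \<^bold>1 = x"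
  using unit by (simp_all add: is_identity_def)

definition "C = carrier (polys F B \<sigma>)"

lemma C_center: "c \<in> C \<Longrightarrow> c \<in> center B"
  unfolding C_def using polys_center[OF unit sigma_closed sigma_center] by blast

lemma C_closed [simp]: "c \<in> C \<Longrightarrow> c \<in> carrier B"
  by (rule center_closed[OF C_center])

lemma C_ops [simp]:
  "\<^bold>1 \<in> C" "\<^bold>0 \<in> C" "\<sigma> \<in> C"
  "\<lbrakk>c \<in> C; d \<in> C\<rbrakk> \<Longrightarrow> c \<boxplus> d \<in> C" "\<lbrakk>c \<in> C; d \<in> C\<rbrakk> \<Longrightarrow> c \<bullet> d \<in> C"
  "\<lbrakk>\<alpha> \<in> carrier F; c \<in> C\<rbrakk> \<Longrightarrow> \<alpha> \<odot>\<^bsub>B\<^esub> c \<in> C" "c \<in> C \<Longrightarrow> \<boxminus> c \<in> C"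
  unfolding C_def
  by (rule polys_one polys_zero polys_generator polys_add polys_mult polys_smult polys_neg
    unit sigma_closed sigma_center | assumption)+

lemma C_minus [simp]: "\<lbrakk>c \<in> C; d \<in> C\<rbrakk> \<Longrightarrow> c \<boxminus> d \<in> C"
  by (simp add: M.minus_eq)

lemma C_assoc: "\<lbrakk>c \<in> C; x \<in> carrier B; y \<in> carrier B\<rbrakk> \<Longrightarrow> (c \<bullet> x) \<bullet> y = c \<bullet> (x \<bullet> y)"
  by (rule center_assoc[OF C_center])

lemma C_lcomm: "\<lbrakk>c \<in> C; x \<in> carrier B; y \<in> carrier B\<rbrakk> \<Longrightarrow> x \<bullet> (c \<bullet> y) = c \<bullet> (x \<bullet> y)"
  by (rule center_lcomm[OF C_center])

lemma C_mult_mult: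
  "\<lbrakk>c \<in> C; d \<in> C; x \<in> carrier B; y \<in> carrier B\<rbrakk> \<Longrightarrow> (c \<bullet> x) \<bullet> (d \<bullet> y) = c \<bullet> (d \<bullet> (x \<bullet> y))"
  by (simp add: C_assoc C_lcomm[of d x y] mult_closed)

lemma C_induct [consumes 1, case_names one add smult mult]:
  assumes "c \<in> C" "Q \<^bold>1" "\<And>p q. \<lbrakk>p \<in> carrier B; q \<in> carrier B; Q p; Q q\<rbrakk> \<Longrightarrow> Q (p \<boxplus> q)"
    "\<And>\<alpha> p. \<lbrakk>\<alpha> \<in> carrier F; p \<in> carrier B; Q p\<rbrakk> \<Longrightarrow> Q (\<alpha> \<odot>\<^bsub>B\<^esub> p)"
    "\<And>p. \<lbrakk>p \<in> carrier B; Q p\<rbrakk> \<Longrightarrow> Q (p \<bullet> \<sigma>)"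
  shows "Q c"
  using assms(1) unfolding C_def
  by (induction rule: polys_induct[OF unit sigma_closed, consumes 1]) (use assms(2-5) in blast)+

text \<open>Solves \<open>\<sigma> a = a (a + b - 2 a b)\<close> for
  \<open>2 a (a b)\<close>.\<close>

lemma a_a_b: "a \<bullet> (a \<bullet> b) \<boxplus> a \<bullet> (a \<bullet> b) = a \<bullet> b \<boxplus> a \<boxminus> \<sigma> \<bullet> a"
proof -
  have "\<sigma> \<bullet> a = a \<bullet> (a \<boxplus> b \<boxminus> (a \<bullet> b \<boxplus> a \<bullet> b))"
    by (simp add: mult_comm[of _ a] sigma_eq[symmetric])
  also have "\<dots> = (a \<boxplus> a \<bullet> b) \<boxminus> (a \<bullet> (a \<bullet> b) \<boxplus> a \<bullet> (a \<bullet> b))"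
    by (simp add: M.minus_eq mult_r_distr mult_r_minus mult_closed)
  finally have "a \<bullet> (a \<bullet> b) \<boxplus> a \<bullet> (a \<bullet> b) = (a \<boxplus> a \<bullet> b) \<boxminus> \<sigma> \<bullet> a"
    by (simp add: M.minus_eq M.minus_add mult_closed M.r_neg2 M.r_neg1 M.a_ac)
  then show ?thesis
    by (simp add: M.a_comm)
qed

text \<open>The projection onto the Peirce 1-space of \<open>a\<close>.\<close>

definition "peirce x = (a \<bullet> (a \<bullet> x) \<boxplus> a \<bullet> (a \<bullet> x)) \<boxminus> a \<bullet> x"

text \<open>The polynomial \<open>2 t^2 - t\<close> takes the values 0, 0, 1 at the Peirce
  eigenvalues 0, 1/2, 1. The generators \<open>a\<close>, \<open>b\<close>, \<sigma> are projected
  to \<open>a\<close>, \<open>(1 - \<sigma>) a\<close>, \<open>\<sigma> a\<close>, and the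
  projection commutes with multiplication by \<sigma>.\<close>

lemma peirce_multiple:
  assumes "x \<in> carrier B"
  shows "\<exists>d\<in>C. peirce x = d \<bullet> a"
  using assms
proof (induction rule: sigma_span_induct)
  case a
  show ?case
    by (rule bexI[of _ "\<^bold>1"]) (simp_all add: peirce_def M.minus_eq M.a_assoc M.r_neg)
next
  case b
  have *: "(x \<boxplus> y \<boxminus> z) \<boxminus> x = y \<boxminus> z" if "x \<in> carrier B" "y \<in> carrier B" "z \<in> carrier B" for x y z
    using that by algebra
  have "peirce b = a \<boxminus> \<sigma> \<bullet> a"
    unfolding peirce_def a_a_b by (rule *) (simp_all add: mult_closed)
  also have "\<dots> = (\<^bold>1 \<boxminus> \<sigma>) \<bullet> a"
    by (simp add: M.minus_eq mult_l_distr mult_l_minus)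
  finally have "peirce b = (\<^bold>1 \<boxminus> \<sigma>) \<bullet> a" .
  then show ?case
    by (intro bexI[of _ "\<^bold>1 \<boxminus> \<sigma>"]) simp_all
next
  case sigma
  have "a \<bullet> (a \<bullet> \<sigma>) = a \<bullet> \<sigma>"
    using idempotent_mult_difference_square[OF two ab(1,3,2,4)] by (simp add: sigma_def[symmetric])
  then have "peirce \<sigma> = \<sigma> \<bullet> a"
    by (simp add: peirce_def mult_comm[of a \<sigma>] mult_closed M.minus_eq M.a_assoc M.r_neg)
  then show ?case
    by (intro bexI[of _ \<sigma>]) simp_all
next
  case (add x y)
  then obtain c d where cd: "c \<in> C" "d \<in> C" "peirce x = c \<bullet> a" "peirce y = d \<bullet> a"
    by blast
  have "peirce (x \<boxplus> y) = peirce x \<boxplus> peirce y"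
    unfolding peirce_def using add.hyps
    by (simp add: mult_r_distr mult_closed M.minus_eq M.minus_add M.a_ac)
  then show ?case
    using cd by (intro bexI[of _ "c \<boxplus> d"]) (simp_all add: mult_l_distr)
next
  case (smult \<alpha> x)
  then obtain c where c: "c \<in> C" "peirce x = c \<bullet> a"
    by blast
  have "peirce (\<alpha> \<odot>\<^bsub>B\<^esub> x) = \<alpha> \<odot>\<^bsub>B\<^esub> peirce x"
    unfolding peirce_def using smult.hyps
    by (simp add: mult_r_smult mult_closed M.minus_eq smult_r_distr smult_r_minus)
  then show ?case
    using c smult.hyps by (intro bexI[of _ "\<alpha> \<odot>\<^bsub>B\<^esub> c"]) (simp_all add: mult_l_smult)
next
  case (mult x)
  then obtain c where c: "c \<in> C" "peirce x = c \<bullet> a"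
    by blast
  have "peirce (\<sigma> \<bullet> x) = \<sigma> \<bullet> peirce x"
    unfolding peirce_def using mult.hyps
    by (simp add: C_lcomm[OF C_ops(3)] mult_closed M.minus_eq mult_r_distr mult_r_minus)
  then show ?case
    using c by (intro bexI[of _ "\<sigma> \<bullet> c"]) (simp_all add: C_assoc)
qed

text \<open>Multiplication by \<open>c\<close> is onto, hence \<open>a = c y\<close>. Projecting to
  the Peirce 1-space turns this into \<open>a = c d a\<close> with \<open>d\<close> in
  \<open>C\<close>, and it remains to cancel \<open>a\<close>.\<close>

lemma C_inverse:
  assumes c: "c \<in> C" "c \<noteq> \<^bold>0"
  shows "\<exists>d\<in>C. d \<bullet> c = \<^bold>1"
proof -
  have "c \<bullet> \<^bold>1 \<noteq> \<^bold>0"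
    using c by simp
  from simple_central_surj[OF simple C_center[OF c(1)] one_simps(1) this]
  obtain y where y: "y \<in> carrier B" "a = c \<bullet> y"
    using ab(1) by metis
  obtain d where d: "d \<in> C" "peirce y = d \<bullet> a"
    using peirce_multiple[OF y(1)] by blast
  have "peirce a = a"
    by (simp add: peirce_def M.minus_eq M.a_assoc M.r_neg)
  moreover have "peirce (c \<bullet> y) = c \<bullet> peirce y"
    unfolding peirce_def using c y(1) by (simp add: C_lcomm[OF c(1)] mult_closed M.minus_eq mult_r_distr mult_r_minus)
  ultimately have "c \<bullet> peirce y = a"
    by (simp only: y(2)[symmetric])
  then have eq: "(c \<bullet> d) \<bullet> a = a"
    using d c by (simp add: C_assoc)
  let ?z = "c \<bullet> d \<boxminus> \<^bold>1"
  have z: "?z \<in> C"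
    using c d by simp
  have za: "?z \<bullet> a = \<^bold>0"
    using eq c d by (simp add: M.minus_eq mult_l_distr mult_l_minus M.r_neg mult_closed)
  \<comment> \<open>Cancelling \<open>a\<close>: if \<open>z = c d - 1\<close> were nonzero, then
    \<open>a = z w\<close> for some \<open>w\<close>, and
    \<open>a = a a = (z w) a = w (z a) = 0\<close>.\<close>
  have "?z = \<^bold>0"
  proof (rule ccontr)
    assume "?z \<noteq> \<^bold>0"
    then have "?z \<bullet> \<^bold>1 \<noteq> \<^bold>0"
      using z by simp
    from simple_central_surj[OF simple C_center[OF z] one_simps(1) this]
    obtain w where w: "w \<in> carrier B" "a = ?z \<bullet> w"
      using ab(1) by metis
    have "a = (?z \<bullet> w) \<bullet> a"
      unfolding w(2)[symmetric] by simp
    also have "\<dots> = w \<bullet> (?z \<bullet> a)"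
      by (simp only: C_assoc[OF z w(1) ab(1)] C_lcomm[OF z w(1) ab(1)])
    also have "\<dots> = \<^bold>0"
      using w za by simp
    finally show False
      using a_nonzero by simp
  qed
  then have "c \<bullet> d = \<^bold>1"
    using c d by (simp add: minus_eq_zero_iff mult_closed)
  then show ?thesis
    using c d mult_comm[of c d] by (intro bexI[of _ d]) simp_all
qed

text \<open>By \<open>C_inverse\<close> the whole algebra is a vector space over the field
  \<open>C\<close>.\<close>

lemma C_mult_eq_zero:
  assumes c: "c \<in> C" "c \<bullet> x = \<^bold>0" and x: "x \<in> carrier B"
  shows "c = \<^bold>0 \<or> x = \<^bold>0"
proof (rule disjCI)
  assume "x \<noteq> \<^bold>0"
  show "c = \<^bold>0"
  proof (rule ccontr)
    assume "c \<noteq> \<^bold>0"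
    then obtain d where d: "d \<in> C" "d \<bullet> c = \<^bold>1"
      using C_inverse[OF c(1)] by blast
    have "x = d \<bullet> (c \<bullet> x)"
      using d c(1) x by (simp add: C_assoc[symmetric])
    then show False
      using c(2) d(1) \<open>x \<noteq> \<^bold>0\<close> by simp
  qed
qed

text \<open>\<open>w\<close> is half of the Peirce 1/2-component \<open>h\<close> of \<open>b\<close> with respect to \<open>a\<close>.\<close>

definition "a' = \<^bold>1 \<boxminus> a"
definition "w = a \<bullet> b \<boxminus> (\<^bold>1 \<boxminus> \<sigma>) \<bullet> a"
definition "h = w \<boxplus> w"

lemma a'_closed [simp]: "a' \<in> carrier B" and w_closed [simp]: "w \<in> carrier B" and h_closed [simp]: "h \<in> carrier B"
  by (simp_all add: a'_def w_def h_def mult_closed)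

lemma w_eq: "w = half \<odot>\<^bsub>B\<^esub> h"
  unfolding h_def by (simp add: half_double)

lemma a_a' [simp]: "a \<bullet> a' = \<^bold>0" "a' \<bullet> a = \<^bold>0" "a' \<bullet> a' = a'" "a \<boxplus> a' = \<^bold>1"
proof -
  note cl = ab(1) one_simps(1)
  show "a \<bullet> a' = \<^bold>0" "a' \<bullet> a = \<^bold>0"
    by (simp_all add: a'_def M.minus_eq mult_l_distr mult_r_distr mult_l_minus mult_r_minus M.r_neg)
  then show "a' \<bullet> a' = a'"
    by (subst (2) a'_def) (simp add: M.minus_eq mult_r_distr mult_r_minus)
  show "a \<boxplus> a' = \<^bold>1"
    unfolding a'_def using cl by algebra
qed

text \<open>Multiplication by \<open>a\<close> fixes the Peirce 1-component
  \<open>(1 - \<sigma>) a\<close> of \<open>b\<close>, halves the 1/2-component and kills the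
  0-component. So \<open>w\<close>, what remains of \<open>a b\<close> without the 1-component, is
  an eigenvector for 1/2.\<close>

lemma a_w: "a \<bullet> w \<boxplus> a \<bullet> w = w"
proof -
  have "a \<bullet> w = a \<bullet> (a \<bullet> b) \<boxminus> (\<^bold>1 \<boxminus> \<sigma>) \<bullet> a"
    by (simp add: w_def M.minus_eq[of _ "_ \<bullet> a"] mult_r_distr mult_r_minus mult_closed C_lcomm[of "\<^bold>1 \<boxminus> \<sigma>"])
  then have "a \<bullet> w \<boxplus> a \<bullet> w = (a \<bullet> (a \<bullet> b) \<boxplus> a \<bullet> (a \<bullet> b)) \<boxminus> ((\<^bold>1 \<boxminus> \<sigma>) \<bullet> a \<boxplus> (\<^bold>1 \<boxminus> \<sigma>) \<bullet> a)"
    by (simp add: M.minus_eq[of _ "_ \<bullet> _"] M.minus_eq[of _ "_ \<boxplus> _"] M.minus_add mult_closed M.a_ac)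
  also have "\<dots> = (a \<bullet> b \<boxplus> (\<^bold>1 \<boxminus> \<sigma>) \<bullet> a) \<boxminus> ((\<^bold>1 \<boxminus> \<sigma>) \<bullet> a \<boxplus> (\<^bold>1 \<boxminus> \<sigma>) \<bullet> a)"
    by (simp add: a_a_b M.minus_eq mult_l_distr mult_l_minus mult_closed M.a_ac)
  also have "\<dots> = w"
    by (simp add: w_def M.minus_eq[of _ "_ \<bullet> _"] M.minus_eq[of _ "_ \<boxplus> _"] M.minus_add mult_closed M.a_assoc M.r_neg1 M.r_neg2)
  finally show ?thesis .
qed

lemma a_h [simp]: "a \<bullet> h = w" "h \<bullet> a = w" "a' \<bullet> h = w" "h \<bullet> a' = w"
proof -
  show ah: "a \<bullet> h = w"
    by (simp add: h_def mult_r_distr a_w)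
  then show "h \<bullet> a = w"
    by (simp add: mult_comm)
  show "a' \<bullet> h = w"
    using ah by (simp add: a'_def M.minus_eq mult_l_distr mult_l_minus h_def[symmetric])
      (simp add: h_def M.a_assoc M.r_neg)
  then show "h \<bullet> a' = w"
    by (simp add: mult_comm)
qed

text \<open>The Peirce decomposition of \<open>b\<close>. By definition
  \<open>h = 2 a b - 2 (1 - \<sigma>) a\<close>, and replacing \<open>2 a b\<close> by
  \<open>a + b - \<sigma>\<close> gives an equation for \<open>b\<close>.\<close>

lemma b_eq: "b = ((\<^bold>1 \<boxminus> \<sigma>) \<bullet> a \<boxplus> \<sigma> \<bullet> a') \<boxplus> h"
proof -
  have "h = (a \<bullet> b \<boxplus> a \<bullet> b) \<boxminus> ((\<^bold>1 \<boxminus> \<sigma>) \<bullet> a \<boxplus> (\<^bold>1 \<boxminus> \<sigma>) \<bullet> a)"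
    by (simp add: h_def w_def M.minus_eq[of _ "_ \<bullet> _"] M.minus_eq[of _ "_ \<boxplus> _"] M.minus_add mult_closed M.a_ac)
  also have "a \<bullet> b \<boxplus> a \<bullet> b = (a \<boxplus> b) \<boxminus> \<sigma>"
  proof -
    have "\<sigma> \<boxplus> (a \<bullet> b \<boxplus> a \<bullet> b) = a \<boxplus> b"
      unfolding sigma_eq by (simp add: M.minus_eq M.a_assoc M.l_neg)
    then show ?thesis
      by (metis M.minus_eq M.a_comm M.r_neg1 M.a_closed M.a_inv_closed ab_closed sigma_closed)
  qed
  finally have "((\<^bold>1 \<boxminus> \<sigma>) \<bullet> a \<boxplus> \<sigma> \<bullet> a') \<boxplus> h =
      ((\<^bold>1 \<boxminus> \<sigma>) \<bullet> a \<boxplus> \<sigma> \<bullet> (\<^bold>1 \<boxminus> a)) \<boxplus> (((a \<boxplus> b) \<boxminus> \<sigma>) \<boxminus> ((\<^bold>1 \<boxminus> \<sigma>) \<bullet> a \<boxplus> (\<^bold>1 \<boxminus> \<sigma>) \<bullet> a))"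
    by (simp add: a'_def)
  also have "\<dots> = ((a \<boxminus> \<sigma> \<bullet> a) \<boxplus> (\<sigma> \<boxminus> \<sigma> \<bullet> a)) \<boxplus> (((a \<boxplus> b) \<boxminus> \<sigma>) \<boxminus> ((a \<boxminus> \<sigma> \<bullet> a) \<boxplus> (a \<boxminus> \<sigma> \<bullet> a)))"
    by (simp add: M.minus_eq mult_l_distr mult_r_distr mult_l_minus mult_r_minus mult_closed)
  also have "\<dots> = b"
  proof -
    have *: "((x \<boxminus> y) \<boxplus> (z \<boxminus> y)) \<boxplus> (((x \<boxplus> b) \<boxminus> z) \<boxminus> ((x \<boxminus> y) \<boxplus> (x \<boxminus> y))) = b"
      if "x \<in> carrier B" "y \<in> carrier B" "z \<in> carrier B" for x y z
      using that ab(2) by algebra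
    show ?thesis
      by (rule *) (simp_all add: mult_closed)
  qed
  finally show ?thesis ..
qed

definition "\<mu> = \<sigma> \<bullet> (\<^bold>1 \<boxminus> \<sigma>)"

lemma mu_C [simp]: "\<mu> \<in> C"
  by (simp add: \<mu>_def)

text \<open>Extracted from \<open>b b = b\<close> with \<open>b = u + h\<close> and
  \<open>u = (1 - \<sigma>) a + \<sigma> a'\<close>. As \<open>u h = w\<close> is half of
  \<open>h\<close>, the mixed terms add up to \<open>h\<close>, leaving
  \<open>h h = u - u u\<close>. Its coefficients at \<open>a\<close> and at \<open>a'\<close> both
  equal \<mu>, and \<open>a + a' = 1\<close>.\<close>

lemma h_h: "h \<bullet> h = \<mu>"
proof -
  let ?p = "\<^bold>1 \<boxminus> \<sigma>" and ?u = "(\<^bold>1 \<boxminus> \<sigma>) \<bullet> a \<boxplus> \<sigma> \<bullet> a'"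
  have u: "?u \<in> carrier B"
    by (simp add: mult_closed)
  have uu: "?u \<bullet> ?u = ?p \<bullet> (?p \<bullet> a) \<boxplus> \<sigma> \<bullet> (\<sigma> \<bullet> a')"
    by (simp add: mult_l_distr mult_r_distr mult_closed C_mult_mult)
  have ps: "?p \<bullet> w \<boxplus> \<sigma> \<bullet> w = w"
  proof -
    have "?p \<bullet> w \<boxplus> \<sigma> \<bullet> w = (?p \<boxplus> \<sigma>) \<bullet> w"
      by (simp add: mult_l_distr[of ?p])
    also have "?p \<boxplus> \<sigma> = \<^bold>1"
      by (simp add: M.minus_eq M.a_assoc M.l_neg)
    finally show ?thesis by simp
  qed
  have uh: "?u \<bullet> h = w"
    using ps by (simp add: mult_l_distr[of _ _ h] mult_closed C_assoc)
  have hu: "h \<bullet> ?u = w"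
    using uh u by (simp add: mult_comm)
  have "b \<bullet> b = (?u \<bullet> ?u \<boxplus> w) \<boxplus> (w \<boxplus> h \<bullet> h)"
    by (subst (1 2) b_eq) (simp only: mult_l_distr[of ?u h] mult_r_distr[of ?u h] u h_closed M.a_closed uh hu)
  also have "\<dots> = h \<bullet> h \<boxplus> (?u \<bullet> ?u \<boxplus> h)"
    unfolding h_def[symmetric] using u by (simp add: h_def mult_closed M.a_ac)
  finally have "h \<bullet> h \<boxplus> (?u \<bullet> ?u \<boxplus> h) = ?u \<boxplus> h"
    using b_eq by simp
  then have "h \<bullet> h \<boxplus> ?u \<bullet> ?u = ?u"
    using u by (simp add: mult_closed M.a_assoc[symmetric])
  moreover have "h \<bullet> h = (h \<bullet> h \<boxplus> ?u \<bullet> ?u) \<boxminus> ?u \<bullet> ?u"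
    using u mult_closed[OF u u] by (simp only: M.minus_eq M.a_assoc M.r_neg M.r_zero mult_closed h_closed M.a_inv_closed)
  ultimately have "h \<bullet> h = ?u \<boxminus> ?u \<bullet> ?u"
    by simp
  also have "\<dots> = (?p \<boxminus> ?p \<bullet> ?p) \<bullet> a \<boxplus> (\<sigma> \<boxminus> \<sigma> \<bullet> \<sigma>) \<bullet> a'"
  proof -
    have "?p \<in> carrier B" by simp
    then show ?thesis
      unfolding uu
      by (simp add: M.minus_eq[of "_ \<boxplus> _"] M.minus_eq[of \<sigma>] M.minus_eq[of ?p] mult_l_distr[of \<sigma>] mult_l_distr[of ?p]
        mult_l_minus mult_closed M.minus_add C_assoc M.a_ac)
  qed
  also have "\<sigma> \<boxminus> \<sigma> \<bullet> \<sigma> = \<mu>"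
    by (simp add: \<mu>_def M.minus_eq mult_r_distr mult_r_minus)
  also have "?p \<boxminus> ?p \<bullet> ?p = \<mu>"
  proof -
    have p: "?p \<in> carrier B" by simp
    have "?p \<bullet> (\<^bold>1 \<boxminus> ?p) = ?p \<boxminus> ?p \<bullet> ?p"
      using p by (simp only: M.minus_eq[of "\<^bold>1" ?p] M.minus_eq[of ?p "?p \<bullet> ?p"] mult_r_distr mult_r_minus one_simps M.a_inv_closed)
    moreover have "\<^bold>1 \<boxminus> (\<^bold>1 \<boxminus> \<sigma>) = \<sigma>"
      by (simp add: M.minus_eq M.minus_add M.r_neg2)
    ultimately show ?thesis
      by (simp add: \<mu>_def mult_comm)
  qed
  also have "\<mu> \<bullet> a \<boxplus> \<mu> \<bullet> a' = \<mu> \<bullet> (a \<boxplus> a')"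
    by (rule mult_r_distr[symmetric]) simp_all
  finally show ?thesis by simp
qed

section \<open>Coordinates over the field F[\<sigma>]\<close>

definition "comb p q r = p \<bullet> a \<boxplus> q \<bullet> h \<boxplus> r \<bullet> a'"

lemma comb_closed [simp]: "\<lbrakk>p \<in> C; q \<in> C; r \<in> C\<rbrakk> \<Longrightarrow> comb p q r \<in> carrier B"
  by (simp add: comb_def mult_closed)

lemma comb_add: "\<lbrakk>p \<in> C; q \<in> C; r \<in> C; p' \<in> C; q' \<in> C; r' \<in> C\<rbrakk> \<Longrightarrow>
  comb p q r \<boxplus> comb p' q' r' = comb (p \<boxplus> p') (q \<boxplus> q') (r \<boxplus> r')"
  by (simp add: comb_def mult_l_distr mult_closed M.a_ac)

lemma comb_smult: "\<lbrakk>\<alpha> \<in> carrier F; p \<in> C; q \<in> C; r \<in> C\<rbrakk> \<Longrightarrow>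
  \<alpha> \<odot>\<^bsub>B\<^esub> comb p q r = comb (\<alpha> \<odot>\<^bsub>B\<^esub> p) (\<alpha> \<odot>\<^bsub>B\<^esub> q) (\<alpha> \<odot>\<^bsub>B\<^esub> r)"
  by (simp add: comb_def smult_r_distr mult_l_smult mult_closed)

lemma comb_C_mult: "\<lbrakk>c \<in> C; p \<in> C; q \<in> C; r \<in> C\<rbrakk> \<Longrightarrow> c \<bullet> comb p q r = comb (c \<bullet> p) (c \<bullet> q) (c \<bullet> r)"
  by (simp add: comb_def mult_r_distr C_assoc mult_closed)

text \<open>The factor \<open>half\<close> appears because \<open>a\<close> and \<open>a'\<close>
  both act on \<open>h\<close> as 1/2; the products \<open>h h = \<mu>\<close> are distributed as
  \<open>\<mu> a + \<mu> a'\<close>.\<close>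

lemma comb_mult:
  assumes "p \<in> C" "q \<in> C" "r \<in> C" "p' \<in> C" "q' \<in> C" "r' \<in> C"
  shows "comb p q r \<bullet> comb p' q' r' =
    comb (p \<bullet> p' \<boxplus> (q \<bullet> q') \<bullet> \<mu>) (half \<odot>\<^bsub>B\<^esub> ((p \<bullet> q' \<boxplus> q \<bullet> p') \<boxplus> (q \<bullet> r' \<boxplus> r \<bullet> q'))) (r \<bullet> r' \<boxplus> (q \<bullet> q') \<bullet> \<mu>)"
proof -
  have mu: "(q \<bullet> q') \<bullet> \<mu> = ((q \<bullet> q') \<bullet> \<mu>) \<bullet> a \<boxplus> ((q \<bullet> q') \<bullet> \<mu>) \<bullet> a'"
    using assms by (simp add: mult_r_distr[symmetric])
  have w: "c \<bullet> w = (half \<odot>\<^bsub>B\<^esub> c) \<bullet> h" if "c \<in> C" for c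
    using that by (simp add: w_eq mult_l_smult mult_r_smult)
  have "comb p q r \<bullet> comb p' q' r' =
      (p \<bullet> (p' \<bullet> a) \<boxplus> q \<bullet> (p' \<bullet> w)) \<boxplus> ((p \<bullet> (q' \<bullet> w) \<boxplus> q \<bullet> (q' \<bullet> \<mu>)) \<boxplus> r \<bullet> (q' \<bullet> w)) \<boxplus> (q \<bullet> (r' \<bullet> w) \<boxplus> r \<bullet> (r' \<bullet> a'))"
    unfolding comb_def using assms
    by (simp add: mult_l_distr mult_r_distr mult_closed C_mult_mult h_h M.a_ac)
  also have "\<dots> = ((p \<bullet> p') \<bullet> a \<boxplus> (q \<bullet> p') \<bullet> w) \<boxplus> (((p \<bullet> q') \<bullet> w \<boxplus> (q \<bullet> q') \<bullet> \<mu>) \<boxplus> (r \<bullet> q') \<bullet> w) \<boxplus> ((q \<bullet> r') \<bullet> w \<boxplus> (r \<bullet> r') \<bullet> a')"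
    using assms by (simp add: C_assoc)
  also have "\<dots> = ((p \<bullet> p') \<bullet> a \<boxplus> ((q \<bullet> q') \<bullet> \<mu>) \<bullet> a) \<boxplus> (((p \<bullet> q') \<bullet> w \<boxplus> (q \<bullet> p') \<bullet> w) \<boxplus> ((q \<bullet> r') \<bullet> w \<boxplus> (r \<bullet> q') \<bullet> w))
      \<boxplus> ((r \<bullet> r') \<bullet> a' \<boxplus> ((q \<bullet> q') \<bullet> \<mu>) \<bullet> a')"
    by (subst mu) (use assms in \<open>simp add: mult_closed M.a_ac\<close>)
  also have "\<dots> = comb (p \<bullet> p' \<boxplus> (q \<bullet> q') \<bullet> \<mu>) (half \<odot>\<^bsub>B\<^esub> ((p \<bullet> q' \<boxplus> q \<bullet> p') \<boxplus> (q \<bullet> r' \<boxplus> r \<bullet> q'))) (r \<bullet> r' \<boxplus> (q \<bullet> q') \<bullet> \<mu>)"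
    unfolding comb_def w[symmetric] using assms
    by (simp add: mult_l_distr[of _ _ a] mult_l_distr[of _ _ a'] mult_l_distr[of _ _ w] w[symmetric] mult_closed)
  finally show ?thesis .
qed

lemma comb_surj:
  assumes "x \<in> carrier B"
  shows "\<exists>p\<in>C. \<exists>q\<in>C. \<exists>r\<in>C. x = comb p q r"
  using assms
proof (induction rule: sigma_span_induct)
  case a
  have "a = comb \<^bold>1 \<^bold>0 \<^bold>0"
    by (simp add: comb_def)
  then show ?case
    using C_ops(1,2) by blast
next
  case b
  have "b = comb (\<^bold>1 \<boxminus> \<sigma>) \<^bold>1 \<sigma>"
    using b_eq by (simp add: comb_def mult_closed M.a_ac)
  then show ?case
    using C_ops(1,3) C_minus by blast
next
  case sigma
  have "\<sigma> = comb \<sigma> \<^bold>0 \<sigma>"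
    using mult_r_distr[OF ab(1) a'_closed sigma_closed] by (simp add: comb_def mult_closed)
  then show ?case
    using C_ops(2,3) by blast
next
  case (add x y)
  then show ?case
    using comb_add C_ops(4) by metis
next
  case (smult \<alpha> x)
  then show ?case
    using comb_smult C_ops(6) by metis
next
  case (mult x)
  then show ?case
    using comb_C_mult[OF C_ops(3)] C_ops(3,5) by metis
qed

text \<open>If \<open>h\<close> vanished, \<open>C a\<close> would be an ideal, hence everything.
  Then \<open>a'\<close>, a multiple of \<open>a\<close> and orthogonal to it, is 0, so
  \<open>a = 1\<close>, and \<open>b\<close> would be an idempotent of the field \<open>C\<close>
  other than 0 and 1. If \<open>a'\<close> vanished, so would \<open>w = a' h\<close> and thus
  \<open>h\<close>.\<close>

lemma a'_nonzero_h_nonzero: "a' \<noteq> \<^bold>0" "h \<noteq> \<^bold>0"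
proof -
  show h: "h \<noteq> \<^bold>0"
  proof
    assume h: "h = \<^bold>0"
    have "algebra_ideal F B ((\<lambda>c. c \<bullet> a) ` C)"
      unfolding algebra_ideal_def
    proof (intro conjI ballI)
      show "submodule ((\<lambda>c. c \<bullet> a) ` C) F B"
      proof (rule submoduleI)
        show "\<^bold>0 \<in> (\<lambda>c. c \<bullet> a) ` C"
          by (rule image_eqI[of _ _ "\<^bold>0"]) simp_all
        fix x
        assume "x \<in> (\<lambda>c. c \<bullet> a) ` C"
        then obtain c where x: "x = c \<bullet> a" "c \<in> C"
          by (rule imageE)
        show "\<boxminus> x \<in> (\<lambda>c. c \<bullet> a) ` C"
          by (rule image_eqI[of _ _ "\<boxminus> c"]) (simp_all add: x mult_l_minus)
        show "\<alpha> \<odot>\<^bsub>B\<^esub> x \<in> (\<lambda>c. c \<bullet> a) ` C" if "\<alpha> \<in> carrier F" for \<alpha>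
          by (rule image_eqI[of _ _ "\<alpha> \<odot>\<^bsub>B\<^esub> c"]) (simp_all add: that x mult_l_smult)
        fix y
        assume "y \<in> (\<lambda>c. c \<bullet> a) ` C"
        then obtain d where y: "y = d \<bullet> a" "d \<in> C"
          by (rule imageE)
        show "x \<boxplus> y \<in> (\<lambda>c. c \<bullet> a) ` C"
          by (rule image_eqI[of _ _ "c \<boxplus> d"]) (simp_all add: x y mult_l_distr)
      qed (auto simp: mult_closed)
      fix x y
      assume x: "x \<in> carrier B" and "y \<in> (\<lambda>c. c \<bullet> a) ` C"
      then obtain c where y: "y = c \<bullet> a" "c \<in> C"
        by blast
      obtain p q r where pqr: "p \<in> C" "q \<in> C" "r \<in> C" "x = comb p q r"
        using comb_surj[OF x] by blast
      have "x \<bullet> a = p \<bullet> a"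
        using pqr by (simp add: comb_def h mult_closed mult_l_distr C_assoc)
      then show xy: "x \<bullet> y \<in> (\<lambda>c. c \<bullet> a) ` C"
        using pqr(1) y x by (intro image_eqI[of _ _ "c \<bullet> p"]) (simp_all add: C_lcomm[of c] C_assoc)
      then show "y \<bullet> x \<in> (\<lambda>c. c \<bullet> a) ` C"
        using x y by (simp add: mult_comm[of x] mult_closed)
    qed
    from simple_idealD[OF simple this _ a_nonzero] have "carrier B = (\<lambda>c. c \<bullet> a) ` C"
      by (metis C_ops(1) ab(1) image_eqI one_simps(2))
    then obtain c where c: "c \<in> C" "a' = c \<bullet> a"
      using a'_closed by blast
    have "a' = (c \<bullet> a) \<bullet> a'"
      using c(2) a_a'(3) by simp
    also have "\<dots> = \<^bold>0"
      using c(1) by (simp add: C_assoc)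
    finally have a'0: "a' = \<^bold>0" .
    then have a1: "a = \<^bold>1"
      by (simp add: a'_def minus_eq_zero_iff)
    have "((\<^bold>1 \<boxminus> \<sigma>) \<bullet> a \<boxplus> \<sigma> \<bullet> a') \<boxplus> h = (\<^bold>1 \<boxminus> \<sigma>) \<bullet> a"
      by (simp add: h a'0 mult_closed)
    also have "\<dots> = \<^bold>1 \<boxminus> \<sigma>"
      by (subst a1) simp
    finally have b: "b \<in> C"
      by (subst b_eq) simp
    then have "b \<bullet> (b \<boxminus> \<^bold>1) = \<^bold>0"
      by (simp add: M.minus_eq mult_r_distr mult_r_minus M.r_neg)
    then show False
      using C_mult_eq_zero[OF b, of "b \<boxminus> \<^bold>1"] b b_nonzero ab(5) a1 by (simp add: minus_eq_zero_iff)
  qed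
  show "a' \<noteq> \<^bold>0"
  proof
    assume "a' = \<^bold>0"
    then have "w = \<^bold>0"
      using a_h(3) by simp
    with h show False
      by (simp add: h_def)
  qed
qed

text \<open>Multiplying by \<open>a\<close> removes the last term; multiplying once more fixes
  \<open>p a\<close> and halves the \<open>h\<close>-part again, which separates the two. The
  coefficients then vanish because \<open>a\<close>, \<open>h\<close>, \<open>a'\<close> are nonzero
  vectors over \<open>C\<close>.\<close>

lemma comb_eq_zero:
  assumes pqr: "p \<in> C" "q \<in> C" "r \<in> C" and eq: "comb p q r = \<^bold>0"
  shows "p = \<^bold>0 \<and> q = \<^bold>0 \<and> r = \<^bold>0"
proof -
  have 1: "a \<bullet> comb p q r = p \<bullet> a \<boxplus> q \<bullet> w"
    using pqr by (simp add: comb_def mult_r_distr mult_closed C_lcomm[of p] C_lcomm[of q] C_lcomm[of r])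
  have "q \<bullet> (a \<bullet> w) \<boxplus> q \<bullet> (a \<bullet> w) = q \<bullet> w"
    using pqr a_w mult_r_distr[of "a \<bullet> w" "a \<bullet> w" q] by (simp add: mult_closed)
  moreover have 2: "a \<bullet> (p \<bullet> a \<boxplus> q \<bullet> w) = p \<bullet> a \<boxplus> q \<bullet> (a \<bullet> w)"
    using pqr by (simp add: mult_r_distr mult_closed C_lcomm[of p] C_lcomm[of q])
  ultimately have "(p \<bullet> a \<boxplus> q \<bullet> (a \<bullet> w)) \<boxplus> (p \<bullet> a \<boxplus> q \<bullet> (a \<bullet> w)) = p \<bullet> a \<boxplus> (p \<bullet> a \<boxplus> q \<bullet> w)"
    using pqr by (simp add: mult_closed M.a_ac)
  moreover have 3: "p \<bullet> a \<boxplus> q \<bullet> w = \<^bold>0"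
    using 1 eq by simp
  moreover have "p \<bullet> a \<boxplus> q \<bullet> (a \<bullet> w) = \<^bold>0"
    using 2 3 by simp
  ultimately have "p \<bullet> a = \<^bold>0"
    using pqr by (simp add: mult_closed)
  then have p: "p = \<^bold>0"
    using C_mult_eq_zero[OF pqr(1) _ ab(1)] a_nonzero by blast
  with 3 have "q \<bullet> w = \<^bold>0"
    using pqr by (simp add: mult_closed)
  then have "q \<bullet> h = \<^bold>0"
    using pqr by (simp add: h_def mult_r_distr)
  then have q: "q = \<^bold>0"
    using C_mult_eq_zero[OF pqr(2) _ h_closed] a'_nonzero_h_nonzero by blast
  have "r \<bullet> a' = \<^bold>0"
    using eq p q pqr by (simp add: comb_def mult_closed)
  then have "r = \<^bold>0"
    using C_mult_eq_zero[OF pqr(3) _ a'_closed] a'_nonzero_h_nonzero by blast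
  with p q show ?thesis by blast
qed

lemma comb_inj:
  assumes "p \<in> C" "q \<in> C" "r \<in> C" "p' \<in> C" "q' \<in> C" "r' \<in> C" and eq: "comb p q r = comb p' q' r'"
  shows "p = p' \<and> q = q' \<and> r = r'"
proof -
  have "comb (p \<boxminus> p') (q \<boxminus> q') (r \<boxminus> r') \<boxplus> comb p' q' r' = comb p q r"
    using assms(1-6) by (subst comb_add) (simp_all add: M.minus_eq M.a_assoc M.l_neg)
  then have "comb (p \<boxminus> p') (q \<boxminus> q') (r \<boxminus> r') = \<^bold>0"
    using assms by simp
  then show ?thesis
    using comb_eq_zero[of "p \<boxminus> p'" "q \<boxminus> q'" "r \<boxminus> r'"] assms(1-6) by (simp add: minus_eq_zero_iff)
qed

lemma sigma_nonzero: "\<sigma> \<noteq> \<^bold>0"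
proof -
  obtain x where "x \<in> carrier B" "\<sigma> \<bullet> x \<noteq> \<^bold>0"
    using sigma_not_annihilating[OF simple] .
  then show ?thesis by auto
qed

text \<open>Otherwise \<mu> = 0 and \<open>h h = 0\<close>. As \<open>a\<close> and
  \<open>a'\<close> act on \<open>h\<close> as 1/2, the set \<open>C h\<close> would be an ideal,
  hence everything, and all products would vanish.\<close>

lemma sigma_not_one: "\<sigma> \<noteq> \<^bold>1"
proof
  assume "\<sigma> = \<^bold>1"
  then have "\<sigma> \<bullet> (\<^bold>1 \<boxminus> \<sigma>) = \<^bold>0"
    by (simp add: M.minus_eq M.r_neg)
  then have hh: "h \<bullet> h = \<^bold>0"
    by (simp add: h_h \<mu>_def)
  have xh: "\<exists>d\<in>C. x \<bullet> h = d \<bullet> h" if x: "x \<in> carrier B" for x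
  proof -
    obtain p q r where pqr: "p \<in> C" "q \<in> C" "r \<in> C" "x = comb p q r"
      using comb_surj[OF x] by blast
    have "x \<bullet> h = (p \<boxplus> r) \<bullet> w"
      using pqr by (simp add: comb_def hh mult_closed mult_l_distr C_assoc)
    also have "\<dots> = (half \<odot>\<^bsub>B\<^esub> (p \<boxplus> r)) \<bullet> h"
      using pqr by (simp add: w_eq mult_l_smult mult_r_smult)
    finally show ?thesis
      using pqr by (intro bexI[of _ "half \<odot>\<^bsub>B\<^esub> (p \<boxplus> r)"]) simp_all
  qed
  have "algebra_ideal F B ((\<lambda>c. c \<bullet> h) ` C)"
    unfolding algebra_ideal_def
  proof (intro conjI ballI)
    show "submodule ((\<lambda>c. c \<bullet> h) ` C) F B"
    proof (rule submoduleI)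
      show "\<^bold>0 \<in> (\<lambda>c. c \<bullet> h) ` C"
        by (rule image_eqI[of _ _ "\<^bold>0"]) simp_all
      fix x
      assume "x \<in> (\<lambda>c. c \<bullet> h) ` C"
      then obtain c where x: "x = c \<bullet> h" "c \<in> C"
        by (rule imageE)
      show "\<boxminus> x \<in> (\<lambda>c. c \<bullet> h) ` C"
        by (rule image_eqI[of _ _ "\<boxminus> c"]) (simp_all add: x mult_l_minus)
      show "\<alpha> \<odot>\<^bsub>B\<^esub> x \<in> (\<lambda>c. c \<bullet> h) ` C" if "\<alpha> \<in> carrier F" for \<alpha>
        by (rule image_eqI[of _ _ "\<alpha> \<odot>\<^bsub>B\<^esub> c"]) (simp_all add: that x mult_l_smult)
      fix y
      assume "y \<in> (\<lambda>c. c \<bullet> h) ` C"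
      then obtain d where y: "y = d \<bullet> h" "d \<in> C"
        by (rule imageE)
      show "x \<boxplus> y \<in> (\<lambda>c. c \<bullet> h) ` C"
        by (rule image_eqI[of _ _ "c \<boxplus> d"]) (simp_all add: x y mult_l_distr)
    qed (auto simp: mult_closed)
    fix x y
    assume x: "x \<in> carrier B" and "y \<in> (\<lambda>c. c \<bullet> h) ` C"
    then obtain c where y: "y = c \<bullet> h" "c \<in> C"
      by blast
    obtain d where d: "d \<in> C" "x \<bullet> h = d \<bullet> h"
      using xh[OF x] by blast
    then show xy: "x \<bullet> y \<in> (\<lambda>c. c \<bullet> h) ` C"
      using y x by (intro image_eqI[of _ _ "c \<bullet> d"]) (simp_all add: C_lcomm[of c] C_assoc)
    then show "y \<bullet> x \<in> (\<lambda>c. c \<bullet> h) ` C"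
      using x y by (simp add: mult_comm[of x] mult_closed)
  qed
  from simple_idealD[OF simple this _ a'_nonzero_h_nonzero(2)] have "carrier B = (\<lambda>c. c \<bullet> h) ` C"
    by (metis C_ops(1) h_closed image_eqI one_simps(2))
  moreover obtain x y where xy: "x \<in> carrier B" "y \<in> carrier B" "x \<bullet> y \<noteq> \<^bold>0"
    using simple_nonzero_product[OF simple] .
  ultimately have "x \<in> (\<lambda>c. c \<bullet> h) ` C" "y \<in> (\<lambda>c. c \<bullet> h) ` C"
    by simp_all
  then obtain c d where "c \<in> C" "d \<in> C" "x = c \<bullet> h" "y = d \<bullet> h"
    by (elim imageE)
  with xy(3) show False
    by (simp add: C_mult_mult hh)
qed

end

section \<open>Two by two matrices over a field\<close>

lemma mat2_simps:
  "carrier (mat2_algebra K) = (carrier K \<times> carrier K) \<times> (carrier K \<times> carrier K)"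
  "((p, q), (r, t)) \<otimes>\<^bsub>mat2_algebra K\<^esub> ((p', q'), (r', t')) =
    ((p \<otimes>\<^bsub>K\<^esub> p' \<oplus>\<^bsub>K\<^esub> q \<otimes>\<^bsub>K\<^esub> r', p \<otimes>\<^bsub>K\<^esub> q' \<oplus>\<^bsub>K\<^esub> q \<otimes>\<^bsub>K\<^esub> t'), (r \<otimes>\<^bsub>K\<^esub> p' \<oplus>\<^bsub>K\<^esub> t \<otimes>\<^bsub>K\<^esub> r', r \<otimes>\<^bsub>K\<^esub> q' \<oplus>\<^bsub>K\<^esub> t \<otimes>\<^bsub>K\<^esub> t'))"
  "\<one>\<^bsub>mat2_algebra K\<^esub> = ((\<one>\<^bsub>K\<^esub>, \<zero>\<^bsub>K\<^esub>), (\<zero>\<^bsub>K\<^esub>, \<one>\<^bsub>K\<^esub>))"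
  "\<zero>\<^bsub>mat2_algebra K\<^esub> = ((\<zero>\<^bsub>K\<^esub>, \<zero>\<^bsub>K\<^esub>), (\<zero>\<^bsub>K\<^esub>, \<zero>\<^bsub>K\<^esub>))"
  "((p, q), (r, t)) \<oplus>\<^bsub>mat2_algebra K\<^esub> ((p', q'), (r', t')) = ((p \<oplus>\<^bsub>K\<^esub> p', q \<oplus>\<^bsub>K\<^esub> q'), (r \<oplus>\<^bsub>K\<^esub> r', t \<oplus>\<^bsub>K\<^esub> t'))"
  "\<alpha> \<odot>\<^bsub>mat2_algebra K\<^esub> ((p, q), (r, t)) = ((\<alpha> \<odot>\<^bsub>K\<^esub> p, \<alpha> \<odot>\<^bsub>K\<^esub> q), (\<alpha> \<odot>\<^bsub>K\<^esub> r, \<alpha> \<odot>\<^bsub>K\<^esub> t))"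
  by (simp_all add: mat2_algebra_def)

text \<open>The field of matrix entries and the algebra over \<open>F\<close> are one record, so
  that linearity over \<open>F\<close> and the field laws are both available for entries. The later
  instance is F[\<sigma>].\<close>

locale field_algebra = assoc_algebra F B + L?: field B
  for F :: "('f, 'm) ring_scheme" (structure) and B :: "('f, 'b, 'n) module_scheme" (structure)
begin

abbreviation bone ("\<^bold>1") where "\<^bold>1 \<equiv> \<one>\<^bsub>B\<^esub>"
abbreviation "MM \<equiv> mat2_algebra B"

lemma mat2E:
  assumes "x \<in> carrier MM"
  obtains p q r t where "x = ((p, q), (r, t))" "p \<in> carrier B" "q \<in> carrier B" "r \<in> carrier B" "t \<in> carrier B"
  using assms by (auto simp: mat2_simps)

lemma mat2_abelian_group: "abelian_group MM"
proof (rule abelian_groupI)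
  fix x
  assume "x \<in> carrier MM"
  then obtain p q r t where x: "x = ((p, q), (r, t))"
    and cl: "p \<in> carrier B" "q \<in> carrier B" "r \<in> carrier B" "t \<in> carrier B"
    by (rule mat2E)
  have "((\<boxminus> p, \<boxminus> q), (\<boxminus> r, \<boxminus> t)) \<oplus>\<^bsub>MM\<^esub> x = \<zero>\<^bsub>MM\<^esub>"
    unfolding x using cl by (simp add: mat2_simps M.l_neg)
  moreover have "((\<boxminus> p, \<boxminus> q), (\<boxminus> r, \<boxminus> t)) \<in> carrier MM"
    using cl by (simp add: mat2_simps)
  ultimately show "\<exists>y\<in>carrier MM. y \<oplus>\<^bsub>MM\<^esub> x = \<zero>\<^bsub>MM\<^esub>"
    by blast
qed (auto elim!: mat2E simp: mat2_simps M.a_ac)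

lemma mat2_module: "module F MM"
proof (rule moduleI[OF K.is_cring mat2_abelian_group])
  fix x
  assume x: "x \<in> carrier MM"
  then show "\<one>\<^bsub>F\<^esub> \<odot>\<^bsub>MM\<^esub> x = x"
    by (elim mat2E) (simp add: mat2_simps)
  fix \<alpha>
  assume \<alpha>: "\<alpha> \<in> carrier F"
  from x \<alpha> show "\<alpha> \<odot>\<^bsub>MM\<^esub> x \<in> carrier MM"
    by (elim mat2E) (simp add: mat2_simps)
  from x \<alpha> show "(\<alpha> \<oplus>\<^bsub>F\<^esub> \<beta>) \<odot>\<^bsub>MM\<^esub> x = \<alpha> \<odot>\<^bsub>MM\<^esub> x \<oplus>\<^bsub>MM\<^esub> \<beta> \<odot>\<^bsub>MM\<^esub> x" if "\<beta> \<in> carrier F" for \<beta>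
    using that by (elim mat2E) (simp add: mat2_simps smult_l_distr)
  from x \<alpha> show "(\<alpha> \<otimes>\<^bsub>F\<^esub> \<beta>) \<odot>\<^bsub>MM\<^esub> x = \<alpha> \<odot>\<^bsub>MM\<^esub> (\<beta> \<odot>\<^bsub>MM\<^esub> x)" if "\<beta> \<in> carrier F" for \<beta>
    using that by (elim mat2E) (simp add: mat2_simps smult_assoc1)
  from x \<alpha> show "\<alpha> \<odot>\<^bsub>MM\<^esub> (x \<oplus>\<^bsub>MM\<^esub> y) = \<alpha> \<odot>\<^bsub>MM\<^esub> x \<oplus>\<^bsub>MM\<^esub> \<alpha> \<odot>\<^bsub>MM\<^esub> y" if "y \<in> carrier MM" for y
    using that by (elim mat2E) (simp add: mat2_simps smult_r_distr)
qed

lemma mat2_assoc_algebra: "assoc_algebra F MM"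
proof (intro assoc_algebra.intro assoc_algebra_axioms.intro na_algebra.intro na_algebra_axioms.intro
    K.field_axioms mat2_module)
  fix x y
  assume xy: "x \<in> carrier MM" "y \<in> carrier MM"
  then show "x \<otimes>\<^bsub>MM\<^esub> y \<in> carrier MM"
    by (elim mat2E) (simp add: mat2_simps)
  from xy show "(\<alpha> \<odot>\<^bsub>MM\<^esub> x) \<otimes>\<^bsub>MM\<^esub> y = \<alpha> \<odot>\<^bsub>MM\<^esub> (x \<otimes>\<^bsub>MM\<^esub> y)" if "\<alpha> \<in> carrier F" for \<alpha>
    using that by (elim mat2E) (simp add: mat2_simps mult_l_smult smult_r_distr)
  from xy show "x \<otimes>\<^bsub>MM\<^esub> (\<alpha> \<odot>\<^bsub>MM\<^esub> y) = \<alpha> \<odot>\<^bsub>MM\<^esub> (x \<otimes>\<^bsub>MM\<^esub> y)" if "\<alpha> \<in> carrier F" for \<alpha>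
    using that by (elim mat2E) (simp add: mat2_simps mult_r_smult smult_r_distr)
  fix z
  assume z: "z \<in> carrier MM"
  from xy z show "(x \<oplus>\<^bsub>MM\<^esub> y) \<otimes>\<^bsub>MM\<^esub> z = x \<otimes>\<^bsub>MM\<^esub> z \<oplus>\<^bsub>MM\<^esub> y \<otimes>\<^bsub>MM\<^esub> z"
    by (elim mat2E) (simp add: mat2_simps L.l_distr M.a_ac)
  from xy z show "z \<otimes>\<^bsub>MM\<^esub> (x \<oplus>\<^bsub>MM\<^esub> y) = z \<otimes>\<^bsub>MM\<^esub> x \<oplus>\<^bsub>MM\<^esub> z \<otimes>\<^bsub>MM\<^esub> y"
    by (elim mat2E) (simp add: mat2_simps L.r_distr M.a_ac)
  from xy z show "(x \<otimes>\<^bsub>MM\<^esub> y) \<otimes>\<^bsub>MM\<^esub> z = x \<otimes>\<^bsub>MM\<^esub> (y \<otimes>\<^bsub>MM\<^esub> z)"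
    by (elim mat2E) (simp add: mat2_simps L.l_distr L.r_distr L.m_assoc M.a_ac)
qed

sublocale MM: assoc_algebra F MM
  by (rule mat2_assoc_algebra)

lemma mat2_identity: "is_identity MM \<one>\<^bsub>MM\<^esub>"
  unfolding is_identity_def by (auto elim!: mat2E simp: mat2_simps)

text \<open>With \<open>Eij\<close> for the matrix units, \<open>E21 E11 E12 = E22\<close>, so the
  ideal contains the identity \<open>E11 + E22\<close>.\<close>

lemma mat2_unitI: "((\<^bold>1, \<^bold>0), (\<^bold>0, \<^bold>0)) \<in> I \<Longrightarrow> algebra_ideal F MM I \<Longrightarrow> I = carrier MM"
proof -
  assume E: "((\<^bold>1, \<^bold>0), (\<^bold>0, \<^bold>0)) \<in> I" and I: "algebra_ideal F MM I"
  have sub: "submodule I F MM"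
    and l: "\<And>x y. \<lbrakk>x \<in> carrier MM; y \<in> I\<rbrakk> \<Longrightarrow> x \<otimes>\<^bsub>MM\<^esub> y \<in> I"
    and r: "\<And>x y. \<lbrakk>x \<in> carrier MM; y \<in> I\<rbrakk> \<Longrightarrow> y \<otimes>\<^bsub>MM\<^esub> x \<in> I"
    using I by (auto simp: algebra_ideal_def)
  have "((\<^bold>0, \<^bold>0), (\<^bold>1, \<^bold>0)) \<otimes>\<^bsub>MM\<^esub> (((\<^bold>1, \<^bold>0), (\<^bold>0, \<^bold>0)) \<otimes>\<^bsub>MM\<^esub> ((\<^bold>0, \<^bold>1), (\<^bold>0, \<^bold>0))) \<in> I"
    by (intro l r E) (simp_all add: mat2_simps)
  then have "((\<^bold>1, \<^bold>0), (\<^bold>0, \<^bold>0)) \<oplus>\<^bsub>MM\<^esub> ((\<^bold>0, \<^bold>0), (\<^bold>0, \<^bold>1)) \<in> I"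
    by (intro MM.submoduleE(5)[OF sub] E) (simp add: mat2_simps)
  then have one: "\<one>\<^bsub>MM\<^esub> \<in> I"
    by (simp add: mat2_simps)
  have "x \<in> I" if "x \<in> carrier MM" for x
    using l[OF that one] mat2_identity that by (simp add: is_identity_def)
  then show "I = carrier MM"
    using MM.submoduleE(1)[OF sub] by blast
qed

lemma mat2_simple: "simple_algebra F MM"
  unfolding simple_algebra_def
proof (intro conjI allI impI)
  show "\<exists>x\<in>carrier MM. \<exists>y\<in>carrier MM. x \<otimes>\<^bsub>MM\<^esub> y \<noteq> \<zero>\<^bsub>MM\<^esub>"
    by (intro bexI[of _ "\<one>\<^bsub>MM\<^esub>"]) (simp_all add: mat2_simps)
  fix I
  assume I: "algebra_ideal F MM I \<and> I \<noteq> carrier MM"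
  have sub: "submodule I F MM"
    and l: "\<And>x y. \<lbrakk>x \<in> carrier MM; y \<in> I\<rbrakk> \<Longrightarrow> x \<otimes>\<^bsub>MM\<^esub> y \<in> I"
    and r: "\<And>x y. \<lbrakk>x \<in> carrier MM; y \<in> I\<rbrakk> \<Longrightarrow> y \<otimes>\<^bsub>MM\<^esub> x \<in> I"
    using I by (auto simp: algebra_ideal_def)
  have zero: "k = \<^bold>0" if k: "k \<in> carrier B" "((k, \<^bold>0), (\<^bold>0, \<^bold>0)) \<in> I" for k
  proof (rule ccontr)
    assume "k \<noteq> \<^bold>0"
    with k have u: "k \<in> Units B"
      by (simp add: L.field_Units)
    have "((inv\<^bsub>B\<^esub> k, \<^bold>0), (\<^bold>0, \<^bold>0)) \<otimes>\<^bsub>MM\<^esub> ((k, \<^bold>0), (\<^bold>0, \<^bold>0)) \<in> I"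
      using u by (intro l k) (simp add: mat2_simps)
    then have "((\<^bold>1, \<^bold>0), (\<^bold>0, \<^bold>0)) \<in> I"
      using u k by (simp add: mat2_simps)
    with mat2_unitI I show False by blast
  qed
  have "x = \<zero>\<^bsub>MM\<^esub>" if x: "x \<in> I" for x
  proof -
    have "x \<in> carrier MM"
      using MM.submoduleE(1)[OF sub] x by blast
    then obtain p q r' t where x': "x = ((p, q), (r', t))"
      and cl: "p \<in> carrier B" "q \<in> carrier B" "r' \<in> carrier B" "t \<in> carrier B"
      by (rule mat2E)
    \<comment> \<open>Sandwiching \<open>x\<close> between suitable matrix units moves each of its
      four entries to the upper left corner, where \<open>zero\<close> applies.\<close>
    have "u \<otimes>\<^bsub>MM\<^esub> (x \<otimes>\<^bsub>MM\<^esub> v) \<in> I" if "u \<in> carrier MM" "v \<in> carrier MM" for u v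
      using that by (intro l r x)
    from this[of "((\<^bold>1, \<^bold>0), (\<^bold>0, \<^bold>0))" "((\<^bold>1, \<^bold>0), (\<^bold>0, \<^bold>0))"] this[of "((\<^bold>1, \<^bold>0), (\<^bold>0, \<^bold>0))" "((\<^bold>0, \<^bold>0), (\<^bold>1, \<^bold>0))"]
      this[of "((\<^bold>0, \<^bold>1), (\<^bold>0, \<^bold>0))" "((\<^bold>1, \<^bold>0), (\<^bold>0, \<^bold>0))"] this[of "((\<^bold>0, \<^bold>1), (\<^bold>0, \<^bold>0))" "((\<^bold>0, \<^bold>0), (\<^bold>1, \<^bold>0))"]
    have "((p, \<^bold>0), (\<^bold>0, \<^bold>0)) \<in> I" "((q, \<^bold>0), (\<^bold>0, \<^bold>0)) \<in> I" "((r', \<^bold>0), (\<^bold>0, \<^bold>0)) \<in> I" "((t, \<^bold>0), (\<^bold>0, \<^bold>0)) \<in> I"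
      using cl by (simp_all add: x' mat2_simps)
    with cl show ?thesis
      by (simp add: x' mat2_simps zero)
  qed
  moreover have "\<zero>\<^bsub>MM\<^esub> \<in> I"
    using MM.submoduleE(2)[OF sub] calculation by blast
  ultimately show "I = {\<zero>\<^bsub>MM\<^esub>}"
    by blast
qed

section \<open>Scalar matrices as a copy of the field\<close>

definition scal :: "'b \<Rightarrow> ('b \<times> 'b) \<times> ('b \<times> 'b)" where
  "scal k = ((k, \<^bold>0), (\<^bold>0, k))"

lemma scal_closed: "k \<in> carrier B \<Longrightarrow> scal k \<in> carrier MM"
  by (simp add: scal_def mat2_simps)

lemma scal_mult:
  "\<lbrakk>k \<in> carrier B; p \<in> carrier B; q \<in> carrier B; r \<in> carrier B; t \<in> carrier B\<rbrakk> \<Longrightarrow>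
    scal k \<otimes>\<^bsub>MM\<^esub> ((p, q), (r, t)) = ((k \<bullet> p, k \<bullet> q), (k \<bullet> r, k \<bullet> t))"
  by (simp add: scal_def mat2_simps)

lemma scal_ops:
  "\<lbrakk>k \<in> carrier B; l \<in> carrier B\<rbrakk> \<Longrightarrow> scal (k \<boxplus> l) = scal k \<oplus>\<^bsub>MM\<^esub> scal l"
  "\<lbrakk>k \<in> carrier B; l \<in> carrier B\<rbrakk> \<Longrightarrow> scal (k \<bullet> l) = scal k \<otimes>\<^bsub>MM\<^esub> scal l"
  "\<alpha> \<in> carrier F \<Longrightarrow> scal (\<alpha> \<odot>\<^bsub>B\<^esub> k) = \<alpha> \<odot>\<^bsub>MM\<^esub> scal k"
  "scal \<^bold>1 = \<one>\<^bsub>MM\<^esub>" "scal \<^bold>0 = \<zero>\<^bsub>MM\<^esub>"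
  by (simp_all add: scal_def mat2_simps)

lemma scal_inj: "scal k = scal l \<longleftrightarrow> k = l"
  by (simp add: scal_def)

lemma scal_center:
  assumes k: "k \<in> carrier B"
  shows "scal k \<in> center MM"
proof (rule MM.centerI)
  show "scal k \<in> carrier MM"
    using k by (rule scal_closed)
  have comm: "x \<otimes>\<^bsub>MM\<^esub> scal k = scal k \<otimes>\<^bsub>MM\<^esub> x" if "x \<in> carrier MM" for x
    using that k by (elim mat2E) (simp add: scal_def mat2_simps L.m_comm)
  then show "x \<otimes>\<^bsub>MM\<^esub> scal k = scal k \<otimes>\<^bsub>MM\<^esub> x" if "x \<in> carrier MM" for x
    using that .
  fix x y
  assume xy: "x \<in> carrier MM" "y \<in> carrier MM"
  show "(scal k \<otimes>\<^bsub>MM\<^esub> x) \<otimes>\<^bsub>MM\<^esub> y = scal k \<otimes>\<^bsub>MM\<^esub> (x \<otimes>\<^bsub>MM\<^esub> y)"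
    by (rule MM.mult_assoc[OF scal_closed[OF k] xy])
  show "x \<otimes>\<^bsub>MM\<^esub> (scal k \<otimes>\<^bsub>MM\<^esub> y) = scal k \<otimes>\<^bsub>MM\<^esub> (x \<otimes>\<^bsub>MM\<^esub> y)"
    using MM.mult_assoc[OF xy(1) scal_closed[OF k] xy(2)] MM.mult_assoc[OF scal_closed[OF k] xy] comm[OF xy(1)]
    by simp
qed

end

text \<open>Abstract form of F[\<sigma>] for a simple algebra: \<open>gen\<close> says that the
  field is F[s], and \<open>s\<close> being different from 0 and 1 makes \<open>s (1 - s)\<close>
  invertible.\<close>

locale simple_field_algebra = field_algebra F B
  for F :: "('f, 'm) ring_scheme" (structure) and B :: "('f, 'b, 'n) module_scheme" (structure) +
  fixes s :: 'b
  assumes s_closed [simp]: "s \<in> carrier B" and s_nonzero: "s \<noteq> \<^bold>0" and s_not_one: "s \<noteq> \<^bold>1"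
    and gen: "\<And>Q. \<lbrakk>\<^bold>1 \<in> Q; \<And>x y. \<lbrakk>x \<in> Q; y \<in> Q; x \<in> carrier B; y \<in> carrier B\<rbrakk> \<Longrightarrow> x \<boxplus> y \<in> Q;
      \<And>\<alpha> x. \<lbrakk>\<alpha> \<in> carrier F; x \<in> Q; x \<in> carrier B\<rbrakk> \<Longrightarrow> \<alpha> \<odot>\<^bsub>B\<^esub> x \<in> Q;
      \<And>x. \<lbrakk>x \<in> Q; x \<in> carrier B\<rbrakk> \<Longrightarrow> x \<bullet> s \<in> Q\<rbrakk> \<Longrightarrow> carrier B \<subseteq> Q"
begin

definition "\<mu> = s \<bullet> (\<^bold>1 \<boxminus> s)"
text \<open>\<open>idem_f\<close> is the image of \<open>b = (1 - s) a + h + s (1 - a)\<close> if \<open>h\<close> is sent to the matrix with rows \<open>(0, 1), (\<mu>, 0)\<close>.\<close>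

definition "idem_e = ((\<^bold>1, \<^bold>0), (\<^bold>0, \<^bold>0))"
definition "idem_f = ((\<^bold>1 \<boxminus> s, \<^bold>1), (\<mu>, s))"

lemma mu_closed [simp]: "\<mu> \<in> carrier B"
  by (simp add: \<mu>_def)

lemma mu_nonzero: "\<mu> \<noteq> \<^bold>0"
proof
  assume "\<mu> = \<^bold>0"
  then have "\<^bold>1 \<boxminus> s = \<^bold>0"
    unfolding \<mu>_def using L.integral[of s "\<^bold>1 \<boxminus> s"] s_nonzero by simp
  then show False
    using minus_eq_zero_iff[of "\<^bold>1" s] s_not_one by simp
qed

lemma mu_Units: "\<mu> \<in> Units B" and s_Units: "s \<in> Units B"
  using mu_nonzero s_nonzero by (simp_all add: L.field_Units)

lemma inv_closed [simp]: "inv\<^bsub>B\<^esub> \<mu> \<in> carrier B" "inv\<^bsub>B\<^esub> s \<in> carrier B"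
  using mu_Units s_Units by simp_all

lemma inv_mu [simp]: "inv\<^bsub>B\<^esub> \<mu> \<bullet> \<mu> = \<^bold>1" "\<mu> \<bullet> inv\<^bsub>B\<^esub> \<mu> = \<^bold>1" "inv\<^bsub>B\<^esub> s \<bullet> s = \<^bold>1"
  using mu_Units s_Units by (simp_all add: L.Units_l_inv L.Units_r_inv)

lemma inv_mu_cancel [simp]: "x \<in> carrier B \<Longrightarrow> inv\<^bsub>B\<^esub> \<mu> \<bullet> (\<mu> \<bullet> x) = x" "x \<in> carrier B \<Longrightarrow> \<mu> \<bullet> (inv\<^bsub>B\<^esub> \<mu> \<bullet> x) = x"
  by (simp_all add: L.m_assoc[symmetric])

lemma idem_closed [simp]: "idem_e \<in> carrier MM" "idem_f \<in> carrier MM"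
  by (simp_all add: idem_e_def idem_f_def mat2_simps)

text \<open>These are the four entries of the equation
  \<open>idem_f idem_f = idem_f\<close>.\<close>

lemma one_minus_s: "(\<^bold>1 \<boxminus> s) \<bullet> (\<^bold>1 \<boxminus> s) \<boxplus> \<mu> = \<^bold>1 \<boxminus> s" "(\<^bold>1 \<boxminus> s) \<boxplus> s = \<^bold>1" "\<mu> \<bullet> (\<^bold>1 \<boxminus> s) \<boxplus> s \<bullet> \<mu> = \<mu>" "\<mu> \<boxplus> s \<bullet> s = s"
proof -
  have s: "s \<in> carrier B" by simp
  show "(\<^bold>1 \<boxminus> s) \<bullet> (\<^bold>1 \<boxminus> s) \<boxplus> \<mu> = \<^bold>1 \<boxminus> s" "(\<^bold>1 \<boxminus> s) \<boxplus> s = \<^bold>1" "\<mu> \<bullet> (\<^bold>1 \<boxminus> s) \<boxplus> s \<bullet> \<mu> = \<mu>" "\<mu> \<boxplus> s \<bullet> s = s"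
    unfolding \<mu>_def using s L.one_closed by algebra+
qed

lemma idem_idempotent: "idem_e \<otimes>\<^bsub>MM\<^esub> idem_e = idem_e" "idem_f \<otimes>\<^bsub>MM\<^esub> idem_f = idem_f"
  by (simp_all add: idem_e_def idem_f_def mat2_simps one_minus_s)

lemma mat2_minus:
  assumes "p \<in> carrier B" "q \<in> carrier B" "r \<in> carrier B" "t \<in> carrier B"
    "p' \<in> carrier B" "q' \<in> carrier B" "r' \<in> carrier B" "t' \<in> carrier B"
  shows "((p, q), (r, t)) \<ominus>\<^bsub>MM\<^esub> ((p', q'), (r', t')) = ((p \<boxminus> p', q \<boxminus> q'), (r \<boxminus> r', t \<boxminus> t'))"
proof -
  have "\<ominus>\<^bsub>MM\<^esub> ((p', q'), (r', t')) = ((\<boxminus> p', \<boxminus> q'), (\<boxminus> r', \<boxminus> t'))"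
    using assms by (intro MM.M.minus_equality) (simp_all add: mat2_simps M.l_neg)
  then show ?thesis
    by (simp add: MM.M.minus_eq M.minus_eq mat2_simps)
qed

text \<open>The difference has rows \<open>(s, -1)\<close> and \<open>(-\<mu>, -s)\<close>; its
  trace is zero, so it squares to a scalar matrix, with the scalar
  \<open>s s + \<mu> = s\<close>.\<close>

lemma idem_sigma: "(idem_e \<ominus>\<^bsub>MM\<^esub> idem_f) \<otimes>\<^bsub>MM\<^esub> (idem_e \<ominus>\<^bsub>MM\<^esub> idem_f) = scal s"
proof -
  have s: "s \<in> carrier B" by simp
  have "(\<^bold>1 \<boxminus> (\<^bold>1 \<boxminus> s)) \<bullet> (\<^bold>1 \<boxminus> (\<^bold>1 \<boxminus> s)) \<boxplus> (\<^bold>0 \<boxminus> \<^bold>1) \<bullet> (\<^bold>0 \<boxminus> \<mu>) = s"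
    "(\<^bold>1 \<boxminus> (\<^bold>1 \<boxminus> s)) \<bullet> (\<^bold>0 \<boxminus> \<^bold>1) \<boxplus> (\<^bold>0 \<boxminus> \<^bold>1) \<bullet> (\<^bold>0 \<boxminus> s) = \<^bold>0"
    "(\<^bold>0 \<boxminus> \<mu>) \<bullet> (\<^bold>1 \<boxminus> (\<^bold>1 \<boxminus> s)) \<boxplus> (\<^bold>0 \<boxminus> s) \<bullet> (\<^bold>0 \<boxminus> \<mu>) = \<^bold>0"
    "(\<^bold>0 \<boxminus> \<mu>) \<bullet> (\<^bold>0 \<boxminus> \<^bold>1) \<boxplus> (\<^bold>0 \<boxminus> s) \<bullet> (\<^bold>0 \<boxminus> s) = s"
    unfolding \<mu>_def using s L.one_closed by algebra+
  then show ?thesis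
    by (simp add: idem_e_def idem_f_def mat2_minus scal_def mat2_simps)
qed

text \<open>Induction on polynomials gives one inclusion and \<open>gen\<close> the other; this
  makes F[(e - f)^2] a copy of the field.\<close>

lemma polys_scal: "carrier (polys F MM (scal s)) = scal ` carrier B"
proof
  note sc = scal_closed[OF s_closed]
  show "carrier (polys F MM (scal s)) \<subseteq> scal ` carrier B"
  proof
    fix x
    assume "x \<in> carrier (polys F MM (scal s))"
    then show "x \<in> scal ` carrier B"
      by (induction rule: MM.polys_induct[OF mat2_identity sc, consumes 1])
        (auto simp: scal_ops[symmetric] intro!: imageI)
  qed
  define Q where "Q = {k \<in> carrier B. scal k \<in> carrier (polys F MM (scal s))}"
  have "carrier B \<subseteq> Q"
    by (rule gen)
      (auto simp: Q_def scal_ops MM.polys_one[OF mat2_identity sc] MM.polys_add[OF mat2_identity sc]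
        MM.polys_smult[OF mat2_identity sc] MM.polys_mult_generator[OF mat2_identity sc])
  then show "scal ` carrier B \<subseteq> carrier (polys F MM (scal s))"
    by (auto simp: Q_def)
qed

lemma polys_scal_field: "field (polys F MM (scal s))"
proof -
  note sc = scal_closed[OF s_closed]
  interpret P: cring "polys F MM (scal s)"
    by (rule MM.polys_cring[OF mat2_identity sc scal_center[OF s_closed]])
  note ps = MM.polys_simps[OF mat2_identity sc]
  show ?thesis
  proof (rule P.cring_fieldI, rule equalityI)
    show "Units (polys F MM (scal s)) \<subseteq> carrier (polys F MM (scal s)) - {\<zero>\<^bsub>polys F MM (scal s)\<^esub>}"
    proof
      fix x
      assume "x \<in> Units (polys F MM (scal s))"
      then obtain k l where "x = scal k" "k \<in> carrier B" "l \<in> carrier B" "scal l \<otimes>\<^bsub>MM\<^esub> scal k = \<one>\<^bsub>MM\<^esub>"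
        unfolding Units_def polys_scal ps by auto
      moreover from this have "l \<bullet> k = \<^bold>1"
        by (simp add: scal_ops[symmetric] scal_inj)
      ultimately show "x \<in> carrier (polys F MM (scal s)) - {\<zero>\<^bsub>polys F MM (scal s)\<^esub>}"
        using L.one_not_zero by (auto simp: polys_scal ps scal_ops(5)[symmetric] scal_inj)
    qed
    show "carrier (polys F MM (scal s)) - {\<zero>\<^bsub>polys F MM (scal s)\<^esub>} \<subseteq> Units (polys F MM (scal s))"
    proof
      fix x
      assume "x \<in> carrier (polys F MM (scal s)) - {\<zero>\<^bsub>polys F MM (scal s)\<^esub>}"
      then obtain k where k: "x = scal k" "k \<in> carrier B" "k \<noteq> \<^bold>0"
        by (auto simp: polys_scal ps scal_ops(5)[symmetric] scal_inj)
      then have u: "k \<in> Units B"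
        by (simp add: L.field_Units)
      then have "scal (inv\<^bsub>B\<^esub> k) \<otimes>\<^bsub>MM\<^esub> scal k = \<one>\<^bsub>MM\<^esub>" "scal k \<otimes>\<^bsub>MM\<^esub> scal (inv\<^bsub>B\<^esub> k) = \<one>\<^bsub>MM\<^esub>"
        using k(2) by (simp_all add: scal_ops(2,4)[symmetric])
      then show "x \<in> Units (polys F MM (scal s))"
        unfolding Units_def polys_scal ps using k u by auto
    qed
  qed
qed

text \<open>Entrywise \<open>scal\<close>: in the target the entries are themselves scalar matrices,
  as F[(e - f)^2] is a subset of the matrix algebra.\<close>

lemma mat2_iso_polys: "algebra_iso F MM (mat2_algebra (polys F MM (scal s)))"
proof -
  note sc = scal_closed[OF s_closed]
  note ps = MM.polys_simps[OF mat2_identity sc]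
  define h where "h = (\<lambda>((p, q), (r, t)). ((scal p, scal q), (scal r, scal t)))"
  have "bij_betw h (carrier MM) (carrier (mat2_algebra (polys F MM (scal s))))"
    unfolding bij_betw_def inj_on_def
    by (auto simp: h_def mat2_simps polys_scal scal_inj image_iff)
  moreover have "h (x \<oplus>\<^bsub>MM\<^esub> y) = h x \<oplus>\<^bsub>mat2_algebra (polys F MM (scal s))\<^esub> h y"
    "h (x \<otimes>\<^bsub>MM\<^esub> y) = h x \<otimes>\<^bsub>mat2_algebra (polys F MM (scal s))\<^esub> h y" if "x \<in> carrier MM" "y \<in> carrier MM" for x y
    using that by (auto elim!: mat2E simp: h_def mat2_simps ps scal_ops[symmetric])
  moreover have "h (\<alpha> \<odot>\<^bsub>MM\<^esub> x) = \<alpha> \<odot>\<^bsub>mat2_algebra (polys F MM (scal s))\<^esub> h x"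
    if "\<alpha> \<in> carrier F" "x \<in> carrier MM" for \<alpha> x
    using that by (auto elim!: mat2E simp: h_def mat2_simps ps scal_ops[symmetric])
  ultimately show ?thesis
    unfolding algebra_iso_def by blast
qed

lemma idem_generated: "generated_by_idempotents F MM idem_e idem_f"
proof -
  have "carrier MM \<subseteq> S" if S: "na_subalgebra F MM S" "idem_e \<in> S" "idem_f \<in> S" for S
  proof -
    have sub: "submodule S F MM" and mult: "\<And>x y. \<lbrakk>x \<in> S; y \<in> S\<rbrakk> \<Longrightarrow> x \<otimes>\<^bsub>MM\<^esub> y \<in> S"
      using S(1) by (auto simp: na_subalgebra_def)
    note add = MM.submoduleE(5)[OF sub]
    have minus: "x \<ominus>\<^bsub>MM\<^esub> y \<in> S" if "x \<in> S" "y \<in> S" for x y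
      unfolding MM.M.minus_eq using that MM.submoduleE(3,5)[OF sub] by blast
    have s: "scal s \<in> S"
      unfolding idem_sigma[symmetric] by (intro mult minus S)
    \<comment> \<open>Multiples of \<open>s\<close> are taken because a subalgebra need not contain
      the identity, and only \<open>scal s\<close> is at hand so far. Invertibility of
      \<open>s\<close> then gives all scalar matrices, the identity included.\<close>
    define Q where "Q = {k \<in> carrier B. scal (k \<bullet> s) \<in> S}"
    have "carrier B \<subseteq> Q"
    proof (rule gen)
      show "\<^bold>1 \<in> Q"
        using s by (simp add: Q_def)
      show "x \<boxplus> y \<in> Q" if "x \<in> Q" "y \<in> Q" for x y
        using that by (simp add: Q_def L.l_distr scal_ops(1) add)
      show "\<alpha> \<odot>\<^bsub>B\<^esub> x \<in> Q" if "\<alpha> \<in> carrier F" "x \<in> Q" for \<alpha> x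
        using that MM.submoduleE(4)[OF sub] by (simp add: Q_def mult_l_smult scal_ops(3))
      show "x \<bullet> s \<in> Q" if "x \<in> Q" for x
        using that mult[of "scal (x \<bullet> s)" "scal s"] s scal_ops(2)[of "x \<bullet> s" s] by (simp add: Q_def)
    qed
    then have scal: "scal k \<in> S" if "k \<in> carrier B" for k
    proof -
      have "k \<bullet> inv\<^bsub>B\<^esub> s \<in> Q"
        using \<open>carrier B \<subseteq> Q\<close> that by auto
      moreover have "(k \<bullet> inv\<^bsub>B\<^esub> s) \<bullet> s = k"
        using that by (simp add: L.m_assoc)
      ultimately show ?thesis
        by (simp add: Q_def)
    qed
    \<comment> \<open>With the identity available, the other matrix units are \<open>1 - e\<close>,
      \<open>e f (1 - e)\<close> and \<open>\<mu>^-1 (1 - e) f e\<close>, where \<open>e\<close> and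
      \<open>f\<close> stand for \<open>idem_e\<close> and \<open>idem_f\<close>.\<close>
    have E11: "((\<^bold>1, \<^bold>0), (\<^bold>0, \<^bold>0)) \<in> S"
      using S(2) by (simp add: idem_e_def)
    have "\<one>\<^bsub>MM\<^esub> \<ominus>\<^bsub>MM\<^esub> ((\<^bold>1, \<^bold>0), (\<^bold>0, \<^bold>0)) \<in> S"
      using scal[OF L.one_closed] by (intro minus E11) (simp add: scal_ops)
    then have E22: "((\<^bold>0, \<^bold>0), (\<^bold>0, \<^bold>1)) \<in> S"
      by (simp add: mat2_simps(3) mat2_minus M.minus_eq M.r_neg)
    have "((\<^bold>1, \<^bold>0), (\<^bold>0, \<^bold>0)) \<otimes>\<^bsub>MM\<^esub> (idem_f \<otimes>\<^bsub>MM\<^esub> ((\<^bold>0, \<^bold>0), (\<^bold>0, \<^bold>1))) \<in> S"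
      by (intro mult E11 E22 S)
    then have E12: "((\<^bold>0, \<^bold>1), (\<^bold>0, \<^bold>0)) \<in> S"
      by (simp add: idem_f_def mat2_simps)
    have "scal (inv\<^bsub>B\<^esub> \<mu>) \<otimes>\<^bsub>MM\<^esub> (((\<^bold>0, \<^bold>0), (\<^bold>0, \<^bold>1)) \<otimes>\<^bsub>MM\<^esub> (idem_f \<otimes>\<^bsub>MM\<^esub> ((\<^bold>1, \<^bold>0), (\<^bold>0, \<^bold>0)))) \<in> S"
      by (intro mult E11 E22 S scal) simp
    then have E21: "((\<^bold>0, \<^bold>0), (\<^bold>1, \<^bold>0)) \<in> S"
      by (simp add: idem_f_def mat2_simps scal_def)
    show ?thesis
    proof
      fix x
      assume "x \<in> carrier MM"
      then obtain p q r t where x: "x = ((p, q), (r, t))"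
        and cl: "p \<in> carrier B" "q \<in> carrier B" "r \<in> carrier B" "t \<in> carrier B"
        by (rule mat2E)
      have "x = scal p \<otimes>\<^bsub>MM\<^esub> ((\<^bold>1, \<^bold>0), (\<^bold>0, \<^bold>0)) \<oplus>\<^bsub>MM\<^esub> scal q \<otimes>\<^bsub>MM\<^esub> ((\<^bold>0, \<^bold>1), (\<^bold>0, \<^bold>0)) \<oplus>\<^bsub>MM\<^esub>
          scal r \<otimes>\<^bsub>MM\<^esub> ((\<^bold>0, \<^bold>0), (\<^bold>1, \<^bold>0)) \<oplus>\<^bsub>MM\<^esub> scal t \<otimes>\<^bsub>MM\<^esub> ((\<^bold>0, \<^bold>0), (\<^bold>0, \<^bold>1))"
        unfolding x using cl by (simp add: scal_mult mat2_simps)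
      also have "\<dots> \<in> S"
        using cl by (intro add mult scal E11 E12 E21 E22)
      finally show "x \<in> S" .
    qed
  qed
  moreover have "na_subalgebra F MM (carrier MM)"
    by (simp add: na_subalgebra_def MM.carrier_is_submodule MM.mult_closed)
  ultimately have "generated_subalgebra F MM {idem_e, idem_f} = carrier MM"
    unfolding generated_subalgebra_def by auto
  moreover have "idem_e \<noteq> idem_f"
    by (simp add: idem_e_def idem_f_def)
  ultimately show ?thesis
    unfolding generated_by_idempotents_def by (simp add: idem_idempotent)
qed

text \<open>The adjoint with respect to the symmetric bilinear form with diagonal matrix \<open>(\<mu>, 1)\<close>.\<close>

definition "star = (\<lambda>((p, q), (r, t)). ((p, inv\<^bsub>B\<^esub> \<mu> \<bullet> r), (\<mu> \<bullet> q, t)))"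

lemma star_simp: "star ((p, q), (r, t)) = ((p, inv\<^bsub>B\<^esub> \<mu> \<bullet> r), (\<mu> \<bullet> q, t))"
  by (simp add: star_def)

lemma star_closed: "x \<in> carrier MM \<Longrightarrow> star x \<in> carrier MM"
  by (elim mat2E) (simp add: star_simp mat2_simps)

lemma star_star: "x \<in> carrier MM \<Longrightarrow> star (star x) = x"
  by (elim mat2E) (simp add: star_simp)

lemma star_add: "\<lbrakk>x \<in> carrier MM; y \<in> carrier MM\<rbrakk> \<Longrightarrow> star (x \<oplus>\<^bsub>MM\<^esub> y) = star x \<oplus>\<^bsub>MM\<^esub> star y"
  by (elim mat2E) (simp add: star_simp mat2_simps L.r_distr)

lemma star_smult: "\<lbrakk>\<alpha> \<in> carrier F; x \<in> carrier MM\<rbrakk> \<Longrightarrow> star (\<alpha> \<odot>\<^bsub>MM\<^esub> x) = \<alpha> \<odot>\<^bsub>MM\<^esub> star x"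
  by (elim mat2E) (simp add: star_simp mat2_simps mult_r_smult)

text \<open>On the diagonal the two weights cancel in \<open>(\<mu>^-1 u) (\<mu> v) = v u\<close>;
  off the diagonal a single weight passes through by commutativity of the field.\<close>

lemma star_mult:
  assumes "x \<in> carrier MM" "y \<in> carrier MM"
  shows "star (x \<otimes>\<^bsub>MM\<^esub> y) = star y \<otimes>\<^bsub>MM\<^esub> star x"
proof -
  obtain p q r t where x: "x = ((p, q), (r, t))"
    and cl: "p \<in> carrier B" "q \<in> carrier B" "r \<in> carrier B" "t \<in> carrier B"
    using assms(1) by (rule mat2E)
  obtain p' q' r' t' where y: "y = ((p', q'), (r', t'))"
    and cl': "p' \<in> carrier B" "q' \<in> carrier B" "r' \<in> carrier B" "t' \<in> carrier B"
    using assms(2) by (rule mat2E)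
  have swap: "(inv\<^bsub>B\<^esub> \<mu> \<bullet> u) \<bullet> (\<mu> \<bullet> v) = v \<bullet> u" if "u \<in> carrier B" "v \<in> carrier B" for u v
  proof -
    have "(inv\<^bsub>B\<^esub> \<mu> \<bullet> u) \<bullet> (\<mu> \<bullet> v) = (inv\<^bsub>B\<^esub> \<mu> \<bullet> \<mu>) \<bullet> (u \<bullet> v)"
      using that by (simp add: L.m_ac del: inv_mu inv_mu_cancel)
    also have "\<dots> = v \<bullet> u"
      using that by (simp add: L.m_comm)
    finally show ?thesis .
  qed
  have swap': "(\<mu> \<bullet> v) \<bullet> (inv\<^bsub>B\<^esub> \<mu> \<bullet> u) = u \<bullet> v" if "u \<in> carrier B" "v \<in> carrier B" for u v
    using swap[OF that] that L.m_comm[of "\<mu> \<bullet> v" "inv\<^bsub>B\<^esub> \<mu> \<bullet> u"] L.m_comm[of v u] by simp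
  have "p \<bullet> p' \<boxplus> q \<bullet> r' = p' \<bullet> p \<boxplus> (inv\<^bsub>B\<^esub> \<mu> \<bullet> r') \<bullet> (\<mu> \<bullet> q)"
    "r \<bullet> q' \<boxplus> t \<bullet> t' = (\<mu> \<bullet> q') \<bullet> (inv\<^bsub>B\<^esub> \<mu> \<bullet> r) \<boxplus> t' \<bullet> t"
    using cl cl' by (simp_all add: swap swap' L.m_comm[of p p'] L.m_comm[of t t'] L.m_comm[of r q'])
  moreover have "inv\<^bsub>B\<^esub> \<mu> \<bullet> (r \<bullet> p' \<boxplus> t \<bullet> r') = p' \<bullet> (inv\<^bsub>B\<^esub> \<mu> \<bullet> r) \<boxplus> (inv\<^bsub>B\<^esub> \<mu> \<bullet> r') \<bullet> t"
    "\<mu> \<bullet> (p \<bullet> q' \<boxplus> q \<bullet> t') = (\<mu> \<bullet> q') \<bullet> p \<boxplus> t' \<bullet> (\<mu> \<bullet> q)"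
    using cl cl' by (simp_all add: L.r_distr L.m_ac M.a_comm)
  ultimately show ?thesis
    unfolding x y by (simp add: star_simp mat2_simps)
qed

lemma star_involution: "involution F MM star"
proof -
  have "bij_betw star (carrier MM) (carrier MM)"
    by (rule bij_betw_byWitness[where f' = star]) (auto simp: star_star star_closed)
  then show ?thesis
    unfolding involution_def by (simp add: star_add star_smult star_mult star_star)
qed

lemma star_scal: "k \<in> carrier B \<Longrightarrow> star (scal k) = scal k"
  by (simp add: star_simp scal_def)

lemma star_idem: "star idem_e = idem_e" "star idem_f = idem_f"
  by (simp_all add: star_simp idem_e_def idem_f_def)

lemma star_scal_mult:
  assumes "k \<in> carrier B" "x \<in> carrier MM"
  shows "star (scal k \<otimes>\<^bsub>MM\<^esub> x) = scal k \<otimes>\<^bsub>MM\<^esub> star x"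
  using assms MM.center_commute[OF scal_center[OF assms(1)] star_closed[OF assms(2)]]
  by (simp add: star_mult scal_closed star_scal)

text \<open>The map is given by entries and the formula is derived: an anti-automorphism that fixes
  the scalar matrices, \<open>idem_e\<close> and \<open>idem_f\<close> must reverse their product.
  This bypasses any question whether the coefficients are unique.\<close>

lemma star_formula:
  assumes "\<alpha>\<^sub>1 \<in> carrier (polys F MM (scal s))" "\<alpha>\<^sub>2 \<in> carrier (polys F MM (scal s))"
    "\<alpha>\<^sub>3 \<in> carrier (polys F MM (scal s))" "\<alpha>\<^sub>4 \<in> carrier (polys F MM (scal s))"
  shows "star (\<alpha>\<^sub>1 \<otimes>\<^bsub>MM\<^esub> scal s \<oplus>\<^bsub>MM\<^esub> \<alpha>\<^sub>2 \<otimes>\<^bsub>MM\<^esub> idem_e \<oplus>\<^bsub>MM\<^esub> \<alpha>\<^sub>3 \<otimes>\<^bsub>MM\<^esub> idem_f \<oplus>\<^bsub>MM\<^esub> \<alpha>\<^sub>4 \<otimes>\<^bsub>MM\<^esub> (idem_e \<otimes>\<^bsub>MM\<^esub> idem_f))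
    = \<alpha>\<^sub>1 \<otimes>\<^bsub>MM\<^esub> scal s \<oplus>\<^bsub>MM\<^esub> \<alpha>\<^sub>2 \<otimes>\<^bsub>MM\<^esub> idem_e \<oplus>\<^bsub>MM\<^esub> \<alpha>\<^sub>3 \<otimes>\<^bsub>MM\<^esub> idem_f \<oplus>\<^bsub>MM\<^esub> \<alpha>\<^sub>4 \<otimes>\<^bsub>MM\<^esub> (idem_f \<otimes>\<^bsub>MM\<^esub> idem_e)"
proof -
  obtain k\<^sub>1 k\<^sub>2 k\<^sub>3 k\<^sub>4 where "\<alpha>\<^sub>1 = scal k\<^sub>1" "\<alpha>\<^sub>2 = scal k\<^sub>2" "\<alpha>\<^sub>3 = scal k\<^sub>3" "\<alpha>\<^sub>4 = scal k\<^sub>4"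
    and "k\<^sub>1 \<in> carrier B" "k\<^sub>2 \<in> carrier B" "k\<^sub>3 \<in> carrier B" "k\<^sub>4 \<in> carrier B"
    using assms unfolding polys_scal by blast
  then show ?thesis
    by (simp add: star_add star_scal_mult star_scal star_idem star_mult[of idem_e idem_f]
      scal_closed MM.mult_closed MM.M.a_closed)
qed

end

section \<open>Coordinatization\<close>

text \<open>The natural map goes from symmetric matrices to the Jordan algebra, opposite to the
  direction asked for. Closure of \<open>C\<close> under its operations allows the homomorphism laws
  to pass to the inverse map.\<close>

lemma algebra_iso_sym:
  assumes iso: "algebra_iso F C B"
    and add: "\<And>x y. \<lbrakk>x \<in> carrier C; y \<in> carrier C\<rbrakk> \<Longrightarrow> x \<oplus>\<^bsub>C\<^esub> y \<in> carrier C"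
    and smult: "\<And>\<alpha> x. \<lbrakk>\<alpha> \<in> carrier F; x \<in> carrier C\<rbrakk> \<Longrightarrow> \<alpha> \<odot>\<^bsub>C\<^esub> x \<in> carrier C"
    and mult: "\<And>x y. \<lbrakk>x \<in> carrier C; y \<in> carrier C\<rbrakk> \<Longrightarrow> x \<otimes>\<^bsub>C\<^esub> y \<in> carrier C"
  shows "algebra_iso F B C"
proof -
  obtain g where g: "bij_betw g (carrier C) (carrier B)"
    and g_add: "\<And>x y. \<lbrakk>x \<in> carrier C; y \<in> carrier C\<rbrakk> \<Longrightarrow> g (x \<oplus>\<^bsub>C\<^esub> y) = g x \<oplus>\<^bsub>B\<^esub> g y"
    and g_smult: "\<And>\<alpha> x. \<lbrakk>\<alpha> \<in> carrier F; x \<in> carrier C\<rbrakk> \<Longrightarrow> g (\<alpha> \<odot>\<^bsub>C\<^esub> x) = \<alpha> \<odot>\<^bsub>B\<^esub> g x"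
    and g_mult: "\<And>x y. \<lbrakk>x \<in> carrier C; y \<in> carrier C\<rbrakk> \<Longrightarrow> g (x \<otimes>\<^bsub>C\<^esub> y) = g x \<otimes>\<^bsub>B\<^esub> g y"
    using iso unfolding algebra_iso_def by blast
  define k where "k = the_inv_into (carrier C) g"
  have inj: "inj_on g (carrier C)" and im: "g ` carrier C = carrier B"
    using g by (auto simp: bij_betw_def)
  have kg: "k (g x) = x" if "x \<in> carrier C" for x
    unfolding k_def by (rule the_inv_into_f_f[OF inj that])
  have gk: "\<exists>x'\<in>carrier C. x = g x'" if "x \<in> carrier B" for x
    using im that by blast
  show ?thesis
    unfolding algebra_iso_def
  proof (intro exI[of _ k] conjI ballI)
    show "bij_betw k (carrier B) (carrier C)"
      unfolding k_def by (rule bij_betw_the_inv_into[OF g])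
    fix x
    assume "x \<in> carrier B"
    then obtain x' where x: "x' \<in> carrier C" "x = g x'"
      using gk by blast
    show "k (\<alpha> \<odot>\<^bsub>B\<^esub> x) = \<alpha> \<odot>\<^bsub>C\<^esub> k x" if "\<alpha> \<in> carrier F" for \<alpha>
      using kg[OF smult[OF that x(1)]] g_smult[OF that x(1)] by (simp add: x kg)
    fix y
    assume "y \<in> carrier B"
    then obtain y' where y: "y' \<in> carrier C" "y = g y'"
      using gk by blast
    show "k (x \<oplus>\<^bsub>B\<^esub> y) = k x \<oplus>\<^bsub>C\<^esub> k y"
      using kg[OF add[OF x(1) y(1)]] g_add[OF x(1) y(1)] by (simp add: x y kg)
    show "k (x \<otimes>\<^bsub>B\<^esub> y) = k x \<otimes>\<^bsub>C\<^esub> k y"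
      using kg[OF mult[OF x(1) y(1)]] g_mult[OF x(1) y(1)] by (simp add: x y kg)
  qed
qed

lemma sym_algebra_simps:
  "carrier (sym_algebra F A star) = {x \<in> carrier A. star x = x}"
  "ring.add (sym_algebra F A star) = ring.add A"
  "module.smult (sym_algebra F A star) = module.smult A"
  "x \<otimes>\<^bsub>sym_algebra F A star\<^esub> y = inv\<^bsub>F\<^esub> (\<one>\<^bsub>F\<^esub> \<oplus>\<^bsub>F\<^esub> \<one>\<^bsub>F\<^esub>) \<odot>\<^bsub>A\<^esub> (x \<otimes>\<^bsub>A\<^esub> y \<oplus>\<^bsub>A\<^esub> y \<otimes>\<^bsub>A\<^esub> x)"
  by (simp_all add: sym_algebra_def plus_algebra_def)

section \<open>Changing the record field for the identity\<close>

lemma algebra_iso_one_update: "algebra_iso F (B\<lparr>monoid.one := u\<rparr>) A = algebra_iso F B A"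
  by (simp add: algebra_iso_def)

lemma submodule_one_update: "submodule S F (B\<lparr>monoid.one := u\<rparr>) = submodule S F B"
  unfolding submodule_def submodule_axioms_def by simp

lemma a_minus_one_update: "a_minus (B\<lparr>monoid.one := u\<rparr>) = a_minus B"
  unfolding a_minus_def a_inv_def by simp

lemma generated_by_idempotents_one_update:
  "generated_by_idempotents F (B\<lparr>monoid.one := u\<rparr>) a b = generated_by_idempotents F B a b"
  unfolding generated_by_idempotents_def generated_subalgebra_def na_subalgebra_def submodule_one_update by simp

lemma simple_algebra_one_update: "simple_algebra F (B\<lparr>monoid.one := u\<rparr>) = simple_algebra F B"
  unfolding simple_algebra_def algebra_ideal_def submodule_one_update by simp

lemma module_one_update:
  assumes "module F B"
  shows "module F (B\<lparr>monoid.one := u\<rparr>)"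
proof -
  interpret module F B by fact
  show ?thesis
  proof (rule moduleI[OF R.is_cring])
    show "abelian_group (B\<lparr>monoid.one := u\<rparr>)"
      by (rule comm_group_abelian_groupI) (simp add: M.a_comm_group)
  qed (simp_all add: smult_l_distr smult_r_distr smult_assoc1)
qed

lemma jordan_algebra_one_update:
  assumes "jordan_algebra F B"
  shows "jordan_algebra F (B\<lparr>monoid.one := u\<rparr>)"
proof -
  interpret jordan_algebra F B by fact
  show ?thesis
    by (intro jordan_algebra.intro jordan_algebra_axioms.intro na_algebra.intro na_algebra_axioms.intro
        K.field_axioms module_one_update module_axioms)
      (simp_all add: mult_closed mult_l_distr mult_r_distr mult_l_smult mult_r_smult jordan_identity,
        rule mult_comm)
qed

section \<open>The isomorphism with the symmetric matrices\<close>

context jordan_simple_unital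
begin

abbreviation "CC \<equiv> polys F B \<sigma>"

lemmas CC_simps = polys_simps[OF unit sigma_closed]

lemma CC_carrier: "carrier CC = C"
  by (simp add: C_def)

lemma CC_cring: "cring CC"
  by (rule polys_cring[OF unit sigma_closed sigma_center])

lemma CC_field: "field CC"
proof -
  interpret P: cring CC
    by (rule CC_cring)
  have one: "\<^bold>1 \<noteq> \<^bold>0"
    using a_nonzero ab(1) by (metis one_simps(2) zero_mult)
  have "Units CC = carrier CC - {\<zero>\<^bsub>CC\<^esub>}"
  proof (rule Set.set_eqI)
    fix c
    show "c \<in> Units CC \<longleftrightarrow> c \<in> carrier CC - {\<zero>\<^bsub>CC\<^esub>}"
    proof
      assume "c \<in> Units CC"
      then obtain d where cd: "c \<in> C" "d \<in> C" "d \<bullet> c = \<^bold>1"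
        unfolding Units_def CC_simps CC_carrier by blast
      then have "c \<noteq> \<^bold>0"
        using one by (metis C_closed mult_zero)
      then show "c \<in> carrier CC - {\<zero>\<^bsub>CC\<^esub>}"
        using cd by (simp add: CC_simps CC_carrier)
    next
      assume "c \<in> carrier CC - {\<zero>\<^bsub>CC\<^esub>}"
      then have c: "c \<in> C" "c \<noteq> \<^bold>0"
        by (simp_all add: CC_simps CC_carrier)
      then obtain d where d: "d \<in> C" "d \<bullet> c = \<^bold>1"
        using C_inverse by blast
      then show "c \<in> Units CC"
        using c mult_comm[of c d] unfolding Units_def CC_simps CC_carrier by auto
    qed
  qed
  then show ?thesis
    by (rule P.cring_fieldI)
qed

lemma CC_assoc_algebra: "assoc_algebra F CC"
proof (intro assoc_algebra.intro assoc_algebra_axioms.intro na_algebra.intro na_algebra_axioms.intro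
    K.field_axioms moduleI K.is_cring)
  show "abelian_group CC"
    using CC_cring by (simp add: cring_def ring_def)
qed (simp_all add: CC_simps CC_carrier mult_l_distr mult_r_distr mult_l_smult mult_r_smult smult_l_distr smult_r_distr
  smult_assoc1 C_assoc)

lemma CC_simple_field_algebra: "simple_field_algebra F CC \<sigma>"
proof (intro simple_field_algebra.intro simple_field_algebra_axioms.intro field_algebra.intro
    CC_assoc_algebra CC_field)
  show "\<sigma> \<in> carrier CC" "\<sigma> \<noteq> \<zero>\<^bsub>CC\<^esub>" "\<sigma> \<noteq> \<one>\<^bsub>CC\<^esub>"
    using sigma_nonzero sigma_not_one by (simp_all add: CC_simps CC_carrier)
  fix Q
  assume Q: "\<one>\<^bsub>CC\<^esub> \<in> Q" "\<And>x y. \<lbrakk>x \<in> Q; y \<in> Q; x \<in> carrier CC; y \<in> carrier CC\<rbrakk> \<Longrightarrow> x \<oplus>\<^bsub>CC\<^esub> y \<in> Q"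
    "\<And>\<alpha> x. \<lbrakk>\<alpha> \<in> carrier F; x \<in> Q; x \<in> carrier CC\<rbrakk> \<Longrightarrow> \<alpha> \<odot>\<^bsub>CC\<^esub> x \<in> Q"
    "\<And>x. \<lbrakk>x \<in> Q; x \<in> carrier CC\<rbrakk> \<Longrightarrow> x \<otimes>\<^bsub>CC\<^esub> \<sigma> \<in> Q"
  show "carrier CC \<subseteq> Q"
  proof
    fix c
    assume "c \<in> carrier CC"
    then have "c \<in> C"
      by (simp add: CC_carrier)
    then have "c \<in> C \<and> c \<in> Q"
    proof (induction rule: C_induct)
      case one
      show ?case
        using Q(1) by (simp add: CC_simps)
    next
      case (add p q)
      then show ?case
        using Q(2)[of p q] by (simp add: CC_simps CC_carrier)
    next
      case (smult \<alpha> p)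
      then show ?case
        using Q(3)[of \<alpha> p] by (simp add: CC_simps CC_carrier)
    next
      case (mult p)
      then show ?case
        using Q(4)[of p] by (simp add: CC_simps CC_carrier)
    qed
    then show "c \<in> Q" ..
  qed
qed

sublocale A: simple_field_algebra F CC \<sigma>
  by (rule CC_simple_field_algebra)

abbreviation "H \<equiv> sym_algebra F (mat2_algebra CC) A.star"

text \<open>Negation in \<open>CC\<close> is determined within the carrier of \<open>CC\<close>, so
  it has to be compared with negation in \<open>B\<close> before the two constants can be
  identified.\<close>

lemma A_mu: "A.\<mu> = \<mu>"
proof -
  have "\<ominus>\<^bsub>CC\<^esub> \<sigma> = \<boxminus> \<sigma>"
    by (rule A.M.minus_equality) (simp_all add: CC_simps CC_carrier M.l_neg)
  then show ?thesis
    by (simp add: A.\<mu>_def \<mu>_def a_minus_def CC_simps)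
qed

text \<open>A fixed point of the adjoint has its lower left entry determined by the upper right one.
  The three free entries are the coordinates used by \<open>comb\<close>.\<close>

lemma H_carrier: "carrier H = {((p, q), (\<mu> \<bullet> q, r)) | p q r. p \<in> C \<and> q \<in> C \<and> r \<in> C}"
proof (rule Set.set_eqI)
  fix x
  show "x \<in> carrier H \<longleftrightarrow> x \<in> {((p, q), (\<mu> \<bullet> q, r)) | p q r. p \<in> C \<and> q \<in> C \<and> r \<in> C}"
  proof
    assume "x \<in> carrier H"
    then have x: "x \<in> carrier (mat2_algebra CC)" "A.star x = x"
      by (simp_all add: sym_algebra_simps)
    then show "x \<in> {((p, q), (\<mu> \<bullet> q, r)) | p q r. p \<in> C \<and> q \<in> C \<and> r \<in> C}"
      by (elim A.mat2E) (auto simp: A.star_simp A_mu CC_carrier CC_simps)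
  next
    assume "x \<in> {((p, q), (\<mu> \<bullet> q, r)) | p q r. p \<in> C \<and> q \<in> C \<and> r \<in> C}"
    then obtain p q r where x: "x = ((p, q), (\<mu> \<bullet> q, r))" "p \<in> C" "q \<in> C" "r \<in> C"
      by blast
    then show "x \<in> carrier H"
      using A.inv_mu_cancel(1)[of q]
      by (simp add: sym_algebra_simps mat2_simps A.star_simp A_mu CC_carrier CC_simps)
  qed
qed

definition "psi = (\<lambda>((p, q), (s, r)). comb p q r)"

lemma psi_simp: "psi ((p, q), (s, r)) = comb p q r"
  by (simp add: psi_def)

lemma HE:
  assumes "x \<in> carrier H"
  obtains p q r where "x = ((p, q), (\<mu> \<bullet> q, r))" "p \<in> C" "q \<in> C" "r \<in> C"
  using assms unfolding H_carrier by blast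

text \<open>On the diagonal \<open>x y\<close> and \<open>y x\<close> agree, so \<open>half\<close>
  cancels; in the upper right entry it stays and is the \<open>half\<close> of
  \<open>comb_mult\<close>.\<close>

lemma psi_mult:
  assumes x: "x \<in> carrier H" and y: "y \<in> carrier H"
  shows "psi (x \<otimes>\<^bsub>H\<^esub> y) = psi x \<bullet> psi y"
proof -
  obtain p q r where x: "x = ((p, q), (\<mu> \<bullet> q, r))" and pqr: "p \<in> C" "q \<in> C" "r \<in> C"
    using x by (rule HE)
  obtain p' q' r' where y: "y = ((p', q'), (\<mu> \<bullet> q', r'))" and pqr': "p' \<in> C" "q' \<in> C" "r' \<in> C"
    using y by (rule HE)
  have 1: "half \<odot>\<^bsub>B\<^esub> ((p \<bullet> p' \<boxplus> q \<bullet> (\<mu> \<bullet> q')) \<boxplus> (p' \<bullet> p \<boxplus> q' \<bullet> (\<mu> \<bullet> q))) = p \<bullet> p' \<boxplus> (q \<bullet> q') \<bullet> \<mu>"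
    "half \<odot>\<^bsub>B\<^esub> (((\<mu> \<bullet> q) \<bullet> q' \<boxplus> r \<bullet> r') \<boxplus> ((\<mu> \<bullet> q') \<bullet> q \<boxplus> r' \<bullet> r)) = r \<bullet> r' \<boxplus> (q \<bullet> q') \<bullet> \<mu>"
  proof -
    have "q \<bullet> (\<mu> \<bullet> q') = (q \<bullet> q') \<bullet> \<mu>" "q' \<bullet> (\<mu> \<bullet> q) = (q \<bullet> q') \<bullet> \<mu>" "(\<mu> \<bullet> q) \<bullet> q' = (q \<bullet> q') \<bullet> \<mu>"
      "(\<mu> \<bullet> q') \<bullet> q = (q \<bullet> q') \<bullet> \<mu>"
      using pqr pqr' mult_comm[of q' q] by (simp_all add: C_lcomm[OF mu_C] C_assoc[OF mu_C] mult_comm[of _ \<mu>] mult_closed)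
    then show "half \<odot>\<^bsub>B\<^esub> ((p \<bullet> p' \<boxplus> q \<bullet> (\<mu> \<bullet> q')) \<boxplus> (p' \<bullet> p \<boxplus> q' \<bullet> (\<mu> \<bullet> q))) = p \<bullet> p' \<boxplus> (q \<bullet> q') \<bullet> \<mu>"
      "half \<odot>\<^bsub>B\<^esub> (((\<mu> \<bullet> q) \<bullet> q' \<boxplus> r \<bullet> r') \<boxplus> ((\<mu> \<bullet> q') \<bullet> q \<boxplus> r' \<bullet> r)) = r \<bullet> r' \<boxplus> (q \<bullet> q') \<bullet> \<mu>"
      using pqr pqr' half_double[of "p \<bullet> p' \<boxplus> (q \<bullet> q') \<bullet> \<mu>"] half_double[of "(q \<bullet> q') \<bullet> \<mu> \<boxplus> r \<bullet> r'"]
        mult_comm[of p' p] mult_comm[of r' r]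
      by (simp_all add: mult_closed M.a_comm)
  qed
  have 2: "(p \<bullet> q' \<boxplus> q \<bullet> r') \<boxplus> (p' \<bullet> q \<boxplus> q' \<bullet> r) = (p \<bullet> q' \<boxplus> q \<bullet> p') \<boxplus> (q \<bullet> r' \<boxplus> r \<bullet> q')"
    using pqr pqr' mult_comm[of p' q] mult_comm[of q' r] by (simp add: mult_closed M.a_ac)
  show ?thesis
    unfolding x y psi_simp comb_mult[OF pqr pqr'] 1[symmetric] 2[symmetric]
    by (simp add: sym_algebra_simps mat2_simps CC_simps psi_simp)
qed

lemma iso_sym_algebra: "algebra_iso F B H"
proof (rule algebra_iso_sym)
  show "algebra_iso F H B"
    unfolding algebra_iso_def
  proof (intro exI[of _ psi] conjI ballI)
    show "bij_betw psi (carrier H) (carrier B)"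
      unfolding bij_betw_def
    proof
      show "inj_on psi (carrier H)"
      proof (rule inj_onI)
        fix x y
        assume x: "x \<in> carrier H" and y: "y \<in> carrier H" and eq: "psi x = psi y"
        obtain p q r where x: "x = ((p, q), (\<mu> \<bullet> q, r))" and pqr: "p \<in> C" "q \<in> C" "r \<in> C"
          using x by (rule HE)
        obtain p' q' r' where y: "y = ((p', q'), (\<mu> \<bullet> q', r'))" and pqr': "p' \<in> C" "q' \<in> C" "r' \<in> C"
          using y by (rule HE)
        show "x = y"
          using comb_inj[OF pqr pqr'] eq by (simp add: x y psi_simp)
      qed
      show "psi ` carrier H = carrier B"
      proof
        show "psi ` carrier H \<subseteq> carrier B"
          by (auto elim!: HE simp: psi_simp)
        show "carrier B \<subseteq> psi ` carrier H"
        proof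
          fix x
          assume "x \<in> carrier B"
          then obtain p q r where pqr: "p \<in> C" "q \<in> C" "r \<in> C" "x = comb p q r"
            using comb_surj by blast
          show "x \<in> psi ` carrier H"
            by (rule image_eqI[of _ _ "((p, q), (\<mu> \<bullet> q, r))"]) (use pqr in \<open>auto simp: psi_simp H_carrier\<close>)
        qed
      qed
    qed
    show "psi (x \<otimes>\<^bsub>H\<^esub> y) = psi x \<bullet> psi y" if "x \<in> carrier H" "y \<in> carrier H" for x y
      using that by (rule psi_mult)
    show "psi (x \<oplus>\<^bsub>H\<^esub> y) = psi x \<boxplus> psi y" if "x \<in> carrier H" "y \<in> carrier H" for x y
      using that by (elim HE) (simp add: sym_algebra_simps mat2_simps CC_simps psi_simp comb_add)
    show "psi (\<alpha> \<odot>\<^bsub>H\<^esub> x) = \<alpha> \<odot>\<^bsub>B\<^esub> psi x" if "\<alpha> \<in> carrier F" "x \<in> carrier H" for \<alpha> x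
      using that by (elim HE) (simp add: sym_algebra_simps mat2_simps CC_simps psi_simp comb_smult)
  qed
  note cl = A.MM.M.a_closed A.MM.smult_closed A.MM.mult_closed
  fix x
  assume x: "x \<in> carrier H"
  then have x': "x \<in> carrier (mat2_algebra CC)" "A.star x = x"
    by (simp_all add: sym_algebra_simps)
  show "\<alpha> \<odot>\<^bsub>H\<^esub> x \<in> carrier H" if "\<alpha> \<in> carrier F" for \<alpha>
    using that x' by (simp add: sym_algebra_simps A.star_smult cl)
  fix y
  assume y: "y \<in> carrier H"
  then have y': "y \<in> carrier (mat2_algebra CC)" "A.star y = y"
    by (simp_all add: sym_algebra_simps)
  show "x \<oplus>\<^bsub>H\<^esub> y \<in> carrier H"
    using x' y' by (simp add: sym_algebra_simps A.star_add cl)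
  have "A.star (x \<otimes>\<^bsub>mat2_algebra CC\<^esub> y \<oplus>\<^bsub>mat2_algebra CC\<^esub> y \<otimes>\<^bsub>mat2_algebra CC\<^esub> x) =
      x \<otimes>\<^bsub>mat2_algebra CC\<^esub> y \<oplus>\<^bsub>mat2_algebra CC\<^esub> y \<otimes>\<^bsub>mat2_algebra CC\<^esub> x"
    using x' y' by (simp add: A.star_add A.star_mult cl A.MM.M.a_comm)
  then show "x \<otimes>\<^bsub>H\<^esub> y \<in> carrier H"
    using x' y' by (simp add: sym_algebra_simps A.star_smult cl)
qed

end

theorem theorem1p2:
  fixes F :: "('f, 'm) ring_scheme" and J :: "('f, 'j, 'n) module_scheme" and a b \<sigma> :: 'j
  assumes jordan: "jordan_algebra F J"
    and char_not_2: "\<one>\<^bsub>F\<^esub> \<oplus>\<^bsub>F\<^esub> \<one>\<^bsub>F\<^esub> \<noteq> \<zero>\<^bsub>F\<^esub>"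
    and generated: "generated_by_idempotents F J a b"
    and sigma: "\<sigma> = (a \<ominus>\<^bsub>J\<^esub> b) \<otimes>\<^bsub>J\<^esub> (a \<ominus>\<^bsub>J\<^esub> b)"
  shows "\<sigma> \<in> center J \<and>
    spanned_by3 (polys F (unital_hull F J) (hull_emb F \<sigma>)) (hull_action_module F J)
      (hull_emb F a) (hull_emb F b) (hull_emb F \<sigma>) \<and>
    (simple_algebra F J \<longrightarrow>
       is_scalar_algebra F J \<or>
       (\<exists>(A :: ('f, ('j \<times> 'j) \<times> ('j \<times> 'j)) module) e f star \<sigma>\<^sub>A.
          assoc_algebra F A \<and> simple_algebra F A \<and> generated_by_idempotents F A e f \<and>
          \<sigma>\<^sub>A = (e \<ominus>\<^bsub>A\<^esub> f) \<otimes>\<^bsub>A\<^esub> (e \<ominus>\<^bsub>A\<^esub> f) \<and>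
          is_identity A \<one>\<^bsub>A\<^esub> \<and> field (polys F A \<sigma>\<^sub>A) \<and>
          (is_scalar_algebra F A \<or> algebra_iso F A (mat2_algebra (polys F A \<sigma>\<^sub>A))) \<and>
          involution F A star \<and>
          (\<forall>\<alpha>\<^sub>1\<in>carrier (polys F A \<sigma>\<^sub>A). \<forall>\<alpha>\<^sub>2\<in>carrier (polys F A \<sigma>\<^sub>A).
           \<forall>\<alpha>\<^sub>3\<in>carrier (polys F A \<sigma>\<^sub>A). \<forall>\<alpha>\<^sub>4\<in>carrier (polys F A \<sigma>\<^sub>A).
             star (\<alpha>\<^sub>1 \<otimes>\<^bsub>A\<^esub> \<sigma>\<^sub>A \<oplus>\<^bsub>A\<^esub> \<alpha>\<^sub>2 \<otimes>\<^bsub>A\<^esub> e \<oplus>\<^bsub>A\<^esub> \<alpha>\<^sub>3 \<otimes>\<^bsub>A\<^esub> f \<oplus>\<^bsub>A\<^esub> \<alpha>\<^sub>4 \<otimes>\<^bsub>A\<^esub> (e \<otimes>\<^bsub>A\<^esub> f))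
             = \<alpha>\<^sub>1 \<otimes>\<^bsub>A\<^esub> \<sigma>\<^sub>A \<oplus>\<^bsub>A\<^esub> \<alpha>\<^sub>2 \<otimes>\<^bsub>A\<^esub> e \<oplus>\<^bsub>A\<^esub> \<alpha>\<^sub>3 \<otimes>\<^bsub>A\<^esub> f \<oplus>\<^bsub>A\<^esub> \<alpha>\<^sub>4 \<otimes>\<^bsub>A\<^esub> (f \<otimes>\<^bsub>A\<^esub> e)) \<and>
          algebra_iso F J (sym_algebra F A star)))"
proof -
  interpret jordan_two_idempotents F J a b \<sigma>
    by (intro jordan_two_idempotents.intro jordan_two_idempotents_axioms.intro jordan char_not_2 generated sigma)
  show ?thesis
  proof (intro conjI impI)
    show "\<sigma> \<in> center J"
      by (rule sigma_center)
    show "spanned_by3 (polys F (unital_hull F J) (hull_emb F \<sigma>)) (hull_action_module F J)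
        (hull_emb F a) (hull_emb F b) (hull_emb F \<sigma>)"
      by (rule spanned_by_a_b_sigma)
    assume simple: "simple_algebra F J"
    obtain u where u: "is_identity J u"
      using simple_unital[OF simple] .
    \<comment> \<open>The field \<open>one\<close> of \<open>J\<close> is arbitrary, so the identity
      just found is stored there. The \<open>one_update\<close> lemmas carry the hypotheses over to
      \<open>?J\<close> and the isomorphism back to \<open>J\<close>.\<close>
    let ?J = "J\<lparr>monoid.one := u\<rparr>"
    show "is_scalar_algebra F J \<or>
       (\<exists>(A :: ('f, ('j \<times> 'j) \<times> ('j \<times> 'j)) module) e f star \<sigma>\<^sub>A.
          assoc_algebra F A \<and> simple_algebra F A \<and> generated_by_idempotents F A e f \<and>
          \<sigma>\<^sub>A = (e \<ominus>\<^bsub>A\<^esub> f) \<otimes>\<^bsub>A\<^esub> (e \<ominus>\<^bsub>A\<^esub> f) \<and>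
          is_identity A \<one>\<^bsub>A\<^esub> \<and> field (polys F A \<sigma>\<^sub>A) \<and>
          (is_scalar_algebra F A \<or> algebra_iso F A (mat2_algebra (polys F A \<sigma>\<^sub>A))) \<and>
          involution F A star \<and>
          (\<forall>\<alpha>\<^sub>1\<in>carrier (polys F A \<sigma>\<^sub>A). \<forall>\<alpha>\<^sub>2\<in>carrier (polys F A \<sigma>\<^sub>A).
           \<forall>\<alpha>\<^sub>3\<in>carrier (polys F A \<sigma>\<^sub>A). \<forall>\<alpha>\<^sub>4\<in>carrier (polys F A \<sigma>\<^sub>A).
             star (\<alpha>\<^sub>1 \<otimes>\<^bsub>A\<^esub> \<sigma>\<^sub>A \<oplus>\<^bsub>A\<^esub> \<alpha>\<^sub>2 \<otimes>\<^bsub>A\<^esub> e \<oplus>\<^bsub>A\<^esub> \<alpha>\<^sub>3 \<otimes>\<^bsub>A\<^esub> f \<oplus>\<^bsub>A\<^esub> \<alpha>\<^sub>4 \<otimes>\<^bsub>A\<^esub> (e \<otimes>\<^bsub>A\<^esub> f))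
             = \<alpha>\<^sub>1 \<otimes>\<^bsub>A\<^esub> \<sigma>\<^sub>A \<oplus>\<^bsub>A\<^esub> \<alpha>\<^sub>2 \<otimes>\<^bsub>A\<^esub> e \<oplus>\<^bsub>A\<^esub> \<alpha>\<^sub>3 \<otimes>\<^bsub>A\<^esub> f \<oplus>\<^bsub>A\<^esub> \<alpha>\<^sub>4 \<otimes>\<^bsub>A\<^esub> (f \<otimes>\<^bsub>A\<^esub> e)) \<and>
          algebra_iso F J (sym_algebra F A star))"
    \<comment> \<open>A zero idempotent leaves a one-dimensional algebra. Otherwise both idempotents
      are nonzero, which the coordinates rely on: \<open>a\<close> for the inverses in F[\<sigma>],
      \<open>b\<close> for \<open>h\<close> being nonzero.\<close>
    proof (cases "a = \<zero>\<^bsub>J\<^esub> \<or> b = \<zero>\<^bsub>J\<^esub>")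
      case True
      then show ?thesis
        using scalar_if_zero_idempotent by blast
    next
      case False
      interpret U: jordan_simple_unital F ?J a b \<sigma>
      proof (intro jordan_simple_unital.intro jordan_simple_unital_axioms.intro jordan_two_idempotents.intro
          jordan_two_idempotents_axioms.intro)
        show "jordan_algebra F ?J"
          by (rule jordan_algebra_one_update[OF jordan])
        show "is_identity ?J \<one>\<^bsub>?J\<^esub>"
          using u by (simp add: is_identity_def)
      qed (use False char_not_2 generated simple sigma_def in
        \<open>simp_all add: generated_by_idempotents_one_update simple_algebra_one_update a_minus_one_update\<close>)
      \<comment> \<open>The witnesses for \<open>e\<close> and \<open>f\<close> are the matrices
        that correspond to \<open>a\<close> and \<open>b\<close>, so their squared difference is the
        scalar matrix of \<sigma>.\<close>
      let ?A = "mat2_algebra (polys F ?J \<sigma>)"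
      show ?thesis
      proof (rule disjI2, rule exI[of _ ?A], rule exI[of _ U.A.idem_e], rule exI[of _ U.A.idem_f],
          rule exI[of _ U.A.star], rule exI[of _ "U.A.scal \<sigma>"], intro conjI ballI disjI2)
        show "assoc_algebra F ?A" "simple_algebra F ?A" "generated_by_idempotents F ?A U.A.idem_e U.A.idem_f"
          "is_identity ?A \<one>\<^bsub>?A\<^esub>" "field (polys F ?A (U.A.scal \<sigma>))" "involution F ?A U.A.star"
          by (rule U.A.mat2_assoc_algebra U.A.mat2_simple U.A.idem_generated U.A.mat2_identity
            U.A.polys_scal_field U.A.star_involution)+
        show "U.A.scal \<sigma> = (U.A.idem_e \<ominus>\<^bsub>?A\<^esub> U.A.idem_f) \<otimes>\<^bsub>?A\<^esub> (U.A.idem_e \<ominus>\<^bsub>?A\<^esub> U.A.idem_f)"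
          by (rule U.A.idem_sigma[symmetric])
        show "algebra_iso F ?A (mat2_algebra (polys F ?A (U.A.scal \<sigma>)))"
          by (rule U.A.mat2_iso_polys)
        show "algebra_iso F J (sym_algebra F ?A U.A.star)"
          using U.iso_sym_algebra by (simp only: algebra_iso_one_update)
      qed (rule U.A.star_formula)
    qed
  qed
qed

end
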